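(* Let $p_1$ and $p_2$ denote the projections of $\mathbb{R}^d \times \mathbb{R}$ onto $\mathbb{R}^d$ and $\mathbb{R}$, respectively. Let $\Gamma$ be a lattice in $\mathbb{R}^d \times \mathbb{R}$ such that the restrictions of $p_1$ and $p_2$ to $\Gamma$ are injective, and such that $p_1(\Gamma)$ and $p_2(\Gamma)$ are dense in $\mathbb{R}^d$ and $\mathbb{R}$, respectively. Let $I \subseteq \mathbb{R}$ be a half-open interval with $|I| \notin p_2(\Gamma)$, and let $$\Lambda = \Lambda(\Gamma, I) = \{ p_1(\gamma) : \gamma \in \Gamma,\ p_2(\gamma) \in I\}.$$ If $S \subseteq \mathbb{R}^d$ is a Riemann measurable set with $$\frac{|I|}{\operatorname{covol}(\Gamma)} = |S|,$$ then $E(\Lambda)$ cannot be a frame for $L^2(S)$, nor a Riesz sequence in $L^2(S)$.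
   Context: $|\cdot|$ denotes Lebesgue measure (so $|I|$ is the length of the bounded interval $I$), and $\operatorname{covol}(\Gamma)$ is the covolume of the lattice $\Gamma$, i.e. the Lebesgue measure of a fundamental domain of $\Gamma$ in $\mathbb{R}^d\times\mathbb{R}$. A set $S \subseteq \mathbb{R}^d$ is Riemann measurable if it is bounded and its boundary has Lebesgue measure zero. For $\lambda \in \mathbb{R}^d$ let $e_\lambda(t) = e^{2\pi i \lambda \cdot t}$, $t \in S$, regarded as an element of $L^2(S)$, and $E(\Lambda) = \{e_\lambda : \lambda \in \Lambda\}$. $E(\Lambda)$ is a frame for $L^2(S)$ if there are $0<A\le B<\infty$ with $A\|f\|^2 \le \sum_{\lambda\in\Lambda} |\langle f, e_\lambda\rangle|^2 \le B\|f\|^2$ for all $f \in L^2(S)$. It is a Riesz sequence in $L^2(S)$ if there are $0<A\le B<\infty$ with $A\|c\|_{\ell^2(\Lambda)}^2 \le \|\sum_{\lambda\in\Lambda} c_\lambda e_\lambda\|^2 \le B\|c\|_{\ell^2(\Lambda)}^2$ for all $c \in \ell^2(\Lambda)$. *)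

theory Defs
  imports "HOL-Analysis.Analysis"
begin

definition is_lattice :: "'a::euclidean_space set \<Rightarrow> bool" where
  "is_lattice \<Gamma> \<longleftrightarrow>
     (\<exists>B. independent B \<and> span B = UNIV \<and>
          \<Gamma> = {\<Sum>b\<in>B. of_int (k b) *\<^sub>R b | k :: 'a \<Rightarrow> int. True})"

definition fundamental_domain :: "'a::euclidean_space set \<Rightarrow> 'a set \<Rightarrow> bool" where
  "fundamental_domain \<Gamma> F \<longleftrightarrow>
     F \<in> sets lebesgue \<and> (\<forall>x. \<exists>!\<gamma>. \<gamma> \<in> \<Gamma> \<and> x - \<gamma> \<in> F)"

text \<open>All fundamental domains of a lattice have the same (finite, positive) measure, so the choice
  is immaterial.\<close>

definition covol :: "'a::euclidean_space set \<Rightarrow> real" where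
  "covol \<Gamma> = measure lebesgue (SOME F. fundamental_domain \<Gamma> F)"

definition half_open_interval :: "real set \<Rightarrow> bool" where
  "half_open_interval I \<longleftrightarrow> (\<exists>a b. a < b \<and> (I = {a..<b} \<or> I = {a<..b}))"

definition cut_project_set :: "('a \<times> real) set \<Rightarrow> real set \<Rightarrow> 'a set" where
  "cut_project_set \<Gamma> I = {fst \<gamma> | \<gamma>. \<gamma> \<in> \<Gamma> \<and> snd \<gamma> \<in> I}"

definition Riemann_measurable :: "'a::euclidean_space set \<Rightarrow> bool" where
  "Riemann_measurable S \<longleftrightarrow> bounded S \<and> emeasure lebesgue (frontier S) = 0"

definition expo :: "'a::euclidean_space \<Rightarrow> 'a \<Rightarrow> complex" where
  "expo l t = exp (2 * of_real pi * \<i> * of_real (l \<bullet> t))"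

text \<open>Elements of $L^2(S)$ are represented by functions, without passing to classes modulo equality
  almost everywhere: the inner product and the (semi)norm depend only on the class, and
  values outside \<open>S\<close> are irrelevant.\<close>

definition L2 :: "'a::euclidean_space set \<Rightarrow> ('a \<Rightarrow> complex) set" where
  "L2 S = {f. f \<in> borel_measurable (lebesgue_on S) \<and>
              integrable (lebesgue_on S) (\<lambda>t. (cmod (f t))\<^sup>2)}"

definition L2_inner :: "'a::euclidean_space set \<Rightarrow> ('a \<Rightarrow> complex) \<Rightarrow> ('a \<Rightarrow> complex) \<Rightarrow> complex" where
  "L2_inner S f g = (LINT t|lebesgue_on S. f t * cnj (g t))"

definition L2_norm :: "'a::euclidean_space set \<Rightarrow> ('a \<Rightarrow> complex) \<Rightarrow> real" where
  "L2_norm S f = sqrt (LINT t|lebesgue_on S. (cmod (f t))\<^sup>2)"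

text \<open>Both notions below are for a family \<open>e\<close> indexed by the set \<open>J\<close>. Since \<open>infsum\<close> is 0 for a
  divergent family, finiteness of the frame sum is required explicitly.\<close>

definition is_frame :: "'a::euclidean_space set \<Rightarrow> 'i set \<Rightarrow> ('i \<Rightarrow> 'a \<Rightarrow> complex) \<Rightarrow> bool" where
  "is_frame S J e \<longleftrightarrow>
     (\<exists>A B. 0 < A \<and> A \<le> B \<and>
        (\<forall>f\<in>L2 S.
           (\<lambda>j. (cmod (L2_inner S f (e j)))\<^sup>2) summable_on J \<and>
           A * (L2_norm S f)\<^sup>2 \<le> (\<Sum>\<^sub>\<infinity>j\<in>J. (cmod (L2_inner S f (e j)))\<^sup>2) \<and>
           (\<Sum>\<^sub>\<infinity>j\<in>J. (cmod (L2_inner S f (e j)))\<^sup>2) \<le> B * (L2_norm S f)\<^sup>2))"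

text \<open>\<open>F\<close> is the sum of the family \<open>g\<close> in $L^2(S)$: the finite partial sums converge to \<open>F\<close> in norm,
  unconditionally. Such an \<open>F\<close> is unique up to equality almost everywhere on \<open>S\<close>.\<close>

definition has_L2_sum ::
    "'a::euclidean_space set \<Rightarrow> 'i set \<Rightarrow> ('i \<Rightarrow> 'a \<Rightarrow> complex) \<Rightarrow> ('a \<Rightarrow> complex) \<Rightarrow> bool" where
  "has_L2_sum S J g F \<longleftrightarrow>
     F \<in> L2 S \<and>
     ((\<lambda>X. L2_norm S (\<lambda>t. (\<Sum>j\<in>X. g j t) - F t)) \<longlongrightarrow> 0) (finite_subsets_at_top J)"

definition ell2 :: "'i set \<Rightarrow> ('i \<Rightarrow> complex) set" where
  "ell2 J = {c. (\<lambda>j. (cmod (c j))\<^sup>2) summable_on J}"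

definition ell2_norm :: "'i set \<Rightarrow> ('i \<Rightarrow> complex) \<Rightarrow> real" where
  "ell2_norm J c = sqrt (\<Sum>\<^sub>\<infinity>j\<in>J. (cmod (c j))\<^sup>2)"

definition is_Riesz_sequence ::
    "'a::euclidean_space set \<Rightarrow> 'i set \<Rightarrow> ('i \<Rightarrow> 'a \<Rightarrow> complex) \<Rightarrow> bool" where
  "is_Riesz_sequence S J e \<longleftrightarrow>
     (\<exists>A B. 0 < A \<and> A \<le> B \<and>
        (\<forall>c\<in>ell2 J. \<exists>F. has_L2_sum S J (\<lambda>j t. c j * e j t) F \<and>
           A * (ell2_norm J c)\<^sup>2 \<le> (L2_norm S F)\<^sup>2 \<and>
           (L2_norm S F)\<^sup>2 \<le> B * (ell2_norm J c)\<^sup>2))"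

end

theory Submission
  imports Defs "HOL-Probability.Probability"
begin

text \<open>Let \<open>l\<close> be the length of the window and write \<open>model {s..<s + l}\<close> for the model sets whose window
is \<open>{s..<s + l}\<close>. Since \<open>snd ` \<Gamma>\<close> is dense, a finite piece of any of them is a translate of a
finite piece of the given set \<open>\<Lambda>\<close>, whichever end point the interval \<open>I\<close> contains
(\<open>window_shift\<close>, \<open>pattern_shift\<close>). Multiplication by an exponential translates frequencies and is
unitary, so all these sets inherit the bounds of \<open>\<Lambda>\<close>. Now move the window \<open>{0..<l}\<close> slightly to the
right: the frequency \<open>0\<close> drops out, and because \<open>l\<close> is not in \<open>snd ` \<Gamma>\<close>, nothing enters inside any
given ball (\<open>window_leaves_zero\<close>). So there are two sets of frequencies that differ by the single
point \<open>0\<close> as far as one can see, and both are frames, or both are Riesz sequences. In the first case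
\<open>0\<close> is a redundant element of the larger set (\<open>redundancy\<close>); in the second case \<open>expo 0\<close> keeps a
positive distance from the span of the smaller one (\<open>Riesz_gap\<close>). By the lattice structure,
places with this defect occur with positive density. A frame with redundant elements must have
density larger than \<open>|S|\<close>, and a Riesz sequence with gaps density smaller than \<open>|S|\<close>, while the
hypothesis makes the density exactly \<open>|S|\<close>.

To turn this into a proof, let \<open>ridge \<tau> X f\<close> be the minimum over \<open>c\<close> of
\<open>\<parallel>f - (\<Sum>x\<in>X. c x * expo x)\<parallel>\<^sup>2 + \<tau> * (\<Sum>x\<in>X. \<bar>c x\<bar>\<^sup>2)\<close>, for a finite set \<open>X\<close> of frequencies. The trace identity
(\<open>ridge_trace\<close>), which rests on Plancherel's theorem, says that
\<open>\<integral>x. (|S| - ridge \<tau> X (expo x)) = (\<Sum>x\<in>X. ridge \<tau> X (expo x) / \<tau>)\<close>. Take for \<open>X\<close> the points of a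
model set in a large ball. For a frame, the integrand is almost \<open>|S|\<close> in the ball,
and each term of the sum is at most \<open>1\<close>, and at most \<open>1 - \<kappa> / 2\<close> at redundant points. For a
Riesz sequence, each term is almost \<open>1\<close>, and the integrand is at most \<open>|S|\<close>, at most \<open>|S| - \<kappa>\<close>
near the gaps, and negligible outside the ball.

Both estimates hold with the same constants for every translate of the lattice. So
they may be averaged over the translations \<open>z\<close> in a fundamental cell, and the mean number of
lattice points in \<open>E - z\<close> is exactly \<open>|E| / covol \<Gamma>\<close> (\<open>average_hits\<close>). Letting the radius tend to infinity gives \<open>|S| covol \<Gamma> < l\<close>
for frames (\<open>no_critical_frame\<close>) and \<open>l < |S| covol \<Gamma>\<close> for Riesz sequences (\<open>no_critical_Riesz\<close>).

For frames one has to approximate by finite linear combinations, with a radius that does not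
depend on the position in the model set. This is done by the frame algorithm: its steps only look at
finite patches, and only finitely many patches of a given radius occur while the window position
varies in a bounded range (\<open>approx_steps\<close>).\<close>

section \<open>Exponentials\<close>

lemma cont_expo [simp, continuous_intros]: "continuous_on A (expo l)"
  unfolding expo_def[abs_def] by (intro continuous_intros)

lemma cmod_expo [simp]: "cmod (expo l t) = 1"
proof -
  have "expo l t = exp (\<i> * complex_of_real (2 * pi * (l \<bullet> t)))"
    by (simp add: expo_def mult.commute mult.left_commute)
  then show ?thesis by (simp only: norm_exp_i_times)
qed

lemma expo_add: "expo (l + m) t = expo l t * expo m t"
  by (simp add: expo_def inner_add_left distrib_left flip: exp_add)

lemma cnj_expo: "cnj (expo l t) = expo (- l) t"
  by (simp add: expo_def exp_cnj)

lemma expo_0 [simp]: "expo 0 t = 1"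
  by (simp add: expo_def)

section \<open>The inner product on continuous functions\<close>

locale bounded_measurable =
  fixes S :: "'a::euclidean_space set"
  assumes S_bounded: "bounded S" and S_sets [measurable]: "S \<in> sets lebesgue"
begin

abbreviation ip :: "('a \<Rightarrow> complex) \<Rightarrow> ('a \<Rightarrow> complex) \<Rightarrow> complex" where
  "ip \<equiv> L2_inner S"

abbreviation nrm :: "('a \<Rightarrow> complex) \<Rightarrow> real" where
  "nrm \<equiv> L2_norm S"

abbreviation cont :: "('a \<Rightarrow> complex) \<Rightarrow> bool" where
  "cont f \<equiv> continuous_on UNIV f"

lemma S_lmeasurable: "S \<in> lmeasurable"
  using S_bounded S_sets by (simp add: bounded_set_imp_lmeasurable)

lemma integrable_cont:
  fixes f :: "'a \<Rightarrow> 'b::{banach, second_countable_topology}"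
  assumes "continuous_on UNIV f"
  shows "integrable (lebesgue_on S) f"
proof -
  interpret finite_measure "lebesgue_on S"
    using S_lmeasurable finite_measure_lebesgue_on by blast
  have "compact (f ` closure S)"
    using S_bounded assms
    by (intro compact_continuous_image continuous_on_subset[OF assms]) auto
  then have "bounded (f ` closure S)" by (rule compact_imp_bounded)
  then obtain K where K: "\<And>x. x \<in> closure S \<Longrightarrow> norm (f x) \<le> K"
    by (auto simp: bounded_iff)
  have "f \<in> borel_measurable lborel"
    using assms borel_measurable_continuous_onI by (simp)
  then have "f \<in> borel_measurable lebesgue"
    by (rule measurable_completion)
  then have m: "f \<in> borel_measurable (lebesgue_on S)"
    by (simp add: measurable_restrict_space1)
  have "AE x in lebesgue_on S. norm (f x) \<le> K"
    using K closure_subset by (intro AE_I2) (auto simp: space_restrict_space)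
  then show ?thesis
    using integrable_const_bound m by blast
qed

lemma cont_L2:
  assumes "cont f"
  shows "f \<in> L2 S"
proof -
  have "integrable (lebesgue_on S) (\<lambda>t. (cmod (f t))\<^sup>2)"
    by (intro integrable_cont continuous_intros assms)
  moreover have "f \<in> borel_measurable (lebesgue_on S)"
    using integrable_cont[OF assms] by auto
  ultimately show ?thesis by (simp add: L2_def)
qed

lemma ip_integrable:
  assumes "cont f" "cont g"
  shows "integrable (lebesgue_on S) (\<lambda>t. f t * cnj (g t))"
  by (intro integrable_cont continuous_intros assms)

lemma ip_commute: "ip g f = cnj (ip f g)"
proof -
  have "cnj (ip f g) = (LINT t|lebesgue_on S. cnj (f t * cnj (g t)))"
    unfolding L2_inner_def by (rule Bochner_Integration.integral_cnj[symmetric])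
  then show ?thesis by (simp add: L2_inner_def mult.commute)
qed

lemma ip_add_left:
  assumes "cont f" "cont g" "cont h"
  shows "ip (\<lambda>t. f t + g t) h = ip f h + ip g h"
  using Bochner_Integration.integral_add[OF ip_integrable[OF assms(1,3)] ip_integrable[OF assms(2,3)]]
  by (simp add: L2_inner_def distrib_right)

lemma ip_diff_left:
  assumes "cont f" "cont g" "cont h"
  shows "ip (\<lambda>t. f t - g t) h = ip f h - ip g h"
  using Bochner_Integration.integral_diff[OF ip_integrable[OF assms(1,3)] ip_integrable[OF assms(2,3)]]
  by (simp add: L2_inner_def left_diff_distrib)

lemma ip_scale_left: "ip (\<lambda>t. c * f t) h = c * ip f h"
  by (simp add: L2_inner_def mult.assoc)

lemma ip_sum_left:
  assumes "finite X" "\<And>j. j \<in> X \<Longrightarrow> cont (f j)" "cont h"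
  shows "ip (\<lambda>t. \<Sum>j\<in>X. c j * f j t) h = (\<Sum>j\<in>X. c j * ip (f j) h)"
proof -
  have "ip (\<lambda>t. \<Sum>j\<in>X. c j * f j t) h = (LINT t|lebesgue_on S. (\<Sum>j\<in>X. c j * (f j t * cnj (h t))))"
    by (simp add: L2_inner_def sum_distrib_right mult.assoc)
  also have "\<dots> = (\<Sum>j\<in>X. (LINT t|lebesgue_on S. c j * (f j t * cnj (h t))))"
    by (rule Bochner_Integration.integral_sum)
      (intro integrable_mult_right ip_integrable assms)
  finally show ?thesis by (simp add: L2_inner_def)
qed

lemma ip_add_right:
  assumes "cont f" "cont g" "cont h"
  shows "ip h (\<lambda>t. f t + g t) = ip h f + ip h g"
  using ip_add_left[OF assms] by (metis ip_commute complex_cnj_add)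

lemma ip_diff_right:
  assumes "cont f" "cont g" "cont h"
  shows "ip h (\<lambda>t. f t - g t) = ip h f - ip h g"
  using ip_diff_left[OF assms] by (metis ip_commute complex_cnj_diff)

lemma ip_scale_right: "ip h (\<lambda>t. c * f t) = cnj c * ip h f"
  using ip_scale_left[of c f h] by (metis ip_commute complex_cnj_mult)

lemma nrm_nonneg: "0 \<le> nrm f"
  by (simp add: L2_norm_def)

lemma nrm_sq: "(nrm f)\<^sup>2 = (LINT t|lebesgue_on S. (cmod (f t))\<^sup>2)"
  by (simp add: L2_norm_def)

lemma ip_self: "ip f f = complex_of_real ((nrm f)\<^sup>2)"
proof -
  have "ip f f = (LINT t|lebesgue_on S. complex_of_real ((cmod (f t))\<^sup>2))"
    by (simp only: L2_inner_def complex_norm_square)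
  then show ?thesis by (simp only: integral_complex_of_real nrm_sq)
qed

lemma nrm_sq_diff:
  assumes "cont f" "cont g"
  shows "(nrm (\<lambda>t. f t - g t))\<^sup>2 = (nrm f)\<^sup>2 - 2 * Re (ip f g) + (nrm g)\<^sup>2"
proof -
  have c: "cont (\<lambda>t. f t - g t)" by (intro continuous_intros assms)
  have "complex_of_real ((nrm (\<lambda>t. f t - g t))\<^sup>2) = ip f f - ip f g - ip g f + ip g g"
    unfolding ip_self[symmetric]
    by (simp add: ip_diff_left ip_diff_right assms c)
  also have "\<dots> = complex_of_real ((nrm f)\<^sup>2 + (nrm g)\<^sup>2) - (ip f g + cnj (ip f g))"
    by (simp add: ip_self ip_commute[of g f])
  also have "\<dots> = complex_of_real ((nrm f)\<^sup>2 - 2 * Re (ip f g) + (nrm g)\<^sup>2)"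
    by (simp add: complex_add_cnj)
  finally show ?thesis using of_real_eq_iff by blast
qed

lemma nrm_scale: "nrm (\<lambda>t. c * f t) = cmod c * nrm f"
  by (simp add: L2_norm_def norm_mult power_mult_distrib real_sqrt_mult)

text \<open>A near minimiser of the distance to a line is nearly orthogonal to it: compare \<open>w\<close> with
\<open>w - z v\<close> for the \<open>z\<close> that minimises the norm. With \<open>D = 0\<close> this is the Cauchy-Schwarz inequality.\<close>

lemma inner_le_of_distance:
  assumes "cont w" "cont v" and D: "\<And>z. D \<le> (nrm (\<lambda>t. w t - z * v t))\<^sup>2"
  shows "(cmod (ip w v))\<^sup>2 \<le> ((nrm w)\<^sup>2 - D) * (nrm v)\<^sup>2"
proof -
  define p where "p = ip w v"
  have expand: "D \<le> (nrm w)\<^sup>2 - 2 * T * (cmod p)\<^sup>2 + T\<^sup>2 * (cmod p)\<^sup>2 * (nrm v)\<^sup>2" for T :: real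
  proof -
    let ?z = "complex_of_real T * p"
    have "(nrm (\<lambda>t. w t - ?z * v t))\<^sup>2 = (nrm w)\<^sup>2 - 2 * Re (ip w (\<lambda>t. ?z * v t)) + (nrm (\<lambda>t. ?z * v t))\<^sup>2"
      by (rule nrm_sq_diff) (intro continuous_intros assms)+
    also have "ip w (\<lambda>t. ?z * v t) = T * (p * cnj p)"
      using ip_scale_right[of w ?z v] by (simp add: p_def)
    also have "\<dots> = complex_of_real (T * (cmod p)\<^sup>2)"
      by (simp add: complex_norm_square[symmetric])
    finally show ?thesis
      using D[of ?z] by (simp add: nrm_scale norm_mult power_mult_distrib)
  qed
  show ?thesis
  proof (cases "(nrm v)\<^sup>2 = 0")
    case True
    have "(cmod p)\<^sup>2 = 0"
    proof (rule ccontr)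
      assume n: "(cmod p)\<^sup>2 \<noteq> 0"
      have "D \<le> (nrm w)\<^sup>2 - 2 * T * (cmod p)\<^sup>2" for T
        using expand[of T] True by simp
      from this[of "((nrm w)\<^sup>2 - D + 1) / (2 * (cmod p)\<^sup>2)"] n show False by (simp add: field_simps)
    qed
    then show ?thesis using True p_def by simp
  next
    case False
    then have pos: "(nrm v)\<^sup>2 > 0" by (simp add: order.strict_iff_order)
    have "D \<le> W - P / G" if "D \<le> W - 2 * (1 / G) * P + (1 / G)\<^sup>2 * P * G" "G > 0" for W P G :: real
      using that by (simp add: power2_eq_square field_simps)
    from this[OF expand pos]
    have "D \<le> (nrm w)\<^sup>2 - (cmod p)\<^sup>2 / (nrm v)\<^sup>2" .
    then show ?thesis using pos unfolding p_def by (simp add: field_simps)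
  qed
qed

lemma Cauchy_Schwarz:
  assumes "cont f" "cont g"
  shows "cmod (ip f g) \<le> nrm f * nrm g"
proof (rule power2_le_imp_le)
  show "(cmod (ip f g))\<^sup>2 \<le> (nrm f * nrm g)\<^sup>2"
    using inner_le_of_distance[OF assms, of 0] by (simp add: power_mult_distrib)
qed (simp add: nrm_nonneg)

lemma nrm_triangle:
  assumes "cont f" "cont g"
  shows "nrm (\<lambda>t. f t + g t) \<le> nrm f + nrm g"
proof (rule power2_le_imp_le)
  have "(nrm (\<lambda>t. f t - (- 1) * g t))\<^sup>2 = (nrm f)\<^sup>2 - 2 * Re (ip f (\<lambda>t. (- 1) * g t)) + (nrm (\<lambda>t. (- 1) * g t))\<^sup>2"
    by (rule nrm_sq_diff) (intro continuous_intros assms)+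
  then have "(nrm (\<lambda>t. f t + g t))\<^sup>2 = (nrm f)\<^sup>2 + 2 * Re (ip f g) + (nrm g)\<^sup>2"
    using nrm_scale[of "-1" g] ip_scale_right[of f "-1" g] by simp
  also have "Re (ip f g) \<le> nrm f * nrm g"
    using Cauchy_Schwarz[OF assms] complex_Re_le_cmod order_trans by blast
  finally show "(nrm (\<lambda>t. f t + g t))\<^sup>2 \<le> (nrm f + nrm g)\<^sup>2"
    by (simp add: power2_sum)
qed (simp add: nrm_nonneg)

lemma nrm_triangle_diff:
  assumes "cont f" "cont g"
  shows "nrm (\<lambda>t. f t - g t) \<le> nrm f + nrm g"
  using nrm_triangle[OF assms(1), of "\<lambda>t. (-1) * g t"] nrm_scale[of "-1" g] assms
  by (simp add: continuous_on_minus)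


section \<open>Trigonometric polynomials and Bessel sequences\<close>

lemma nrm_expo: "(nrm (expo l))\<^sup>2 = measure lebesgue S"
  by (simp add: nrm_sq measure_restrict_space)

lemma nrm_expo_eq: "nrm (expo x) = sqrt (measure lebesgue S)"
  using nrm_expo[of x] nrm_nonneg[of "expo x"] by (simp add: real_sqrt_unique)

lemma ip_modulate: "ip (\<lambda>t. expo x t * f t) (\<lambda>t. expo x t * g t) = ip f g"
proof -
  have "expo x t * f t * cnj (expo x t * g t) = f t * cnj (g t)" for t
  proof -
    have "expo x t * f t * cnj (expo x t * g t) = (expo x t * cnj (expo x t)) * (f t * cnj (g t))"
      by simp
    also have "expo x t * cnj (expo x t) = 1"
      by (simp add: complex_norm_square[symmetric])
    finally show ?thesis by simp
  qed
  then show ?thesis unfolding L2_inner_def by presburger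
qed

lemma nrm_modulate: "nrm (\<lambda>t. expo x t * f t) = nrm f"
  by (simp add: L2_norm_def norm_mult)

definition trig_poly :: "'a set \<Rightarrow> ('a \<Rightarrow> complex) \<Rightarrow> 'a \<Rightarrow> complex" where
  "trig_poly X c = (\<lambda>t. \<Sum>l\<in>X. c l * expo l t)"

lemma cont_trig_poly [simp, continuous_intros]: "continuous_on A (trig_poly X c)"
  unfolding trig_poly_def by (intro continuous_intros)

lemma ip_trig_poly_left: "finite X \<Longrightarrow> cont f \<Longrightarrow> ip (trig_poly X c) f = (\<Sum>l\<in>X. c l * ip (expo l) f)"
  unfolding trig_poly_def by (rule ip_sum_left) auto

lemma ip_trig_poly_right: "finite X \<Longrightarrow> cont f \<Longrightarrow> ip f (trig_poly X c) = (\<Sum>l\<in>X. cnj (c l) * ip f (expo l))"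
  by (subst ip_commute) (simp add: ip_trig_poly_left ip_commute[of f])

lemma trig_poly_diff: "trig_poly X c t - trig_poly X d t = trig_poly X (\<lambda>l. c l - d l) t"
  by (simp add: trig_poly_def sum_subtractf left_diff_distrib)

lemma trig_poly_cong: "(\<And>l. l \<in> X \<Longrightarrow> c l = d l) \<Longrightarrow> trig_poly X c = trig_poly X d"
  unfolding trig_poly_def by auto

lemma trig_poly_restrict: "finite Y \<Longrightarrow> X \<subseteq> Y \<Longrightarrow> trig_poly Y (\<lambda>l. if l \<in> X then c l else 0) = trig_poly X c"
  unfolding trig_poly_def
  by (intro ext sum.mono_neutral_cong_right) auto

lemma trig_poly_translate: "trig_poly ((+) x ` X) c t = expo x t * trig_poly X (\<lambda>l. c (x + l)) t"
  by (simp add: trig_poly_def sum.reindex sum_distrib_left expo_add mult.left_commute mult.commute)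

definition sqsum :: "'a set \<Rightarrow> ('a \<Rightarrow> complex) \<Rightarrow> real" where
  "sqsum X c = (\<Sum>l\<in>X. (cmod (c l))\<^sup>2)"

lemma sqsum_nonneg: "0 \<le> sqsum X c"
  by (simp add: sqsum_def sum_nonneg)

lemma sqsum_L2_set: "sqrt (sqsum X c) = L2_set (\<lambda>l. cmod (c l)) X"
  by (simp add: sqsum_def L2_set_def)

lemma cmod_sum_le_sqsum: "cmod (\<Sum>l\<in>X. c l * d l) \<le> sqrt (sqsum X c) * sqrt (sqsum X d)"
proof -
  have "cmod (\<Sum>l\<in>X. c l * d l) \<le> (\<Sum>l\<in>X. \<bar>cmod (c l)\<bar> * \<bar>cmod (d l)\<bar>)"
    by (rule order_trans[OF norm_sum]) (simp add: norm_mult)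
  also have "\<dots> \<le> sqrt (sqsum X c) * sqrt (sqsum X d)"
    unfolding sqsum_L2_set by (rule L2_set_mult_ineq)
  finally show ?thesis .
qed

lemma sqsum_triangle: "sqrt (sqsum X (\<lambda>l. c l + d l)) \<le> sqrt (sqsum X c) + sqrt (sqsum X d)"
proof -
  have "sqrt (sqsum X (\<lambda>l. c l + d l)) \<le> L2_set (\<lambda>l. cmod (c l) + cmod (d l)) X"
    unfolding sqsum_L2_set by (intro L2_set_mono norm_triangle_ineq) auto
  also have "\<dots> \<le> sqrt (sqsum X c) + sqrt (sqsum X d)"
    unfolding sqsum_L2_set by (rule L2_set_triangle_ineq)
  finally show ?thesis .
qed

lemma sqsum_scale: "sqsum X (\<lambda>l. a * c l) = (cmod a)\<^sup>2 * sqsum X c"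
  by (simp add: sqsum_def norm_mult power_mult_distrib sum_distrib_left)

lemma sqsum_restrict:
  "finite Y \<Longrightarrow> X \<subseteq> Y \<Longrightarrow> sqsum Y (\<lambda>l. if l \<in> X then c l else 0) = sqsum X c"
  unfolding sqsum_def by (intro sum.mono_neutral_cong_right) auto

lemma sqsum_mono: "finite Y \<Longrightarrow> X \<subseteq> Y \<Longrightarrow> sqsum X c \<le> sqsum Y c"
  unfolding sqsum_def by (intro sum_mono2) auto

lemma sqsum_translate: "sqsum ((+) x ` X) c = sqsum X (\<lambda>l. c (x + l))"
  by (simp add: sqsum_def sum.reindex)

abbreviation coef :: "('a \<Rightarrow> complex) \<Rightarrow> 'a \<Rightarrow> complex" where
  "coef f \<equiv> (\<lambda>l. ip f (expo l))"

lemma coef_modulate: "coef (\<lambda>t. expo x t * f t) l = coef f (l - x)"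
  using ip_modulate[of x f "expo (l - x)"] by (simp add: flip: expo_add)

text \<open>Only finite subsets and continuous functions enter, which is all that the proof tests.\<close>

definition Bessel :: "real \<Rightarrow> 'a set \<Rightarrow> bool" where
  "Bessel B L \<longleftrightarrow> 0 \<le> B \<and> (\<forall>X f. finite X \<longrightarrow> X \<subseteq> L \<longrightarrow> cont f \<longrightarrow> sqsum X (coef f) \<le> B * (nrm f)\<^sup>2)"

lemma BesselD: "Bessel B L \<Longrightarrow> finite X \<Longrightarrow> X \<subseteq> L \<Longrightarrow> cont f \<Longrightarrow> sqsum X (coef f) \<le> B * (nrm f)\<^sup>2"
  unfolding Bessel_def by blast

lemma Bessel_mono: "Bessel B L \<Longrightarrow> L' \<subseteq> L \<Longrightarrow> B \<le> B' \<Longrightarrow> Bessel B' L'"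
  unfolding Bessel_def
  by (smt (verit, best) mult_right_mono subset_trans zero_le_power2)

text \<open>Analysis and synthesis are adjoint to each other, hence have the same bound.\<close>

lemma Bessel_synthesis:
  assumes B: "Bessel B L" and X: "finite X" "X \<subseteq> L"
  shows "(nrm (trig_poly X c))\<^sup>2 \<le> B * sqsum X c"
proof -
  let ?n = "nrm (trig_poly X c)"
  have "complex_of_real (?n\<^sup>2) = (\<Sum>l\<in>X. cnj (c l) * coef (trig_poly X c) l)"
    unfolding ip_self[symmetric] using X by (simp add: ip_trig_poly_right)
  then have "?n\<^sup>2 = cmod (\<Sum>l\<in>X. cnj (c l) * coef (trig_poly X c) l)"
    by (metis norm_of_real abs_of_nonneg zero_le_power2)
  also have "\<dots> \<le> sqrt (sqsum X (\<lambda>l. cnj (c l))) * sqrt (sqsum X (coef (trig_poly X c)))"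
    by (rule cmod_sum_le_sqsum)
  also have "\<dots> \<le> sqrt (sqsum X c) * sqrt (B * ?n\<^sup>2)"
    using BesselD[OF B X, of "trig_poly X c"] 
    by (intro mult_mono) (auto simp: sqsum_def sum_nonneg)
  also have "\<dots> = sqrt (B * sqsum X c) * ?n"
    by (simp add: real_sqrt_mult nrm_nonneg)
  finally have *: "?n * ?n \<le> sqrt (B * sqsum X c) * ?n" by (simp add: power2_eq_square)
  have "?n \<le> sqrt (B * sqsum X c)"
  proof (cases "?n = 0")
    case True
    then show ?thesis using B by (simp add: Bessel_def sqsum_nonneg)
  next
    case False
    then show ?thesis using * nrm_nonneg[of "trig_poly X c"] by simp
  qed
  then show ?thesis
    using B by (metis Bessel_def mult_nonneg_nonneg nrm_nonneg power_mono real_sqrt_pow2 sqsum_nonneg)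
qed

lemma BesselI_synthesis:
  assumes B: "0 \<le> B" and syn: "\<And>X c. finite X \<Longrightarrow> X \<subseteq> L \<Longrightarrow> (nrm (trig_poly X c))\<^sup>2 \<le> B * sqsum X c"
  shows "Bessel B L"
  unfolding Bessel_def
proof (intro conjI allI impI B)
  fix X f assume X: "finite X" "X \<subseteq> L" and f: "cont f"
  let ?s = "sqrt (sqsum X (coef f))"
  have "complex_of_real (sqsum X (coef f)) = (\<Sum>l\<in>X. cnj (coef f l) * coef f l)"
    unfolding sqsum_def of_real_sum by (intro sum.cong refl) (simp add: complex_norm_square del: of_real_power)
  also have "\<dots> = ip f (trig_poly X (coef f))"
    using X f by (simp add: ip_trig_poly_right)
  finally have "sqsum X (coef f) = cmod (ip f (trig_poly X (coef f)))"
    by (metis norm_of_real abs_of_nonneg sqsum_nonneg)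
  also have "\<dots> \<le> nrm f * nrm (trig_poly X (coef f))"
    by (rule Cauchy_Schwarz[OF f]) simp
  also have "\<dots> \<le> nrm f * sqrt (B * sqsum X (coef f))"
    using syn[OF X, of "coef f"] by (intro mult_left_mono real_le_rsqrt nrm_nonneg)
  finally have *: "?s * ?s \<le> (sqrt B * nrm f) * ?s"
    by (simp add: real_sqrt_mult sqsum_nonneg mult_ac)
  have "?s \<le> sqrt B * nrm f"
  proof (cases "?s = 0")
    case True
    then show ?thesis using B nrm_nonneg by simp
  next
    case False
    then have "?s > 0" using sqsum_nonneg by (simp add: order.strict_iff_order)
    then show ?thesis using * mult_right_le_imp_le by blast
  qed
  then have "?s\<^sup>2 \<le> (sqrt B * nrm f)\<^sup>2" by (intro power_mono) (auto simp: sqsum_nonneg)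
  then show "sqsum X (coef f) \<le> B * (nrm f)\<^sup>2"
    using B by (simp add: power_mult_distrib sqsum_nonneg)
qed

text \<open>Translating the frequencies amounts to modulating \<open>f\<close>, which preserves its norm.\<close>

lemma Bessel_translate:
  assumes "Bessel b L"
  shows "Bessel b ((+) x ` L)"
  unfolding Bessel_def
proof (intro conjI allI impI)
  show "0 \<le> b" using assms by (simp add: Bessel_def)
  fix X f assume X: "finite X" "X \<subseteq> (+) x ` L" and f: "cont f"
  define Y where "Y = (+) (- x) ` X"
  have XY: "X = (+) x ` Y" by (auto simp: Y_def image_image)
  have Y: "finite Y" "Y \<subseteq> L" using X by (auto simp: Y_def)
  have c: "cont (\<lambda>t. expo (- x) t * f t)" by (intro continuous_intros f)
  have "sqsum X (coef f) = sqsum Y (coef (\<lambda>t. expo (- x) t * f t))"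
    unfolding XY sqsum_translate by (simp add: coef_modulate add.commute)
  also have "\<dots> \<le> b * (nrm f)\<^sup>2"
    using BesselD[OF assms Y c] by (simp add: nrm_modulate)
  finally show "sqsum X (coef f) \<le> b * (nrm f)\<^sup>2" .
qed

lemma Bessel_empty: "Bessel 0 {}"
  by (simp add: Bessel_def sqsum_def)

lemma Bessel_Un:
  assumes "Bessel b L" "Bessel b' L'"
  shows "Bessel (b + b') (L \<union> L')"
  unfolding Bessel_def
proof (intro conjI allI impI)
  show "0 \<le> b + b'" using assms by (simp add: Bessel_def)
  fix X f assume X: "finite X" "X \<subseteq> L \<union> L'" and f: "cont f"
  have "sqsum X (coef f) = sqsum (X \<inter> L) (coef f) + sqsum (X - L) (coef f)"
    unfolding sqsum_def using X by (subst sum.Int_Diff[of _ _ L]) auto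
  also have "\<dots> \<le> b * (nrm f)\<^sup>2 + b' * (nrm f)\<^sup>2"
    using X f by (intro add_mono BesselD[OF assms(1)] BesselD[OF assms(2)]) auto
  finally show "sqsum X (coef f) \<le> (b + b') * (nrm f)\<^sup>2" by (simp add: distrib_right)
qed

lemma Bessel_UN:
  assumes "finite F" "\<And>i. i \<in> F \<Longrightarrow> \<exists>b. Bessel b (L i)"
  shows "\<exists>b. Bessel b (\<Union>i\<in>F. L i)"
  using assms
proof (induction F rule: finite_induct)
  case empty
  then show ?case using Bessel_empty by auto
next
  case (insert i F)
  then obtain b b' where "Bessel b (L i)" "Bessel b' (\<Union>i\<in>F. L i)" by blast
  from Bessel_Un[OF this] show ?case by auto
qed

text \<open>The frame coefficients of a fixed function are square summable, hence almost all of
  their mass sits in a ball.\<close>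

lemma Bessel_tail:
  assumes B: "Bessel b L" and f: "cont f" and \<epsilon>: "0 < \<epsilon>"
  obtains R where "0 < R" "\<And>X. finite X \<Longrightarrow> X \<subseteq> L \<Longrightarrow> X \<inter> ball 0 R = {} \<Longrightarrow> sqsum X (coef f) \<le> \<epsilon>"
proof -
  define V where "V = (\<lambda>X. sqsum X (coef f)) ` {X. finite X \<and> X \<subseteq> L}"
  have bdd: "bdd_above V"
    unfolding V_def by (rule bdd_aboveI2[of _ _ "b * (nrm f)\<^sup>2"]) (use BesselD[OF B _ _ f] in auto)
  have "{} \<in> {X. finite X \<and> X \<subseteq> L}" by simp
  then have "V \<noteq> {}" unfolding V_def by blast
  then obtain v where "v \<in> V" "Sup V - \<epsilon> < v"
    using less_cSupD[of V "Sup V - \<epsilon>"] \<epsilon> by auto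
  then obtain X0 where X0: "finite X0" "X0 \<subseteq> L" "Sup V - \<epsilon> < sqsum X0 (coef f)"
    unfolding V_def by auto
  have "bounded X0" using X0(1) by (rule finite_imp_bounded)
  then obtain R where R: "0 < R" "X0 \<subseteq> ball 0 R"
    using bounded_subset_ballD by blast
  show ?thesis
  proof (rule that[OF R(1)])
    fix X assume X: "finite X" "X \<subseteq> L" "X \<inter> ball 0 R = {}"
    have "sqsum (X0 \<union> X) (coef f) = sqsum X0 (coef f) + sqsum X (coef f)"
      unfolding sqsum_def using X X0 R by (intro sum.union_disjoint) auto
    moreover have "sqsum (X0 \<union> X) (coef f) \<le> Sup V"
      using X X0 bdd by (intro cSup_upper) (auto simp: V_def)
    ultimately show "sqsum X (coef f) \<le> \<epsilon>" using X0(3) by linarith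
  qed
qed

lemma nrm_expo_diff:
  obtains K where "0 < K" "\<And>x y. nrm (\<lambda>t. expo x t - expo y t) \<le> K * norm (x - y)"
proof -
  obtain b where b: "0 < b" "\<And>t. t \<in> S \<Longrightarrow> norm t \<le> b"
    using S_bounded by (meson bounded_pos)
  define K where "K = 2 * pi * b"
  have K0: "0 < K" using b by (simp add: K_def)
  have pt: "cmod (expo x t - expo y t) \<le> K * norm (x - y)" if "t \<in> S" for x y t
  proof -
    have "expo x t - expo y t = expo y t * (expo (x - y) t - 1)"
      using expo_add[of y "x - y" t] by (simp add: right_diff_distrib)
    then have "cmod (expo x t - expo y t) = cmod (expo (x - y) t - 1)" by (simp add: norm_mult)
    also have "expo (x - y) t = iexp (2 * pi * (x \<bullet> t) - 2 * pi * (y \<bullet> t))"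
      by (simp add: expo_def inner_diff_left mult_ac right_diff_distrib)
    also have "cmod (iexp (2 * pi * (x \<bullet> t) - 2 * pi * (y \<bullet> t)) - 1) \<le> \<bar>2 * pi * (x \<bullet> t) - 2 * pi * (y \<bullet> t)\<bar>"
      using iexp_approx1[of "2 * pi * (x \<bullet> t) - 2 * pi * (y \<bullet> t)" 0] by simp
    also have "\<dots> = 2 * pi * \<bar>(x - y) \<bullet> t\<bar>"
      by (simp add: inner_diff_left abs_mult flip: right_diff_distrib)
    also have "\<dots> \<le> 2 * pi * (norm (x - y) * b)"
      using Cauchy_Schwarz_ineq2[of "x - y" t] b(2)[OF that]
      by (intro mult_left_mono order_trans[OF Cauchy_Schwarz_ineq2] mult_left_mono) auto
    finally show ?thesis by (simp add: K_def mult_ac)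
  qed
  have main: "nrm (\<lambda>t. expo x t - expo y t) \<le> K * norm (x - y) * sqrt (measure lebesgue S)" for x y
  proof -
    have "(nrm (\<lambda>t. expo x t - expo y t))\<^sup>2 \<le> (LINT t|lebesgue_on S. (K * norm (x - y))\<^sup>2)"
      unfolding nrm_sq
    proof (rule integral_mono)
      show "integrable (lebesgue_on S) (\<lambda>t. (cmod (expo x t - expo y t))\<^sup>2)"
        by (intro integrable_cont continuous_intros)
      show "integrable (lebesgue_on S) (\<lambda>t. (K * norm (x - y))\<^sup>2)"
        by (intro integrable_cont continuous_intros)
      show "(cmod (expo x t - expo y t))\<^sup>2 \<le> (K * norm (x - y))\<^sup>2" if "t \<in> space (lebesgue_on S)" for t
        using that pt by (intro power_mono) (auto simp: space_restrict_space)
    qed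
    also have "\<dots> = (K * norm (x - y) * sqrt (measure lebesgue S))\<^sup>2"
      by (simp add: measure_restrict_space power_mult_distrib)
    finally show ?thesis
      by (rule power2_le_imp_le) (use K0 in simp)
  qed
  show ?thesis
  proof (rule that[of "K * sqrt (measure lebesgue S) + 1"])
    show "0 < K * sqrt (measure lebesgue S) + 1" using K0 by (intro add_nonneg_pos) auto
    show "nrm (\<lambda>t. expo x t - expo y t) \<le> (K * sqrt (measure lebesgue S) + 1) * norm (x - y)" for x y
    proof -
      have "K * norm (x - y) * sqrt (measure lebesgue S) \<le> (K * sqrt (measure lebesgue S) + 1) * norm (x - y)"
        by (simp add: algebra_simps)
      then show ?thesis using main[of x y] by linarith
    qed
  qed
qed

end


section \<open>Regularised least squares\<close>

text \<open>Gaussian elimination: when the index \<open>a\<close> is added, the Schur complement \<open>s\<close> of the block indexed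
by \<open>X\<close> is the value of the form at the vector \<open>d\<close>, hence nonzero.\<close>

lemma linear_system_solvable:
  fixes M :: "'i \<Rightarrow> 'i \<Rightarrow> complex"
  assumes "finite X"
    and "\<And>c. \<exists>l\<in>X. c l \<noteq> 0 \<Longrightarrow> (\<Sum>l\<in>X. cnj (c l) * (\<Sum>m\<in>X. M l m * c m)) \<noteq> 0"
  shows "\<exists>c. \<forall>l\<in>X. (\<Sum>m\<in>X. M l m * c m) = b l"
  using assms
proof (induction X arbitrary: b rule: finite_induct)
  case empty
  then show ?case by simp
next
  case (insert a X)
  note fin = insert.hyps(1) and a = insert.hyps(2) and nd = insert.prems
  have "\<exists>c. \<forall>l\<in>X. (\<Sum>m\<in>X. M l m * c m) = b l" for b
  proof (rule insert.IH)
    fix c assume c: "\<exists>l\<in>X. c l \<noteq> (0::complex)"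
    define d where "d = c(a := 0)"
    have *: "(\<Sum>m\<in>X. M l m * d m) = (\<Sum>m\<in>X. M l m * c m)" for l
      by (rule sum.cong) (use a in \<open>auto simp: d_def\<close>)
    have **: "(\<Sum>l\<in>X. cnj (d l) * z l) = (\<Sum>l\<in>X. cnj (c l) * z l)" for z
      by (rule sum.cong) (use a in \<open>auto simp: d_def\<close>)
    have "\<exists>l\<in>insert a X. d l \<noteq> 0" using c a by (auto simp: d_def)
    from nd[OF this] show "(\<Sum>l\<in>X. cnj (c l) * (\<Sum>m\<in>X. M l m * c m)) \<noteq> 0"
      using fin a by (simp add: * ** ) (simp add: d_def)
  qed
  note IH = this
  obtain c0 where c0: "\<forall>l\<in>X. (\<Sum>m\<in>X. M l m * c0 m) = M l a" using IH[of "\<lambda>l. M l a"] by blast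
  obtain cb where cb: "\<forall>l\<in>X. (\<Sum>m\<in>X. M l m * cb m) = b l" using IH by blast
  define s where "s = M a a - (\<Sum>m\<in>X. M a m * c0 m)"
  define d where "d = (\<lambda>m. if m = a then 1 else - c0 m)"
  have d: "(\<Sum>m\<in>insert a X. M l m * d m) = M l a - (\<Sum>m\<in>X. M l m * c0 m)" for l
  proof -
    have "(\<Sum>m\<in>X. M l m * d m) = (\<Sum>m\<in>X. - (M l m * c0 m))"
      by (rule sum.cong) (use a in \<open>auto simp: d_def\<close>)
    then show ?thesis using fin a by (simp add: d_def sum_negf)
  qed
  have "s \<noteq> 0"
  proof -
    have "(\<Sum>l\<in>insert a X. cnj (d l) * (\<Sum>m\<in>insert a X. M l m * d m)) \<noteq> 0"
      by (rule nd) (auto simp: d_def)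
    moreover have "(\<Sum>l\<in>insert a X. cnj (d l) * (\<Sum>m\<in>insert a X. M l m * d m)) = s"
    proof -
      have "(\<Sum>l\<in>X. cnj (d l) * (\<Sum>m\<in>insert a X. M l m * d m)) = 0"
        unfolding d by (rule sum.neutral) (use c0 in auto)
      then show ?thesis unfolding sum.insert[OF fin a, of "\<lambda>l. cnj (d l) * _ l"]
        unfolding d by (simp add: s_def d_def)
    qed
    ultimately show ?thesis by simp
  qed
  define t where "t = (b a - (\<Sum>m\<in>X. M a m * cb m)) / s"
  define c where "c = (\<lambda>m. if m = a then t else cb m - t * c0 m)"
  have c: "(\<Sum>m\<in>insert a X. M l m * c m) = M l a * t + (\<Sum>m\<in>X. M l m * cb m) - t * (\<Sum>m\<in>X. M l m * c0 m)" for l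
  proof -
    have "(\<Sum>m\<in>X. M l m * c m) = (\<Sum>m\<in>X. M l m * cb m - t * (M l m * c0 m))"
      by (rule sum.cong) (use a in \<open>auto simp: c_def algebra_simps\<close>)
    then show ?thesis using fin a by (simp add: c_def sum_subtractf sum_distrib_left)
  qed
  have "t * s = b a - (\<Sum>m\<in>X. M a m * cb m)" using \<open>s \<noteq> 0\<close> by (simp add: t_def)
  then have "(\<Sum>m\<in>insert a X. M a m * c m) = b a"
    unfolding c by (simp add: s_def algebra_simps)
  moreover have "(\<Sum>m\<in>insert a X. M l m * c m) = b l" if "l \<in> X" for l
    unfolding c using cb c0 that by simp
  ultimately show ?case by blast
qed

context bounded_measurable
begin

text \<open>The regularisation \<open>\<tau>\<close> makes the minimisation well posed without any independence of the
exponentials in \<open>X\<close>, and penalises approximations with large coefficients, which would spoil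
the comparison of \<open>ridge \<tau> X (expo x)\<close> with \<open>\<tau>\<close> for \<open>x \<in> X\<close>.\<close>

definition energy :: "real \<Rightarrow> 'a set \<Rightarrow> ('a \<Rightarrow> complex) \<Rightarrow> ('a \<Rightarrow> complex) \<Rightarrow> real" where
  "energy \<tau> X f c = (nrm (\<lambda>t. f t - trig_poly X c t))\<^sup>2 + \<tau> * sqsum X c"

definition ridge :: "real \<Rightarrow> 'a set \<Rightarrow> ('a \<Rightarrow> complex) \<Rightarrow> real" where
  "ridge \<tau> X f = (INF c. energy \<tau> X f c)"

lemma energy_nonneg: "0 \<le> \<tau> \<Longrightarrow> 0 \<le> energy \<tau> X f c"
  by (simp add: energy_def sqsum_nonneg)

lemma ridge_le: "0 \<le> \<tau> \<Longrightarrow> ridge \<tau> X f \<le> energy \<tau> X f c"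
  unfolding ridge_def by (rule cINF_lower) (auto intro!: bdd_belowI2 energy_nonneg)

lemma ridge_ge: "(\<And>c. m \<le> energy \<tau> X f c) \<Longrightarrow> m \<le> ridge \<tau> X f"
  unfolding ridge_def by (rule cINF_greatest) auto

text \<open>The normal equations say that \<open>(f - trig_poly X c, - c)\<close> is orthogonal, in the direct sum of
\<open>L\<^sup>2(S)\<close> and \<open>l\<^sup>2(X)\<close> weighted by \<open>\<tau>\<close>, to the graph of the synthesis operator. So Pythagoras' theorem
shows that \<open>c\<close> is the minimiser.\<close>

lemma ridge_normal_equations:
  assumes \<tau>: "0 \<le> \<tau>" and X: "finite X" and f: "cont f"
    and eq: "\<And>l. l \<in> X \<Longrightarrow> coef (\<lambda>t. f t - trig_poly X c t) l = \<tau> * c l"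
  shows "complex_of_real (ridge \<tau> X f) = ip f f - (\<Sum>l\<in>X. c l * ip (expo l) f)"
proof -
  define u where "u = (\<lambda>t. f t - trig_poly X c t)"
  have u: "cont u" unfolding u_def by (intro continuous_intros f)
  have pyth: "energy \<tau> X f d = energy \<tau> X f c + energy \<tau> X (\<lambda>_. 0) (\<lambda>l. d l - c l)" for d
  proof -
    define v where "v = trig_poly X (\<lambda>l. d l - c l)"
    have v: "cont v" by (simp add: v_def)
    have "(\<lambda>t. f t - trig_poly X d t) = (\<lambda>t. u t - v t)"
      by (auto simp: u_def v_def trig_poly_diff[symmetric])
    then have 1: "(nrm (\<lambda>t. f t - trig_poly X d t))\<^sup>2 = (nrm u)\<^sup>2 - 2 * Re (ip u v) + (nrm v)\<^sup>2"
      using nrm_sq_diff[OF u v] by simp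
    have 2: "Re (ip u v) = \<tau> * (\<Sum>l\<in>X. Re (cnj (d l - c l) * c l))"
    proof -
      have "ip u v = (\<Sum>l\<in>X. cnj (d l - c l) * coef u l)"
        unfolding v_def using X u by (rule ip_trig_poly_right)
      also have "\<dots> = (\<Sum>l\<in>X. \<tau> * (cnj (d l - c l) * c l))"
        by (rule sum.cong) (auto simp: u_def eq)
      finally show ?thesis by (simp add: sum_distrib_left)
    qed
    have 3: "sqsum X d = sqsum X c + sqsum X (\<lambda>l. d l - c l) + 2 * (\<Sum>l\<in>X. Re (cnj (d l - c l) * c l))"
      unfolding sqsum_def sum_distrib_left sum.distrib[symmetric]
      by (rule sum.cong[OF refl]) (unfold cmod_power2, simp add: power2_eq_square algebra_simps)
    have 4: "nrm (\<lambda>t. 0 - v t) = nrm v" using nrm_scale[of "-1" v] by simp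
    show ?thesis
      unfolding energy_def 1 3 v_def[symmetric] 4 u_def[symmetric] 2 by (simp add: algebra_simps)
  qed
  have "ridge \<tau> X f = energy \<tau> X f c"
  proof (rule antisym[OF ridge_le[OF \<tau>]])
    show "energy \<tau> X f c \<le> ridge \<tau> X f"
    proof (rule ridge_ge)
      fix d
      show "energy \<tau> X f c \<le> energy \<tau> X f d"
        unfolding pyth[of d] using energy_nonneg[OF \<tau>] by simp
    qed
  qed
  moreover have "complex_of_real (energy \<tau> X f c) = ip u f"
  proof -
    have "ip u u = ip u f - ip u (trig_poly X c)"
      using ip_diff_right[OF f cont_trig_poly u, of X c] unfolding u_def[symmetric] .
    also have "ip u (trig_poly X c) = (\<Sum>l\<in>X. cnj (c l) * coef u l)"
      using X u by (rule ip_trig_poly_right)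
    also have "\<dots> = \<tau> * sqsum X c"
      unfolding sqsum_def of_real_sum sum_distrib_left of_real_mult
      by (rule sum.cong) (auto simp: u_def eq complex_norm_square simp del: of_real_power)
    finally show ?thesis unfolding energy_def u_def[symmetric] by (simp add: ip_self)
  qed
  moreover have "ip u f = ip f f - (\<Sum>l\<in>X. c l * ip (expo l) f)"
    unfolding u_def using f X by (simp add: ip_diff_left ip_trig_poly_left)
  ultimately show ?thesis by simp
qed

text \<open>Adding \<open>\<tau>\<close> on the diagonal turns the positive semidefinite Gram matrix into a positive definite
one.\<close>

lemma regularised_Gram_inverse:
  fixes \<tau> :: real
  assumes \<tau>: "0 < \<tau>" and X: "finite X"
  shows "\<exists>K :: 'a \<Rightarrow> 'a \<Rightarrow> complex. \<forall>l\<in>X. \<forall>n\<in>X.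
      (\<Sum>m\<in>X. ip (expo m) (expo l) * K m n) + \<tau> * K l n = (if l = n then 1 else 0)"
proof -
  define M where "M l m = ip (expo m) (expo l) + (if l = m then complex_of_real \<tau> else 0)" for l m
  have M: "(\<Sum>m\<in>X. M l m * c m) = (\<Sum>m\<in>X. ip (expo m) (expo l) * c m) + \<tau> * c l" if "l \<in> X" for l and c :: "'a \<Rightarrow> complex"
    using that X by (simp add: M_def distrib_right sum.distrib if_distrib[of "\<lambda>x. x * _"] sum.delta cong: if_cong)
  have nd: "(\<Sum>l\<in>X. cnj (c l) * (\<Sum>m\<in>X. M l m * c m)) \<noteq> 0" if c: "\<exists>l\<in>X. c l \<noteq> 0" for c
  proof -
    have "(\<Sum>l\<in>X. cnj (c l) * (\<Sum>m\<in>X. M l m * c m))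
        = (\<Sum>l\<in>X. cnj (c l) * coef (trig_poly X c) l + \<tau> * (cnj (c l) * c l))"
    proof (rule sum.cong[OF refl])
      fix l assume l: "l \<in> X"
      have "coef (trig_poly X c) l = (\<Sum>m\<in>X. ip (expo m) (expo l) * c m)"
        using X by (simp add: ip_trig_poly_left mult.commute)
      then have "(\<Sum>m\<in>X. M l m * c m) = coef (trig_poly X c) l + \<tau> * c l"
        using M[OF l, of c] by simp
      then show "cnj (c l) * (\<Sum>m\<in>X. M l m * c m) = cnj (c l) * coef (trig_poly X c) l + \<tau> * (cnj (c l) * c l)"
        by (simp only: distrib_left mult.left_commute)
    qed
    also have "\<dots> = (\<Sum>l\<in>X. cnj (c l) * coef (trig_poly X c) l) + \<tau> * (\<Sum>l\<in>X. cnj (c l) * c l)"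
      by (simp add: sum.distrib sum_distrib_left)
    also have "(\<Sum>l\<in>X. cnj (c l) * coef (trig_poly X c) l) = (nrm (trig_poly X c))\<^sup>2"
      using X by (simp add: ip_trig_poly_right flip: ip_self of_real_power)
    also have "(\<Sum>l\<in>X. cnj (c l) * c l) = sqsum X c"
      unfolding sqsum_def of_real_sum by (rule sum.cong) (auto simp: complex_norm_square simp del: of_real_power)
    finally have eq: "(\<Sum>l\<in>X. cnj (c l) * (\<Sum>m\<in>X. M l m * c m)) = complex_of_real ((nrm (trig_poly X c))\<^sup>2 + \<tau> * sqsum X c)"
      by simp
    obtain l where l: "l \<in> X" "c l \<noteq> 0" using c by blast
    have "0 < (cmod (c l))\<^sup>2" using l by simp
    also have "\<dots> \<le> sqsum X c"
      unfolding sqsum_def by (rule member_le_sum[OF l(1)]) (use X in auto)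
    finally have "0 < (nrm (trig_poly X c))\<^sup>2 + \<tau> * sqsum X c"
      using \<tau> by (simp add: add_nonneg_pos)
    then show ?thesis unfolding eq by (metis less_irrefl of_real_eq_0_iff)
  qed
  have "\<exists>k. \<forall>l\<in>X. (\<Sum>m\<in>X. M l m * k m) = (if l = n then 1 else 0)" for n
    using linear_system_solvable[OF X, of M "\<lambda>l. if l = n then 1 else 0"] nd by blast
  then obtain k where k: "\<And>n l. l \<in> X \<Longrightarrow> (\<Sum>m\<in>X. M l m * k n m) = (if l = n then 1 else 0)"
    by metis
  show ?thesis
    by (rule exI[of _ "\<lambda>m n. k n m"]) (use k M in auto)
qed

text \<open>Let \<open>G\<close> be the Gram matrix of \<open>X\<close> and \<open>K = (G + \<tau>)\<^sup>-\<^sup>1\<close>. The best coefficients for \<open>f\<close> are \<open>K\<close> applied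
to the inner products of \<open>f\<close> with the exponentials in \<open>X\<close>, so \<open>|S| - ridge \<tau> X (expo x)\<close> is a quadratic
form in these inner products, and by assumption the integral of that form is the trace of \<open>K G\<close>.
The same number is the sum over \<open>X\<close>, since the coefficient of \<open>expo l\<close> in its own best
approximation is \<open>1 - \<tau> K l l\<close>. The assumption on the kernel is Plancherel's theorem for
exponentials restricted to \<open>S\<close>.\<close>

lemma ridge_trace:
  assumes \<tau>: "0 < \<tau>" and X: "finite X"
    and planch: "\<And>m n. has_bochner_integral lborel (\<lambda>x. ip (expo m) (expo x) * ip (expo x) (expo n)) (ip (expo m) (expo n))"
  shows "has_bochner_integral lborel (\<lambda>x. measure lebesgue S - ridge \<tau> X (expo x))
           ((\<Sum>l\<in>X. ridge \<tau> X (expo l)) / \<tau>)"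
proof -
  obtain K :: "'a \<Rightarrow> 'a \<Rightarrow> complex" where K: "\<And>l n. l \<in> X \<Longrightarrow> n \<in> X \<Longrightarrow>
      (\<Sum>m\<in>X. ip (expo m) (expo l) * K m n) + \<tau> * K l n = (if l = n then 1 else 0)"
    using regularised_Gram_inverse[OF \<tau> X] by (elim exE) blast
  have rx: "complex_of_real (measure lebesgue S - ridge \<tau> X (expo x))
      = (\<Sum>m\<in>X. \<Sum>n\<in>X. K m n * (ip (expo m) (expo x) * ip (expo x) (expo n)))" for x
  proof -
    define c where "c = (\<lambda>m. \<Sum>n\<in>X. K m n * coef (expo x) n)"
    have "coef (\<lambda>t. expo x t - trig_poly X c t) l = \<tau> * c l" if l: "l \<in> X" for l
    proof -
      have "(\<Sum>m\<in>X. ip (expo m) (expo l) * c m) + \<tau> * c l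
          = (\<Sum>n\<in>X. ((\<Sum>m\<in>X. ip (expo m) (expo l) * K m n) + \<tau> * K l n) * coef (expo x) n)"
        unfolding c_def sum_distrib_left distrib_right sum_distrib_right sum.distrib
        by (subst (2) sum.swap) (simp add: mult.assoc)
      also have "\<dots> = (\<Sum>n\<in>X. (if l = n then 1 else 0) * coef (expo x) n)"
        by (rule sum.cong) (use K l in auto)
      also have "\<dots> = coef (expo x) l"
        using X l by (simp add: if_distrib[of "\<lambda>x. x * _"] sum.delta cong: if_cong)
      finally show ?thesis using X by (simp add: ip_diff_left ip_trig_poly_left algebra_simps)
    qed
    from ridge_normal_equations[OF _ X _ this] \<tau>
    have "complex_of_real (ridge \<tau> X (expo x)) = ip (expo x) (expo x) - (\<Sum>m\<in>X. c m * ip (expo m) (expo x))"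
      by simp
    then show ?thesis
      by (simp add: ip_self nrm_expo c_def sum_distrib_right sum_distrib_left mult_ac del: of_real_power)
  qed
  have rl: "complex_of_real (ridge \<tau> X (expo l)) = \<tau> * (1 - \<tau> * K l l)" if l: "l \<in> X" for l
  proof -
    define c where "c = (\<lambda>m. (if m = l then 1 else 0) - \<tau> * K m l)"
    have trig_poly: "coef (trig_poly X c) k = ip (expo l) (expo k) - \<tau> * (\<Sum>m\<in>X. ip (expo m) (expo k) * K m l)" for k
    proof -
      have "coef (trig_poly X c) k = (\<Sum>m\<in>X. c m * ip (expo m) (expo k))"
        using X by (simp add: ip_trig_poly_left)
      also have "\<dots> = (\<Sum>m\<in>X. (if m = l then ip (expo m) (expo k) else 0) - \<tau> * (ip (expo m) (expo k) * K m l))"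
        by (rule sum.cong) (auto simp: c_def algebra_simps)
      finally show ?thesis using X l by (simp add: sum_subtractf sum_distrib_left)
    qed
    have eq: "coef (\<lambda>t. expo l t - trig_poly X c t) k = \<tau> * c k" if k: "k \<in> X" for k
    proof -
      have "(\<Sum>m\<in>X. ip (expo m) (expo k) * K m l) = (if k = l then 1 else 0) - \<tau> * K k l"
        using K[OF k l] by (simp add: algebra_simps)
      moreover have "coef (\<lambda>t. expo l t - trig_poly X c t) k = coef (expo l) k - coef (trig_poly X c) k"
        by (rule ip_diff_left) simp_all
      ultimately have "coef (\<lambda>t. expo l t - trig_poly X c t) k = \<tau> * ((if k = l then 1 else 0) - \<tau> * K k l)"
        unfolding trig_poly by simp
      then show ?thesis by (simp only: c_def)
    qed
    have "complex_of_real (ridge \<tau> X (expo l)) = ip (expo l) (expo l) - (\<Sum>m\<in>X. c m * ip (expo m) (expo l))"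
      using ridge_normal_equations[OF _ X _ eq] \<tau> by simp
    also have "\<dots> = coef (\<lambda>t. expo l t - trig_poly X c t) l"
      using X by (simp add: ip_diff_left ip_trig_poly_left)
    finally show ?thesis using eq[OF l] by (simp add: c_def)
  qed
  have "has_bochner_integral lborel
      (\<lambda>x. \<Sum>m\<in>X. \<Sum>n\<in>X. K m n * (ip (expo m) (expo x) * ip (expo x) (expo n)))
      (\<Sum>m\<in>X. \<Sum>n\<in>X. K m n * ip (expo m) (expo n))"
    by (intro has_bochner_integral_sum has_bochner_integral_mult_right planch) 
  moreover have "(\<Sum>m\<in>X. \<Sum>n\<in>X. K m n * ip (expo m) (expo n)) = complex_of_real ((\<Sum>l\<in>X. ridge \<tau> X (expo l)) / \<tau>)"
  proof -
    have "(\<Sum>m\<in>X. \<Sum>n\<in>X. K m n * ip (expo m) (expo n)) = (\<Sum>n\<in>X. \<Sum>m\<in>X. ip (expo m) (expo n) * K m n)"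
      by (subst sum.swap) (simp add: mult.commute)
    also have "\<dots> = (\<Sum>n\<in>X. complex_of_real (ridge \<tau> X (expo n)) / \<tau>)"
    proof (rule sum.cong[OF refl])
      fix n assume n: "n \<in> X"
      have "(\<Sum>m\<in>X. ip (expo m) (expo n) * K m n) = 1 - \<tau> * K n n"
        using K[OF n n] by (simp add: algebra_simps)
      also have "\<dots> = complex_of_real (ridge \<tau> X (expo n)) / \<tau>"
        using rl[OF n] \<tau> by simp
      finally show "(\<Sum>m\<in>X. ip (expo m) (expo n) * K m n) = complex_of_real (ridge \<tau> X (expo n)) / \<tau>" .
    qed
    finally show ?thesis by (simp add: sum_divide_distrib)
  qed
  ultimately have "has_bochner_integral lborel (\<lambda>x. complex_of_real (measure lebesgue S - ridge \<tau> X (expo x)))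
     (complex_of_real ((\<Sum>l\<in>X. ridge \<tau> X (expo l)) / \<tau>))"
    unfolding rx by simp
  from has_bochner_integral_bounded_linear[OF bounded_linear_Re this] show ?thesis by simp
qed

lemma trig_poly_combine:
  assumes "finite X" "finite Y"
  shows "trig_poly X c t + z * trig_poly Y d t
    = trig_poly (X \<union> Y) (\<lambda>l. (if l \<in> X then c l else 0) + z * (if l \<in> Y then d l else 0)) t"
proof -
  have "trig_poly X c = trig_poly (X \<union> Y) (\<lambda>l. if l \<in> X then c l else 0)"
    "trig_poly Y d = trig_poly (X \<union> Y) (\<lambda>l. if l \<in> Y then d l else 0)"
    using assms by (simp_all add: trig_poly_restrict)
  then show ?thesis
    by (simp add: trig_poly_def sum_distrib_left distrib_right sum.distrib mult.assoc)
qed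

lemma nrm_expo_trig_poly_shift:
  "nrm (\<lambda>t. expo (y + x) t - trig_poly ((+) y ` X) c t) = nrm (\<lambda>t. expo x t - trig_poly X (\<lambda>l. c (y + l)) t)"
proof -
  have "(\<lambda>t. expo (y + x) t - trig_poly ((+) y ` X) c t) = (\<lambda>t. expo y t * (expo x t - trig_poly X (\<lambda>l. c (y + l)) t))"
    by (simp add: expo_add trig_poly_translate right_diff_distrib)
  then show ?thesis by (simp only: nrm_modulate)
qed

lemma energy_shift:
  "energy \<tau> ((+) y ` X) (expo (y + x)) c = energy \<tau> X (expo x) (\<lambda>l. c (y + l))"
  by (simp add: energy_def nrm_expo_trig_poly_shift sqsum_translate)

text \<open>Enlarging the set of frequencies and translating everything can only help the approximation.\<close>

lemma ridge_le_translate: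
  assumes X: "finite X" and sub: "(+) y ` Y \<subseteq> X" and \<tau>: "0 \<le> \<tau>"
  shows "ridge \<tau> X (expo (y + x)) \<le> energy \<tau> Y (expo x) c"
proof -
  let ?d = "\<lambda>l. if l \<in> (+) y ` Y then c (l - y) else 0"
  have "ridge \<tau> X (expo (y + x)) \<le> energy \<tau> X (expo (y + x)) ?d" by (rule ridge_le[OF \<tau>])
  also have "\<dots> = energy \<tau> ((+) y ` Y) (expo (y + x)) (\<lambda>l. c (l - y))"
    unfolding energy_def using trig_poly_restrict[OF X sub, of "\<lambda>l. c (l - y)"] sqsum_restrict[OF X sub, of "\<lambda>l. c (l - y)"]
    by (simp only:)
  also have "\<dots> = energy \<tau> Y (expo x) c" by (simp add: energy_shift)
  finally show ?thesis .
qed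

text \<open>If \<open>c x\<close> differs from \<open>1\<close> by \<open>q\<close>, then the lower bound forces an error of at least \<open>A q\<^sup>2\<close>, while the
penalty is at least \<open>\<tau> (1 - 2 q)\<close>. The sum of both is smallest at \<open>q = \<tau> / A\<close>.\<close>

lemma ridge_ge_of_lower_bound:
  assumes \<tau>: "0 < \<tau>" and A: "0 < A" and X: "finite X" and x: "x \<in> X"
    and low: "\<And>c. A * sqsum X c \<le> (nrm (trig_poly X c))\<^sup>2"
  shows "\<tau> * (1 - \<tau> / A) \<le> ridge \<tau> X (expo x)"
proof (rule ridge_ge)
  fix c
  define q where "q = cmod (1 - c x)"
  define d where "d = (\<lambda>l. (if l = x then 1 else 0) - c l)"
  have entry: "(cmod (c x))\<^sup>2 \<le> sqsum X c" for c
    unfolding sqsum_def by (rule member_le_sum[OF x]) (use X in auto)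
  have "expo x t = trig_poly X (\<lambda>l. if l = x then 1 else 0) t" for t
    using X x by (simp add: trig_poly_def if_distrib[of "\<lambda>c. c * _"] cong: if_cong)
  then have e: "(\<lambda>t. expo x t - trig_poly X c t) = trig_poly X d"
    by (simp add: trig_poly_diff d_def)
  have "A * q\<^sup>2 \<le> A * sqsum X d"
    using entry[of d] A by (intro mult_left_mono) (auto simp: d_def q_def)
  also have "\<dots> \<le> (nrm (trig_poly X d))\<^sup>2" by (rule low)
  finally have 1: "A * q\<^sup>2 \<le> (nrm (\<lambda>t. expo x t - trig_poly X c t))\<^sup>2" by (simp add: e)
  have "1 - q \<le> cmod (c x)"
    using norm_triangle_ineq[of "c x" "1 - c x"] by (simp add: q_def)
  moreover have "2 * cmod (c x) - 1 \<le> (cmod (c x))\<^sup>2"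
    using zero_le_power2[of "cmod (c x) - 1"] by (simp add: power2_diff)
  ultimately have "1 - 2 * q \<le> sqsum X c" using entry[of c] by linarith
  then have 2: "\<tau> * (1 - 2 * q) \<le> \<tau> * sqsum X c" using \<tau> by (intro mult_left_mono) auto
  have "0 \<le> (A * q - \<tau>)\<^sup>2 / A" using A by simp
  also have "\<dots> = A * q\<^sup>2 - 2 * \<tau> * q + \<tau>\<^sup>2 / A"
    using A by (simp add: power2_eq_square field_simps)
  finally have "\<tau> * (1 - \<tau> / A) \<le> A * q\<^sup>2 + \<tau> * (1 - 2 * q)"
    by (simp add: algebra_simps power2_eq_square)
  then show "\<tau> * (1 - \<tau> / A) \<le> energy \<tau> X (expo x) c"
    using 1 2 by (simp add: energy_def)
qed

text \<open>Expand the square, bound the mixed term by the Cauchy-Schwarz inequality on \<open>X\<close>, and complete the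
square in the norm of the coefficients. This controls the trace integrand far away from \<open>X\<close>, where
all the inner products are small.\<close>

lemma ridge_ge_coef:
  assumes \<tau>: "0 \<le> \<tau>" and A: "0 < A" and X: "finite X" and f: "cont f"
    and low: "\<And>c. A * sqsum X c \<le> (nrm (trig_poly X c))\<^sup>2"
  shows "(nrm f)\<^sup>2 - sqsum X (coef f) / A \<le> ridge \<tau> X f"
proof (rule ridge_ge)
  fix c
  define q where "q = sqrt (sqsum X c)"
  define s where "s = sqrt (sqsum X (coef f))"
  have "ip f (trig_poly X c) = (\<Sum>l\<in>X. cnj (c l) * coef f l)"
    using X f by (simp add: ip_trig_poly_right)
  then have "cmod (ip f (trig_poly X c)) \<le> sqrt (sqsum X (\<lambda>l. cnj (c l))) * s"
    using cmod_sum_le_sqsum[of "\<lambda>l. cnj (c l)" "coef f" X] by (simp add: s_def)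
  also have "sqsum X (\<lambda>l. cnj (c l)) = sqsum X c" by (simp add: sqsum_def)
  finally have "Re (ip f (trig_poly X c)) \<le> q * s"
    using complex_Re_le_cmod order_trans unfolding q_def by blast
  moreover have "A * q\<^sup>2 \<le> (nrm (trig_poly X c))\<^sup>2" using low[of c] by (simp add: q_def sqsum_nonneg)
  moreover have "0 \<le> (A * q - s)\<^sup>2 / A" using A by simp
  moreover have "(A * q - s)\<^sup>2 / A = A * q\<^sup>2 - 2 * (q * s) + s\<^sup>2 / A"
    using A by (simp add: power2_eq_square field_simps)
  moreover have "s\<^sup>2 = sqsum X (coef f)" by (simp add: s_def sqsum_nonneg)
  ultimately have "(nrm f)\<^sup>2 - sqsum X (coef f) / A
      \<le> (nrm f)\<^sup>2 - 2 * Re (ip f (trig_poly X c)) + (nrm (trig_poly X c))\<^sup>2" by simp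
  also have "\<dots> = (nrm (\<lambda>t. f t - trig_poly X c t))\<^sup>2"
    by (rule nrm_sq_diff[symmetric]) (use f in simp_all)
  also have "\<dots> \<le> energy \<tau> X f c" using \<tau> by (simp add: energy_def sqsum_nonneg)
  finally show "(nrm f)\<^sup>2 - sqsum X (coef f) / A \<le> energy \<tau> X f c" .
qed

text \<open>A substitute for the orthogonal projection onto the closed span of the exponentials in \<open>L\<close> that
stays within finite sums: a combination that almost attains the infimum of the distances.\<close>

lemma almost_orthogonal_residual:
  assumes f: "cont f" and \<theta>: "0 < \<theta>"
  obtains Y d where "finite Y" "Y \<subseteq> L" "(nrm (\<lambda>t. f t - trig_poly Y d t))\<^sup>2 \<le> (nrm f)\<^sup>2 + \<theta>\<^sup>2"
    "\<And>X c. finite X \<Longrightarrow> X \<subseteq> L \<Longrightarrow>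
       cmod (ip (\<lambda>t. f t - trig_poly Y d t) (trig_poly X c)) \<le> \<theta> * nrm (trig_poly X c)"
proof -
  define V where "V = {(nrm (\<lambda>t. f t - trig_poly Y d t))\<^sup>2 | Y d. finite Y \<and> Y \<subseteq> L}"
  have VI: "(nrm (\<lambda>t. f t - trig_poly Y d t))\<^sup>2 \<in> V" if "finite Y" "Y \<subseteq> L" for Y d
    unfolding V_def using that by blast
  have fV: "(nrm f)\<^sup>2 \<in> V" using VI[of "{}" "\<lambda>_. 0"] by (simp add: trig_poly_def)
  define D where "D = Inf V"
  have bdd: "bdd_below V" by (rule bdd_belowI[of _ 0]) (auto simp: V_def)
  have Df: "D \<le> (nrm f)\<^sup>2" unfolding D_def using fV bdd by (rule cInf_lower)
  obtain v where "v \<in> V" "v < D + \<theta>\<^sup>2"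
    using cInf_lessD[of V "D + \<theta>\<^sup>2"] fV \<theta> unfolding D_def by auto
  then obtain Y d where Y: "finite Y" "Y \<subseteq> L" "(nrm (\<lambda>t. f t - trig_poly Y d t))\<^sup>2 < D + \<theta>\<^sup>2"
    by (auto simp: V_def)
  define w where "w = (\<lambda>t. f t - trig_poly Y d t)"
  have cw: "cont w" unfolding w_def by (intro continuous_intros f)
  have wD: "(nrm w)\<^sup>2 < D + \<theta>\<^sup>2" using Y(3) by (simp add: w_def)
  have "cmod (ip w (trig_poly X c)) \<le> \<theta> * nrm (trig_poly X c)" if X: "finite X" "X \<subseteq> L" for X c
  proof -
    have "D \<le> (nrm (\<lambda>t. w t - z * trig_poly X c t))\<^sup>2" for z
    proof -
      have "(\<lambda>t. w t - z * trig_poly X c t)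
        = (\<lambda>t. f t - trig_poly (Y \<union> X) (\<lambda>l. (if l \<in> Y then d l else 0) + z * (if l \<in> X then c l else 0)) t)"
        unfolding trig_poly_combine[OF Y(1) X(1), symmetric] by (auto simp: w_def)
      then have "(nrm (\<lambda>t. w t - z * trig_poly X c t))\<^sup>2 \<in> V"
        using X Y by (simp only:) (rule VI, auto)
      then show ?thesis unfolding D_def using bdd by (rule cInf_lower)
    qed
    from inner_le_of_distance[OF cw cont_trig_poly this]
    have "(cmod (ip w (trig_poly X c)))\<^sup>2 \<le> ((nrm w)\<^sup>2 - D) * (nrm (trig_poly X c))\<^sup>2" .
    also have "\<dots> \<le> \<theta>\<^sup>2 * (nrm (trig_poly X c))\<^sup>2" using wD by (intro mult_right_mono) auto
    finally show ?thesis
      by (metis \<theta> less_imp_le mult_nonneg_nonneg nrm_nonneg power2_le_imp_le power_mult_distrib)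
  qed
  moreover have "(nrm w)\<^sup>2 \<le> (nrm f)\<^sup>2 + \<theta>\<^sup>2" using wD Df by simp
  ultimately show ?thesis using that[OF Y(1,2)] by (simp add: w_def)
qed

lemma ridge_nonneg: "0 \<le> \<tau> \<Longrightarrow> 0 \<le> ridge \<tau> X f"
  by (rule ridge_ge) (rule energy_nonneg)

end


section \<open>Gaussian integrals\<close>

lemma Gaussian_char_real:
  "has_bochner_integral lborel (\<lambda>y::real. complex_of_real (exp (- (y\<^sup>2) / 2)) * exp (\<i> * of_real (y * t)))
     (complex_of_real (sqrt (2 * pi) * exp (- (t\<^sup>2) / 2)))"
proof -
  interpret prob_space std_normal_distribution
    by (rule prob_space_normal_density) simp
  have int: "integrable std_normal_distribution (\<lambda>y. exp (\<i> * of_real (t * y)))"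
    by (intro integrable_const_bound[of _ 1]) (auto simp del: of_real_mult)
  have v: "(CLINT y|std_normal_distribution. exp (\<i> * of_real (t * y))) = exp (- (t\<^sup>2) / 2)"
    using fun_cong[OF char_std_normal_distribution, of t] by (simp add: char_def)
  have "has_bochner_integral std_normal_distribution (\<lambda>y. exp (\<i> * of_real (t * y))) (exp (- (t\<^sup>2) / 2))"
    using int v by (simp add: has_bochner_integral_iff)
  then have "has_bochner_integral lborel (\<lambda>y. std_normal_density y *\<^sub>R exp (\<i> * of_real (t * y))) (exp (- (t\<^sup>2) / 2))"
    by (simp add: has_bochner_integral_iff integrable_density integral_density del: of_real_mult of_real_exp)
  from has_bochner_integral_scaleR_right[OF this, of "sqrt (2 * pi)"]
  show ?thesis
    by (simp add: std_normal_density_def scaleR_conv_of_real mult_ac)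
qed

text \<open>Fubini's theorem for the product of the one-dimensional transforms over an orthonormal basis.\<close>

lemma Gaussian_char:
  fixes w :: "'a::euclidean_space"
  shows "has_bochner_integral lborel
     (\<lambda>x::'a. complex_of_real (exp (- (norm x)\<^sup>2 / 2)) * exp (\<i> * of_real (x \<bullet> w)))
     (complex_of_real (sqrt (2 * pi) ^ DIM('a) * exp (- (norm w)\<^sup>2 / 2)))"
proof -
  interpret product_sigma_finite "\<lambda>_::'a. lborel :: real measure"
    by standard
  define f where "f b y = complex_of_real (exp (- (y\<^sup>2) / 2)) * exp (\<i> * of_real (y * (w \<bullet> b)))" for b :: 'a and y :: real
  have hf: "has_bochner_integral lborel (f b) (complex_of_real (sqrt (2 * pi) * exp (- ((w \<bullet> b)\<^sup>2) / 2)))" for b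
    unfolding f_def by (rule Gaussian_char_real)
  have nsq: "(norm x)\<^sup>2 = (\<Sum>b\<in>Basis. (x \<bullet> b)\<^sup>2)" for x :: 'a
    unfolding power2_norm_eq_inner by (subst euclidean_inner) (simp add: power2_eq_square)
  have prod: "complex_of_real (exp (- (norm x)\<^sup>2 / 2)) * exp (\<i> * of_real (x \<bullet> w)) = (\<Prod>b\<in>Basis. f b (x \<bullet> b))" for x :: 'a
  proof -
    have "(\<Prod>b\<in>Basis. f b (x \<bullet> b)) = (\<Prod>b\<in>Basis. exp (complex_of_real (- ((x \<bullet> b)\<^sup>2) / 2) + \<i> * of_real ((x \<bullet> b) * (w \<bullet> b))))"
      by (simp only: f_def exp_add exp_of_real)
    also have "\<dots> = exp (\<Sum>b\<in>Basis. complex_of_real (- ((x \<bullet> b)\<^sup>2) / 2) + \<i> * of_real ((x \<bullet> b) * (w \<bullet> b)))"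
      by (simp add: exp_sum)
    also have "(\<Sum>b\<in>Basis. complex_of_real (- ((x \<bullet> b)\<^sup>2) / 2) + \<i> * of_real ((x \<bullet> b) * (w \<bullet> b)))
        = complex_of_real (- (norm x)\<^sup>2 / 2) + \<i> * of_real (x \<bullet> w)"
      unfolding nsq euclidean_inner[of x w]
      by (simp add: sum.distrib sum_subtractf sum_distrib_left sum_negf sum_divide_distrib)
    finally show ?thesis by (simp only: exp_add exp_of_real)
  qed
  have val: "(\<Prod>b\<in>Basis. complex_of_real (sqrt (2 * pi) * exp (- ((w \<bullet> b)\<^sup>2) / 2)))
      = complex_of_real (sqrt (2 * pi) ^ DIM('a) * exp (- (norm w)\<^sup>2 / 2))"
    unfolding nsq of_real_prod[symmetric] prod.distrib
    by (simp add: exp_sum[symmetric] sum_negf sum_divide_distrib)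
  have int: "integrable lborel (f b)" for b
    using hf by (rule integrable.intros)
  have ival: "integral\<^sup>L lborel (f b) = complex_of_real (sqrt (2 * pi) * exp (- ((w \<bullet> b)\<^sup>2) / 2))" for b
    using hf by (rule has_bochner_integral_integral_eq)
  have [measurable]: "f b \<in> borel_measurable borel" for b
    using int[of b] by (simp add: integrable_iff_bounded)
  have m: "(\<lambda>x::'a. \<Prod>b\<in>Basis. f b (x \<bullet> b)) \<in> borel_measurable borel"
    by measurable
  have inner: "(\<Sum>c\<in>Basis. g c *\<^sub>R c) \<bullet> b = g b" if "b \<in> Basis" for g :: "'a \<Rightarrow> real" and b
    using that by simp
  have eq: "(\<lambda>g. \<Prod>b\<in>Basis. f b ((\<Sum>c\<in>Basis. g c *\<^sub>R c) \<bullet> b)) = (\<lambda>g. \<Prod>b\<in>Basis. f b (g b))"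
    by (intro ext prod.cong refl) (simp add: inner)
  have "has_bochner_integral (\<Pi>\<^sub>M b\<in>(Basis::'a set). lborel) (\<lambda>g. \<Prod>b\<in>Basis. f b (g b))
     (\<Prod>b\<in>Basis. integral\<^sup>L lborel (f b))"
    using product_integrable_prod[of Basis f] product_integral_prod[of Basis f] int
    by (simp add: has_bochner_integral_iff)
  moreover have meas: "(\<lambda>f. \<Sum>b\<in>Basis. f b *\<^sub>R b) \<in> borel_measurable (\<Pi>\<^sub>M b\<in>(Basis::'a set). lborel)"
    by measurable
  ultimately have "has_bochner_integral (distr (\<Pi>\<^sub>M b\<in>(Basis::'a set). lborel) borel (\<lambda>f. \<Sum>b\<in>Basis. f b *\<^sub>R b))
     (\<lambda>x. \<Prod>b\<in>Basis. f b (x \<bullet> b)) (\<Prod>b\<in>Basis. integral\<^sup>L lborel (f b))"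
    by (intro has_bochner_integral_distr m meas) (simp only: eq)
  then show ?thesis
    unfolding lborel_eq[symmetric] ival val prod[symmetric] .
qed

lemma lborel_has_bochner_integral_affine:
  fixes f :: "'a::euclidean_space \<Rightarrow> 'b::{banach, second_countable_topology}"
  assumes c: "c \<noteq> 0" and f: "has_bochner_integral lborel f v"
  shows "has_bochner_integral lborel (\<lambda>x. f (t + c *\<^sub>R x)) (v /\<^sub>R (\<bar>c\<bar> ^ DIM('a)))"
proof -
  have [measurable]: "f \<in> borel_measurable borel"
    using f by (auto simp: has_bochner_integral_iff dest: borel_measurable_integrable)
  have "has_bochner_integral (density (distr lborel borel (\<lambda>x. t + c *\<^sub>R x)) (\<lambda>_. ennreal (\<bar>c\<bar> ^ DIM('a)))) f v"
    using f lborel_affine[OF c, of t] by (simp add: ennreal_power)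
  then have "has_bochner_integral (distr lborel borel (\<lambda>x. t + c *\<^sub>R x)) (\<lambda>x. (\<bar>c\<bar> ^ DIM('a)) *\<^sub>R f x) v"
    by (simp add: has_bochner_integral_iff integrable_density integral_density)
  then have "has_bochner_integral lborel (\<lambda>x. (\<bar>c\<bar> ^ DIM('a)) *\<^sub>R f (t + c *\<^sub>R x)) v"
    by (simp add: has_bochner_integral_iff integrable_distr_eq integral_distr)
  from has_bochner_integral_scaleR_right[OF this, of "inverse (\<bar>c\<bar> ^ DIM('a))"] c
  show ?thesis by simp
qed

text \<open>The factor \<open>gauss \<epsilon>\<close> damps integrals over all of space and tends to \<open>1\<close> as \<open>\<epsilon>\<close> tends to \<open>0\<close>. Its
Fourier transform \<open>gauss_hat \<epsilon>\<close> is an approximate identity: rescaled to unit width it is the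
probability density \<open>gauss_hat 1\<close> (\<open>gauss_hat_scale\<close>, \<open>gauss_hat_integral\<close>).\<close>

definition gauss :: "real \<Rightarrow> 'a::euclidean_space \<Rightarrow> real" where
  "gauss \<epsilon> x = exp (- (\<epsilon> * norm x)\<^sup>2 / 2)"

definition gauss_hat :: "real \<Rightarrow> 'a::euclidean_space \<Rightarrow> real" where
  "gauss_hat \<epsilon> w = (sqrt (2 * pi) / \<epsilon>) ^ DIM('a) * exp (- (2 * pi * norm w / \<epsilon>)\<^sup>2 / 2)"

lemma gauss_transform:
  fixes w :: "'a::euclidean_space"
  assumes "\<epsilon> > 0"
  shows "has_bochner_integral lborel (\<lambda>x::'a. complex_of_real (gauss \<epsilon> x) * expo w x) (complex_of_real (gauss_hat \<epsilon> w))"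
proof -
  let ?w = "(2 * pi / \<epsilon>) *\<^sub>R w"
  from lborel_has_bochner_integral_affine[OF _ Gaussian_char[of ?w], of \<epsilon> 0] assms
  have h: "has_bochner_integral lborel
     (\<lambda>x::'a. complex_of_real (exp (- (norm (\<epsilon> *\<^sub>R x))\<^sup>2 / 2)) * exp (\<i> * of_real ((\<epsilon> *\<^sub>R x) \<bullet> ?w)))
     (complex_of_real (sqrt (2 * pi) ^ DIM('a) * exp (- (norm ?w)\<^sup>2 / 2)) /\<^sub>R (\<epsilon> ^ DIM('a)))"
    by simp
  have e: "exp (\<i> * of_real ((\<epsilon> *\<^sub>R x) \<bullet> ?w)) = expo w x" for x
    using assms by (simp add: expo_def inner_commute mult_ac)
  have n: "norm (\<epsilon> *\<^sub>R x) = \<epsilon> * norm x" for x :: 'a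
    using assms by simp
  have v: "complex_of_real (sqrt (2 * pi) ^ DIM('a) * exp (- (norm ?w)\<^sup>2 / 2)) /\<^sub>R (\<epsilon> ^ DIM('a))
      = complex_of_real (gauss_hat \<epsilon> w)"
  proof -
    have n: "norm ?w = 2 * pi * norm w / \<epsilon>" using assms by simp
    have g: "gauss_hat \<epsilon> w = (sqrt (2 * pi) ^ DIM('a) * exp (- (norm ?w)\<^sup>2 / 2)) / \<epsilon> ^ DIM('a)"
      unfolding gauss_hat_def n by (simp only: power_divide times_divide_eq_left)
    have "complex_of_real a /\<^sub>R r = complex_of_real (a / r)" for a r
      by (simp only: scaleR_conv_of_real divide_inverse of_real_mult mult.commute)
    then show ?thesis unfolding g .
  qed
  show ?thesis using h unfolding n e v gauss_def .
qed

lemma gauss_nonneg: "0 \<le> gauss \<epsilon> x" by (simp add: gauss_def)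

lemma gauss_hat_nonneg: "0 < \<epsilon> \<Longrightarrow> 0 \<le> gauss_hat \<epsilon> x" by (simp add: gauss_hat_def)

lemma gauss_integrable: "0 < \<epsilon> \<Longrightarrow> integrable lborel (gauss \<epsilon> :: 'a::euclidean_space \<Rightarrow> real)"
  using has_bochner_integral_bounded_linear[OF bounded_linear_Re gauss_transform[of \<epsilon> "0::'a"]]
  by (auto simp: has_bochner_integral_iff)

lemma gauss_hat_scale:
  assumes "0 < \<epsilon>"
  shows "\<epsilon> ^ DIM('a) * gauss_hat \<epsilon> (\<epsilon> *\<^sub>R w) = gauss_hat 1 (w :: 'a::euclidean_space)"
  using assms by (simp add: gauss_hat_def power_divide power_mult_distrib)

lemma gauss_hat_integral: "has_bochner_integral lborel (gauss_hat 1 :: 'a::euclidean_space \<Rightarrow> real) 1"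
proof -
  \<comment> \<open>\<open>gauss_hat 1\<close> is a multiple of \<open>gauss (2 * pi)\<close>, whose integral is its transform at \<open>0\<close>\<close>
  have "has_bochner_integral lborel (\<lambda>x::'a. complex_of_real (gauss (2 * pi) x)) (complex_of_real (gauss_hat (2 * pi) (0::'a)))"
    using gauss_transform[of "2 * pi" "0::'a"] by simp
  from has_bochner_integral_bounded_linear[OF bounded_linear_Re this]
  have "has_bochner_integral lborel (\<lambda>x::'a. gauss (2 * pi) x) (gauss_hat (2 * pi) (0::'a))" by simp
  from has_bochner_integral_mult_right[OF this, of "sqrt (2 * pi) ^ DIM('a)"]
  have "has_bochner_integral lborel (\<lambda>x::'a. sqrt (2 * pi) ^ DIM('a) * gauss (2 * pi) x)
     (sqrt (2 * pi) ^ DIM('a) * gauss_hat (2 * pi) (0::'a))" by simp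
  moreover have "sqrt (2 * pi) ^ DIM('a) * gauss_hat (2 * pi) (0::'a) = 1"
    by (simp add: gauss_hat_def flip: power_mult_distrib)
  ultimately show ?thesis by (simp add: gauss_hat_def[abs_def] gauss_def)
qed

lemma borel_measurable_cnj [measurable (raw)]:
  "f \<in> borel_measurable M \<Longrightarrow> (\<lambda>x. cnj (f x)) \<in> borel_measurable M"
  by (rule borel_measurable_continuous_on[OF continuous_on_cnj[OF continuous_on_id]])

lemma Fubini_dominated:
  fixes f :: "'a::euclidean_space \<Rightarrow> 'b::euclidean_space \<Rightarrow> complex"
  assumes [measurable]: "case_prod f \<in> borel_measurable (lborel \<Otimes>\<^sub>M lborel)"
    and g: "integrable lborel g" and h: "integrable lborel h"
    and b: "\<And>x y. cmod (f x y) \<le> g x * h y"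
  shows "(\<integral>x. (\<integral>y. f x y \<partial>lborel) \<partial>lborel) = (\<integral>y. (\<integral>x. f x y \<partial>lborel) \<partial>lborel)"
proof -
  have fx: "integrable lborel (\<lambda>y. f x y)" for x
    by (rule Bochner_Integration.integrable_bound[of _ "\<lambda>y. g x * h y"])
      (use h b in \<open>auto intro: order_trans[OF b abs_ge_self]\<close>)
  have "integrable (lborel \<Otimes>\<^sub>M lborel) (case_prod f)"
  proof (rule lborel_pair.Fubini_integrable)
    show "integrable lborel (\<lambda>x. \<integral>y. norm (case_prod f (x, y)) \<partial>lborel)"
    proof (rule Bochner_Integration.integrable_bound)
      show "integrable lborel (\<lambda>x. g x * (\<integral>y. h y \<partial>lborel))" using g by simp
      show "AE x in lborel. norm (\<integral>y. norm (case_prod f (x, y)) \<partial>lborel) \<le> norm (g x * (\<integral>y. h y \<partial>lborel))"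
      proof (rule AE_I2)
        fix x
        have "(\<integral>y. norm (f x y) \<partial>lborel) \<le> (\<integral>y. g x * h y \<partial>lborel)"
          by (rule integral_mono) (use fx h b in auto)
        then show "norm (\<integral>y. norm (case_prod f (x, y)) \<partial>lborel) \<le> norm (g x * (\<integral>y. h y \<partial>lborel))"
          by (simp add: Bochner_Integration.integral_nonneg)
      qed
    qed measurable
  qed (use fx in auto)
  from lborel_pair.Fubini_integral[OF this] show ?thesis by simp
qed


section \<open>Plancherel's theorem for Riemann measurable sets\<close>

locale Riemann_set = bounded_measurable S for S :: "'a::euclidean_space set" +
  assumes frontier_null: "emeasure lebesgue (frontier S) = 0"
begin

abbreviation U where "U \<equiv> interior S"

lemma U_borel [measurable]: "U \<in> sets borel" by simp

lemma U_integrable: "integrable lborel (indicator U :: 'a \<Rightarrow> real)"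
proof -
  have "bounded U" using S_bounded bounded_subset interior_subset by blast
  then have "emeasure lborel U < \<infinity>" by (rule emeasure_bounded_finite)
  then show ?thesis by (intro integrable_real_indicator) auto
qed

text \<open>The boundary of \<open>S\<close> is a null set, so \<open>S\<close> may be replaced by an open set. Then the indicator
function is lower semicontinuous, which makes the limit \<open>\<epsilon> \<rightarrow> 0\<close> below pointwise.\<close>

lemma ip_interior:
  assumes "cont f" "cont g"
  shows "ip f g = (\<integral>t. indicator U t * (f t * cnj (g t)) \<partial>lborel)"
proof -
  have c: "cont (\<lambda>t. f t * cnj (g t))" by (intro continuous_intros assms)
  have m: "(\<lambda>t. f t * cnj (g t)) \<in> borel_measurable borel"
    using c by (rule borel_measurable_continuous_onI)
  have "ip f g = (\<integral>t. indicator S t *\<^sub>R (f t * cnj (g t)) \<partial>lebesgue)"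
    unfolding L2_inner_def by (rule integral_restrict_space) simp
  also have "\<dots> = (\<integral>t. indicator U t * (f t * cnj (g t)) \<partial>lebesgue)"
  proof (rule integral_cong_AE)
    have "frontier S \<in> null_sets lebesgue"
      using frontier_null by (auto intro!: null_setsI)
    moreover have "indicator S t *\<^sub>R (f t * cnj (g t)) = indicator U t * (f t * cnj (g t))"
      if "t \<notin> frontier S" for t
    proof -
      have "t \<in> S \<longleftrightarrow> t \<in> U"
        using that interior_subset closure_subset[of S] unfolding frontier_def by blast
      then show ?thesis by (simp add: indicator_def)
    qed
    ultimately show "AE t in lebesgue. indicator S t *\<^sub>R (f t * cnj (g t)) = indicator U t * (f t * cnj (g t))"
      by (intro AE_I'[of "frontier S"]) auto
    have [measurable]: "(\<lambda>t. f t * cnj (g t)) \<in> borel_measurable lebesgue"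
      using m by (intro measurable_completion) simp
    show "(\<lambda>t. indicator S t *\<^sub>R (f t * cnj (g t))) \<in> borel_measurable lebesgue" by measurable
    have [measurable]: "U \<in> sets lebesgue" by simp
    show "(\<lambda>t. indicator U t * (f t * cnj (g t))) \<in> borel_measurable lebesgue" by measurable
  qed
  also have "\<dots> = (\<integral>t. indicator U t * (f t * cnj (g t)) \<partial>lborel)"
    by (rule integral_completion) (use m in measurable)
  finally show ?thesis .
qed

lemma expo_swap: "expo x t = expo t (x::'a)"
  by (simp add: expo_def inner_commute)

lemma borel_expo [measurable (raw)]:
  assumes "f \<in> borel_measurable M" "g \<in> borel_measurable M"
  shows "(\<lambda>x. expo (f x) (g x :: 'a)) \<in> borel_measurable M"
  unfolding expo_def using assms by measurable

lemma borel_gauss [measurable]: "(gauss \<epsilon> :: 'a \<Rightarrow> real) \<in> borel_measurable borel"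
  unfolding gauss_def[abs_def] by measurable

lemma borel_gauss_hat [measurable]: "(gauss_hat \<epsilon> :: 'a \<Rightarrow> real) \<in> borel_measurable borel"
  unfolding gauss_hat_def[abs_def] by measurable

lemma borel_ip_expo [measurable]:
  "(\<lambda>x. ip (expo x) (expo n)) \<in> borel_measurable borel" "(\<lambda>x. ip (expo n) (expo x)) \<in> borel_measurable borel"
  by (subst ip_interior, simp, simp, measurable)+

lemma ip_expo_bound: "cmod (ip (expo m) (expo n)) \<le> measure lebesgue S"
proof -
  have "cmod (ip (expo m) (expo n)) \<le> nrm (expo m) * nrm (expo n)"
    by (rule Cauchy_Schwarz) simp_all
  also have "\<dots> = measure lebesgue S"
    unfolding nrm_expo[of 0, symmetric] by (simp add: L2_norm_def power2_eq_square)
  finally show ?thesis .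
qed

text \<open>Write both inner products as integrals over \<open>U\<close>. The damping makes everything absolutely
integrable, so Fubini's theorem lets the integral over \<open>x\<close> come first. It produces
\<open>gauss_hat \<epsilon> (u - t)\<close>, and the substitution \<open>u = t + \<epsilon> v\<close> moves \<open>\<epsilon>\<close> into the argument of the indicator.\<close>

lemma damped_Plancherel:
  assumes \<epsilon>: "0 < \<epsilon>"
  shows "(\<integral>x. gauss \<epsilon> x * (ip (expo m) (expo x) * ip (expo x) (expo n)) \<partial>lborel)
    = (\<integral>t. indicator U t * expo m t * (\<integral>v. gauss_hat 1 v * (indicator U (t + \<epsilon> *\<^sub>R v) * cnj (expo n (t + \<epsilon> *\<^sub>R v))) \<partial>lborel) \<partial>lborel)"
proof -
  let ?B = "\<lambda>x. ip (expo x) (expo n)"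
  have in2: "(\<integral>x. gauss \<epsilon> x * (?B x * cnj (expo x t)) \<partial>lborel)
     = (\<integral>v. gauss_hat 1 v * (indicator U (t + \<epsilon> *\<^sub>R v) * cnj (expo n (t + \<epsilon> *\<^sub>R v))) \<partial>lborel)" for t
  proof -
    have "(\<integral>x. gauss \<epsilon> x * (?B x * cnj (expo x t)) \<partial>lborel)
       = (\<integral>x. (\<integral>u. gauss \<epsilon> x * indicator U u * (cnj (expo n u) * expo (u - t) x) \<partial>lborel) \<partial>lborel)"
    proof (rule Bochner_Integration.integral_cong[OF refl])
      fix x
      have "(\<integral>u. gauss \<epsilon> x * indicator U u * (cnj (expo n u) * expo (u - t) x) \<partial>lborel)
         = (\<integral>u. (gauss \<epsilon> x * cnj (expo x t)) * (indicator U u * (expo x u * cnj (expo n u))) \<partial>lborel)"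
      proof (rule Bochner_Integration.integral_cong[OF refl])
        fix u
        have "expo (u - t) x = expo x u * cnj (expo x t)"
          using expo_add[of u "-t" x] by (simp add: cnj_expo expo_swap[of x] flip: cnj_expo)
        then show "gauss \<epsilon> x * indicator U u * (cnj (expo n u) * expo (u - t) x)
           = (gauss \<epsilon> x * cnj (expo x t)) * (indicator U u * (expo x u * cnj (expo n u)))"
          by (cases "u \<in> U") simp_all
      qed
      also have "\<dots> = gauss \<epsilon> x * cnj (expo x t) * ?B x"
        by (simp add: ip_interior)
      finally show "gauss \<epsilon> x * (?B x * cnj (expo x t)) = (\<integral>u. gauss \<epsilon> x * indicator U u * (cnj (expo n u) * expo (u - t) x) \<partial>lborel)"
        by simp
    qed
    also have "\<dots> = (\<integral>u. (\<integral>x. gauss \<epsilon> x * indicator U u * (cnj (expo n u) * expo (u - t) x) \<partial>lborel) \<partial>lborel)"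
    proof (rule Fubini_dominated[of _ "gauss \<epsilon>" "indicator U"])
      show "cmod (gauss \<epsilon> x * indicator U u * (cnj (expo n u) * expo (u - t) x)) \<le> gauss \<epsilon> x * indicator U u" for x u
        by (simp add: norm_mult gauss_nonneg)
    qed (auto simp: gauss_integrable \<epsilon> U_integrable)
    also have "\<dots> = (\<integral>u. indicator U u * cnj (expo n u) * gauss_hat \<epsilon> (u - t) \<partial>lborel)"
    proof (rule Bochner_Integration.integral_cong[OF refl])
      fix u
      have "(\<integral>x. gauss \<epsilon> x * indicator U u * (cnj (expo n u) * expo (u - t) x) \<partial>lborel)
         = (\<integral>x. (indicator U u * cnj (expo n u)) * (gauss \<epsilon> x * expo (u - t) x) \<partial>lborel)"
        by (rule Bochner_Integration.integral_cong) (auto simp: indicator_def)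
      also have "\<dots> = indicator U u * cnj (expo n u) * gauss_hat \<epsilon> (u - t)"
        using has_bochner_integral_integral_eq[OF gauss_transform[OF \<epsilon>, of "u - t"]] by simp
      finally show "(\<integral>x. gauss \<epsilon> x * indicator U u * (cnj (expo n u) * expo (u - t) x) \<partial>lborel)
        = indicator U u * cnj (expo n u) * gauss_hat \<epsilon> (u - t)" .
    qed
    also have "\<dots> = \<epsilon> ^ DIM('a) *\<^sub>R (\<integral>v. indicator U (t + \<epsilon> *\<^sub>R v) * cnj (expo n (t + \<epsilon> *\<^sub>R v)) * gauss_hat \<epsilon> (\<epsilon> *\<^sub>R v) \<partial>lborel)"
    proof -
      let ?f = "\<lambda>u. indicator U u * cnj (expo n u) * complex_of_real (gauss_hat \<epsilon> (u - t))"
      have [measurable]: "?f \<in> borel_measurable borel" by measurable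
      have "integral\<^sup>L lborel ?f = integral\<^sup>L (density (distr lborel borel (\<lambda>x. t + \<epsilon> *\<^sub>R x)) (\<lambda>_. ennreal (\<epsilon> ^ DIM('a)))) ?f"
        using lborel_affine[of \<epsilon> t] \<epsilon> by (simp add: ennreal_power)
      also have "\<dots> = (\<integral>v. \<epsilon> ^ DIM('a) *\<^sub>R ?f (t + \<epsilon> *\<^sub>R v) \<partial>lborel)"
        using \<epsilon> by (subst integral_density) (auto simp: integral_distr)
      finally show ?thesis by simp
    qed
    also have "\<dots> = (\<integral>v. gauss_hat 1 v * (indicator U (t + \<epsilon> *\<^sub>R v) * cnj (expo n (t + \<epsilon> *\<^sub>R v))) \<partial>lborel)"
      unfolding integral_scaleR_right[symmetric] gauss_hat_scale[OF \<epsilon>, symmetric]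
      by (rule Bochner_Integration.integral_cong) (auto simp: scaleR_conv_of_real)
    finally show ?thesis .
  qed
  have "(\<integral>x. gauss \<epsilon> x * (ip (expo m) (expo x) * ?B x) \<partial>lborel)
     = (\<integral>x. (\<integral>t. gauss \<epsilon> x * indicator U t * (expo m t * (?B x * cnj (expo x t))) \<partial>lborel) \<partial>lborel)"
  proof (rule Bochner_Integration.integral_cong[OF refl])
    fix x
    have "(\<integral>t. gauss \<epsilon> x * indicator U t * (expo m t * (?B x * cnj (expo x t))) \<partial>lborel)
       = (\<integral>t. (gauss \<epsilon> x * ?B x) * (indicator U t * (expo m t * cnj (expo x t))) \<partial>lborel)"
      by (rule Bochner_Integration.integral_cong) (auto simp: indicator_def)
    also have "\<dots> = gauss \<epsilon> x * ?B x * ip (expo m) (expo x)"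
      by (simp add: ip_interior[of "expo m"])
    finally show "gauss \<epsilon> x * (ip (expo m) (expo x) * ?B x) = (\<integral>t. gauss \<epsilon> x * indicator U t * (expo m t * (?B x * cnj (expo x t))) \<partial>lborel)"
      by simp
  qed
  also have "\<dots> = (\<integral>t. (\<integral>x. gauss \<epsilon> x * indicator U t * (expo m t * (?B x * cnj (expo x t))) \<partial>lborel) \<partial>lborel)"
  proof (rule Fubini_dominated[of _ "gauss \<epsilon>" "\<lambda>t. measure lebesgue S * indicator U t"])
    show "cmod (gauss \<epsilon> x * indicator U t * (expo m t * (?B x * cnj (expo x t)))) \<le> gauss \<epsilon> x * (measure lebesgue S * indicator U t)" for x t
      using ip_expo_bound[of x n] gauss_nonneg[of \<epsilon> x] by (auto simp: norm_mult indicator_def mult_left_mono)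
  qed (auto simp: gauss_integrable \<epsilon> U_integrable)
  also have "\<dots> = (\<integral>t. indicator U t * expo m t * (\<integral>x. gauss \<epsilon> x * (?B x * cnj (expo x t)) \<partial>lborel) \<partial>lborel)"
    unfolding integral_mult_right_zero[symmetric]
    by (intro Bochner_Integration.integral_cong refl) (auto simp: indicator_def)
  finally show ?thesis unfolding in2 .
qed

lemma damped_Plancherel_limit:
  fixes e :: "nat \<Rightarrow> real"
  assumes e: "\<And>j. 0 < e j" "e \<longlonglongrightarrow> 0"
  shows "(\<lambda>j. \<integral>x. gauss (e j) x * (ip (expo m) (expo x) * ip (expo x) (expo n)) \<partial>lborel)
           \<longlonglongrightarrow> ip (expo m) (expo n)"
proof -
  define J where "J j t = (\<integral>v. gauss_hat 1 v * (indicator U (t + e j *\<^sub>R v) * cnj (expo n (t + e j *\<^sub>R v))) \<partial>lborel)"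
    for j and t :: 'a
  have gh: "integrable lborel (gauss_hat 1 :: 'a \<Rightarrow> real)" "integral\<^sup>L lborel (gauss_hat 1 :: 'a \<Rightarrow> real) = 1"
    using gauss_hat_integral by (auto simp: has_bochner_integral_iff)
  have J_lim: "(\<lambda>j. J j t) \<longlonglongrightarrow> cnj (expo n t)" if t: "t \<in> U" for t
  proof -
    have "(\<lambda>j. J j t) \<longlonglongrightarrow> (\<integral>v. gauss_hat 1 (v::'a) * cnj (expo n t) \<partial>lborel)"
      unfolding J_def
    proof (rule integral_dominated_convergence[where w = "gauss_hat 1 :: 'a \<Rightarrow> real"])
      show "AE v in lborel. (\<lambda>j. gauss_hat 1 v * (indicator U (t + e j *\<^sub>R v) * cnj (expo n (t + e j *\<^sub>R v))))
        \<longlonglongrightarrow> complex_of_real (gauss_hat 1 v) * cnj (expo n t)"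
      proof (rule AE_I2)
        fix v :: 'a
        have "(\<lambda>j. t + e j *\<^sub>R v) \<longlonglongrightarrow> t + 0 *\<^sub>R v"
          by (intro tendsto_intros e)
        then have lim: "(\<lambda>j. t + e j *\<^sub>R v) \<longlonglongrightarrow> t" by simp
        then have "eventually (\<lambda>j. t + e j *\<^sub>R v \<in> U) sequentially"
          using t by (rule topological_tendstoD[OF _ open_interior])
        then have "(\<lambda>j. indicator U (t + e j *\<^sub>R v) :: complex) \<longlonglongrightarrow> 1"
          by (intro tendsto_eventually) (auto elim: eventually_mono)
        moreover have "(\<lambda>j. expo n (t + e j *\<^sub>R v)) \<longlonglongrightarrow> expo n t"
          using continuous_on_tendsto_compose[OF cont_expo[of UNIV n] lim] by simp
        ultimately have "(\<lambda>j. gauss_hat 1 v * (indicator U (t + e j *\<^sub>R v) * cnj (expo n (t + e j *\<^sub>R v))))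
          \<longlonglongrightarrow> complex_of_real (gauss_hat 1 v) * (1 * cnj (expo n t))"
          by (intro tendsto_intros)
        then show "(\<lambda>j. gauss_hat 1 v * (indicator U (t + e j *\<^sub>R v) * cnj (expo n (t + e j *\<^sub>R v))))
          \<longlonglongrightarrow> complex_of_real (gauss_hat 1 v) * cnj (expo n t)" by simp
      qed
      show "AE v in lborel. norm (complex_of_real (gauss_hat 1 v) * (indicator U (t + e j *\<^sub>R v) * cnj (expo n (t + e j *\<^sub>R v)))) \<le> gauss_hat 1 v" for j
        by (rule AE_I2) (auto simp: norm_mult indicator_def gauss_hat_nonneg)
    qed (use gh in auto)
    also have "(\<integral>v. gauss_hat 1 (v::'a) * cnj (expo n t) \<partial>lborel) = cnj (expo n t)"
      using gh by simp
    finally show ?thesis .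
  qed
  have J_bound: "cmod (J j t) \<le> 1" for j t
  proof -
    have "cmod (J j t) \<le> integral\<^sup>L lborel (gauss_hat 1 :: 'a \<Rightarrow> real)"
      unfolding J_def
    proof (rule order_trans[OF integral_norm_bound])
      show "(\<integral>v. cmod (gauss_hat 1 v * (indicator U (t + e j *\<^sub>R v) * cnj (expo n (t + e j *\<^sub>R v)))) \<partial>lborel) \<le> integral\<^sup>L lborel (gauss_hat 1 :: 'a \<Rightarrow> real)"
        by (rule integral_mono'[OF gh(1)]) (auto simp: norm_mult indicator_def gauss_hat_nonneg)
    qed
    then show ?thesis using gh by simp
  qed
  have J_meas [measurable]: "J j \<in> borel_measurable borel" for j
    unfolding J_def[abs_def] by measurable
  have "(\<lambda>j. \<integral>t. indicator U t * expo m t * J j t \<partial>lborel) \<longlonglongrightarrow> (\<integral>t. indicator U t * expo m t * cnj (expo n t) \<partial>lborel)"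
  proof (rule integral_dominated_convergence[where w = "indicator U"])
    show "AE t in lborel. (\<lambda>j. indicator U t * expo m t * J j t) \<longlonglongrightarrow> indicator U t * expo m t * cnj (expo n t)"
    proof (rule AE_I2)
      fix t
      show "(\<lambda>j. indicator U t * expo m t * J j t) \<longlonglongrightarrow> indicator U t * expo m t * cnj (expo n t)"
        by (cases "t \<in> U") (auto intro!: tendsto_intros J_lim)
    qed
    show "AE t in lborel. norm (indicator U t * expo m t * J j t) \<le> indicator U t" for j
      by (rule AE_I2) (use J_bound in \<open>auto simp: norm_mult indicator_def\<close>)
  qed (auto simp: U_integrable)
  then show ?thesis
    unfolding damped_Plancherel[OF e(1)] J_def[symmetric] ip_interior[OF cont_expo[of _ m] cont_expo[of _ n]]
    by (simp add: mult.assoc)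
qed

text \<open>For \<open>m = n\<close> the damped integrand is nonnegative and increases to the undamped one, so
monotone convergence shows that \<open>ip (expo m) (expo x)\<close> is square integrable in \<open>x\<close>. This provides the
dominating function for the general case.\<close>

theorem Plancherel_kernel:
  "has_bochner_integral lborel (\<lambda>x. ip (expo m) (expo x) * ip (expo x) (expo n)) (ip (expo m) (expo n))"
proof -
  define e where "e j = inverse (real (Suc j))" for j
  have e: "0 < e j" for j by (simp add: e_def)
  have e0: "e \<longlonglongrightarrow> 0" unfolding e_def[abs_def] by (rule LIMSEQ_inverse_real_of_nat)
  have g_lim: "(\<lambda>j. gauss (e j) x) \<longlonglongrightarrow> 1" for x :: 'a
  proof -
    have "(\<lambda>j. exp (- (e j * norm x)\<^sup>2 / 2)) \<longlonglongrightarrow> exp (- (0 * norm x)\<^sup>2 / 2)"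
      by (intro tendsto_intros e0) simp
    then show ?thesis by (simp add: gauss_def)
  qed
  have g_le: "gauss \<epsilon> x \<le> 1" for \<epsilon> and x :: 'a by (simp add: gauss_def)
  have sq: "integrable lborel (\<lambda>x. (cmod (ip (expo m) (expo x)))\<^sup>2)" for m
  proof (rule integral_monotone_convergence_nonneg(1))
    show "integrable lborel (\<lambda>x. gauss (e j) x * (cmod (ip (expo m) (expo x)))\<^sup>2)" for j
    proof (rule Bochner_Integration.integrable_bound)
      show "integrable lborel (\<lambda>x::'a. gauss (e j) x * (measure lebesgue S)\<^sup>2)"
        by (intro integrable_mult_left gauss_integrable e)
      show "AE x in lborel. norm (gauss (e j) x * (cmod (ip (expo m) (expo x)))\<^sup>2) \<le> norm (gauss (e j) x * (measure lebesgue S)\<^sup>2)"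
        by (rule AE_I2) (auto simp: abs_mult gauss_nonneg intro!: mult_left_mono power_mono ip_expo_bound)
    qed measurable
    have "e (Suc j) \<le> e j" for j by (simp add: e_def)
    then have "decseq e" by (rule decseq_SucI)
    then have "mono (\<lambda>j. gauss (e j) x)" for x :: 'a
    proof (intro monoI)
      fix i j :: nat assume "i \<le> j"
      then have "e j \<le> e i" using \<open>decseq e\<close> by (simp add: decseqD)
      then have "(e j * norm x)\<^sup>2 \<le> (e i * norm x)\<^sup>2"
        using e[of j] by (intro power_mono mult_right_mono) auto
      then show "gauss (e i) x \<le> gauss (e j) x" by (simp add: gauss_def)
    qed
    then show "AE x in lborel. mono (\<lambda>j. gauss (e j) x * (cmod (ip (expo m) (expo x)))\<^sup>2)"
      by (auto simp: mono_def intro!: AE_I2 mult_right_mono)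
    show "AE x in lborel. 0 \<le> gauss (e j) x * (cmod (ip (expo m) (expo x)))\<^sup>2" for j
      by (simp add: gauss_nonneg)
    show "AE x in lborel. (\<lambda>j. gauss (e j) x * (cmod (ip (expo m) (expo x)))\<^sup>2) \<longlonglongrightarrow> (cmod (ip (expo m) (expo x)))\<^sup>2"
      using tendsto_mult[OF g_lim tendsto_const] by (intro AE_I2) fastforce
    have "complex_of_real (gauss (e j) x) * (ip (expo m) (expo x) * ip (expo x) (expo m))
        = complex_of_real (gauss (e j) x * (cmod (ip (expo m) (expo x)))\<^sup>2)" for j x
      by (subst ip_commute[of "expo x"]) (simp only: complex_norm_square of_real_mult)
    with damped_Plancherel_limit[OF e e0, of m m]
    have "(\<lambda>j. complex_of_real (\<integral>x. gauss (e j) x * (cmod (ip (expo m) (expo x)))\<^sup>2 \<partial>lborel)) \<longlonglongrightarrow> ip (expo m) (expo m)"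
      by (simp only: integral_complex_of_real)
    then show "(\<lambda>j. \<integral>x. gauss (e j) x * (cmod (ip (expo m) (expo x)))\<^sup>2 \<partial>lborel) \<longlonglongrightarrow> (nrm (expo m))\<^sup>2"
      unfolding ip_self using tendsto_of_real_iff by blast
  qed measurable
  let ?f = "\<lambda>x. ip (expo m) (expo x) * ip (expo x) (expo n)"
  let ?w = "\<lambda>x. (cmod (ip (expo m) (expo x)))\<^sup>2 + (cmod (ip (expo n) (expo x)))\<^sup>2"
  have w: "integrable lborel ?w" using sq by simp
  have bd: "cmod (?f x) \<le> ?w x" for x
  proof -
    have "cmod (ip (expo x) (expo n)) = cmod (ip (expo n) (expo x))"
      by (subst ip_commute) simp
    moreover have "a * b \<le> a\<^sup>2 + b\<^sup>2" if "0 \<le> a" "0 \<le> b" for a b :: real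
      using that sum_squares_bound[of a b] mult_nonneg_nonneg[OF that] by linarith
    ultimately show ?thesis by (simp add: norm_mult)
  qed
  have int: "integrable lborel ?f"
    by (rule Bochner_Integration.integrable_bound[OF w]) (auto intro!: order_trans[OF bd])
  have "(\<lambda>j. \<integral>x. gauss (e j) x * ?f x \<partial>lborel) \<longlonglongrightarrow> integral\<^sup>L lborel ?f"
  proof (rule integral_dominated_convergence[where w = ?w])
    show "AE x in lborel. (\<lambda>j. complex_of_real (gauss (e j) x) * ?f x) \<longlonglongrightarrow> ?f x"
    proof (rule AE_I2)
      fix x
      have "(\<lambda>j. complex_of_real (gauss (e j) x) * ?f x) \<longlonglongrightarrow> complex_of_real 1 * ?f x"
        by (intro tendsto_intros g_lim)
      then show "(\<lambda>j. complex_of_real (gauss (e j) x) * ?f x) \<longlonglongrightarrow> ?f x" by simp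
    qed
    show "AE x in lborel. norm (complex_of_real (gauss (e j) x) * ?f x) \<le> ?w x" for j
    proof (rule AE_I2)
      fix x
      have "norm (complex_of_real (gauss (e j) x) * ?f x) = gauss (e j) x * cmod (?f x)"
        by (simp add: norm_mult gauss_nonneg)
      also have "\<dots> \<le> 1 * cmod (?f x)" by (intro mult_right_mono g_le) simp
      finally show "norm (complex_of_real (gauss (e j) x) * ?f x) \<le> ?w x" using bd[of x] by simp
    qed
  qed (use w in auto)
  from LIMSEQ_unique[OF this damped_Plancherel_limit[OF e e0]]
  show ?thesis using int by (simp add: has_bochner_integral_iff)
qed

end


section \<open>Averaging over a lattice\<close>

lemma emeasure_lebesgue_translation:
  fixes A :: "'a::euclidean_space set"
  shows "emeasure lebesgue ((+) a ` A) = emeasure lebesgue A"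
  using emeasure_lebesgue_affine[of 1 a A] by (simp add: add.commute cong: image_cong_simp)

lemma mem_translate_iff: "x \<in> (+) a ` A \<longleftrightarrow> x - a \<in> A" for x a :: "'a::ab_group_add"
  by (auto intro!: image_eqI[of x _ "x - a"])

locale lattice =
  fixes \<Gamma> B :: "'b::euclidean_space set"
  assumes independent_B: "independent B" and span_B: "span B = UNIV"
    and lattice_eq: "\<Gamma> = {\<Sum>b\<in>B. of_int (k b) *\<^sub>R b | k :: 'b \<Rightarrow> int. True}"
begin

abbreviation coord :: "'b \<Rightarrow> 'b \<Rightarrow> real" where
  "coord x b \<equiv> representation B x b"

lemma finite_B: "finite B"
  using independent_B by (rule finiteI_independent)

lemma coord_linear: "linear (\<lambda>x. coord x b)"
  by (rule linearI) (simp_all add: representation_add representation_scale independent_B span_B)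

lemma coord_sum: "(\<Sum>b\<in>B. coord x b *\<^sub>R b) = x"
  by (rule sum_representation_eq) (simp_all add: independent_B span_B finite_B)

lemma coord_of_sum:
  assumes "b \<in> B"
  shows "coord (\<Sum>c\<in>B. r c *\<^sub>R c) b = r b"
proof -
  have "coord (\<Sum>c\<in>B. r c *\<^sub>R c) b = (\<Sum>c\<in>B. r c * coord c b)"
    by (simp add: linear_sum[OF coord_linear] linear_scale[OF coord_linear])
  also have "\<dots> = (\<Sum>c\<in>B. if c = b then r c else 0)"
    by (rule sum.cong) (auto simp: representation_basis[OF independent_B])
  finally show ?thesis using assms finite_B by simp
qed

lemma lattice_iff: "x \<in> \<Gamma> \<longleftrightarrow> (\<forall>b\<in>B. coord x b \<in> \<int>)"
proof
  assume "x \<in> \<Gamma>"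
  then show "\<forall>b\<in>B. coord x b \<in> \<int>" by (auto simp: lattice_eq coord_of_sum)
next
  assume *: "\<forall>b\<in>B. coord x b \<in> \<int>"
  have "x = (\<Sum>b\<in>B. coord x b *\<^sub>R b)" by (simp add: coord_sum)
  also have "\<dots> = (\<Sum>b\<in>B. of_int \<lfloor>coord x b\<rfloor> *\<^sub>R b)"
    by (rule sum.cong) (use * in \<open>auto elim!: Ints_cases\<close>)
  finally show "x \<in> \<Gamma>"
    unfolding lattice_eq by (intro CollectI exI[of _ "\<lambda>b. \<lfloor>coord x b\<rfloor>"]) simp
qed

lemma zero_in: "0 \<in> \<Gamma>"
  by (simp add: lattice_iff representation_zero)

lemma add_in: "x \<in> \<Gamma> \<Longrightarrow> y \<in> \<Gamma> \<Longrightarrow> x + y \<in> \<Gamma>"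
  by (simp add: lattice_iff linear_add[OF coord_linear])

lemma diff_in: "x \<in> \<Gamma> \<Longrightarrow> y \<in> \<Gamma> \<Longrightarrow> x - y \<in> \<Gamma>"
  by (simp add: lattice_iff linear_diff[OF coord_linear])

lemma uminus_in: "x \<in> \<Gamma> \<Longrightarrow> - x \<in> \<Gamma>"
  using diff_in[OF zero_in] by simp

lemma locally_finite:
  assumes "bounded E"
  shows "finite (\<Gamma> \<inter> E)"
proof -
  obtain R where R: "\<And>x. x \<in> E \<Longrightarrow> norm x \<le> R" using assms by (auto simp: bounded_iff)
  have "\<exists>K. \<forall>x. norm (coord x b) \<le> norm x * K" for b
    using linear_conv_bounded_linear[of "\<lambda>x. coord x b"] coord_linear bounded_linear.bounded by blast
  then obtain K where K: "\<And>b x. \<bar>coord x b\<bar> \<le> norm x * K b" by (metis real_norm_def)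
  define N where "N b = \<lceil>R * \<bar>K b\<bar>\<rceil>" for b
  have "\<Gamma> \<inter> E \<subseteq> (\<lambda>k. \<Sum>b\<in>B. of_int (k b) *\<^sub>R b) ` (PiE B (\<lambda>b. {- N b..N b}))"
  proof
    fix x assume x: "x \<in> \<Gamma> \<inter> E"
    define k where "k = restrict (\<lambda>b. \<lfloor>coord x b\<rfloor>) B"
    have kb: "of_int (k b) = coord x b" if "b \<in> B" for b
      using x that by (auto simp: lattice_iff k_def elim!: Ints_cases)
    have "k b \<in> {- N b..N b}" if "b \<in> B" for b
    proof -
      have "\<bar>of_int (k b)\<bar> \<le> norm x * K b" using K[of x b] kb[OF that] by simp
      also have "\<dots> \<le> norm x * \<bar>K b\<bar>" by (intro mult_left_mono) auto
      also have "\<dots> \<le> R * \<bar>K b\<bar>" using R x by (intro mult_right_mono) auto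
      finally have "of_int \<bar>k b\<bar> \<le> R * \<bar>K b\<bar>" by simp
      then have "\<bar>k b\<bar> \<le> N b" unfolding N_def by linarith
      then show ?thesis by auto
    qed
    then have "k \<in> PiE B (\<lambda>b. {- N b..N b})" by (auto simp: k_def)
    moreover have "x = (\<Sum>b\<in>B. of_int (k b) *\<^sub>R b)"
      using coord_sum[of x] kb by (simp cong: sum.cong)
    ultimately show "x \<in> (\<lambda>k. \<Sum>b\<in>B. of_int (k b) *\<^sub>R b) ` (PiE B (\<lambda>b. {- N b..N b}))" by blast
  qed
  then show ?thesis
    by (rule finite_subset) (intro finite_imageI finite_PiE finite_B, simp)
qed

lemma countable_lattice: "countable \<Gamma>"
proof -
  have "\<Gamma> = (\<Union>n::nat. \<Gamma> \<inter> cball 0 (real n))"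
  proof (intro equalityI subsetI)
    fix x assume "x \<in> \<Gamma>"
    moreover obtain n :: nat where "norm x \<le> real n" using real_arch_simple by blast
    ultimately show "x \<in> (\<Union>n::nat. \<Gamma> \<inter> cball 0 (real n))" by auto
  qed auto
  moreover have "countable (\<Union>n::nat. \<Gamma> \<inter> cball 0 (real n))"
    by (rule countable_UN) (auto intro!: countable_finite locally_finite)
  ultimately show ?thesis by simp
qed

text \<open>The half-open parallelepiped spanned by the basis.\<close>

definition cell :: "'b set" where
  "cell = {x. \<forall>b\<in>B. 0 \<le> coord x b \<and> coord x b < 1}"

lemma bounded_cell: "bounded cell"
  unfolding bounded_iff
proof (intro exI ballI)
  fix x assume x: "x \<in> cell"
  have "norm x = norm (\<Sum>b\<in>B. coord x b *\<^sub>R b)" by (simp add: coord_sum)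
  also have "\<dots> \<le> (\<Sum>b\<in>B. norm (coord x b *\<^sub>R b))" by (rule norm_sum)
  also have "\<dots> \<le> (\<Sum>b\<in>B. norm b)"
    using x by (intro sum_mono) (auto simp: cell_def mult_left_le_one_le less_imp_le)
  finally show "norm x \<le> (\<Sum>b\<in>B. norm b)" .
qed

lemma cell_borel [measurable]: "cell \<in> sets borel"
proof -
  have [measurable]: "(\<lambda>x. coord x b) \<in> borel_measurable borel" for b
    using coord_linear linear_continuous_on linear_conv_bounded_linear borel_measurable_continuous_onI by blast
  have "{x \<in> space borel. \<forall>b\<in>B. 0 \<le> coord x b \<and> coord x b < 1} \<in> sets borel"
    using finite_B by measurable
  then show ?thesis by (simp add: cell_def)
qed

lemma cell_fundamental: "fundamental_domain \<Gamma> cell"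
  unfolding fundamental_domain_def
proof (intro conjI allI)
  show "cell \<in> sets lebesgue" by simp
  fix x
  define k where "k = (\<Sum>b\<in>B. of_int \<lfloor>coord x b\<rfloor> *\<^sub>R b)"
  show "\<exists>!\<gamma>. \<gamma> \<in> \<Gamma> \<and> x - \<gamma> \<in> cell"
  proof (rule ex1I[of _ k])
    show "k \<in> \<Gamma> \<and> x - k \<in> cell"
      by (auto simp: k_def lattice_iff cell_def coord_of_sum linear_diff[OF coord_linear]) linarith
    fix \<gamma> assume g: "\<gamma> \<in> \<Gamma> \<and> x - \<gamma> \<in> cell"
    have "coord \<gamma> b = of_int \<lfloor>coord x b\<rfloor>" if b: "b \<in> B" for b
    proof -
      obtain i where i: "coord \<gamma> b = of_int i" using g b unfolding lattice_iff by (meson Ints_cases)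
      have "0 \<le> coord x b - of_int i" "coord x b - of_int i < 1"
        using g b i by (auto simp: cell_def linear_diff[OF coord_linear])
      then have "\<lfloor>coord x b\<rfloor> = i" by (intro floor_unique) auto
      then show ?thesis using i by simp
    qed
    then show "\<gamma> = k"
      using coord_sum[of \<gamma>] by (simp add: k_def cong: sum.cong)
  qed
qed

lemma disjoint_translates:
  assumes "fundamental_domain \<Gamma> F"
  shows "disjoint_family_on (\<lambda>\<gamma>. (+) \<gamma> ` F) \<Gamma>"
  unfolding disjoint_family_on_def
proof (intro ballI impI)
  fix \<gamma> \<delta> assume gd: "\<gamma> \<in> \<Gamma>" "\<delta> \<in> \<Gamma>" "\<gamma> \<noteq> \<delta>"
  have False if "x \<in> (+) \<gamma> ` F" "x \<in> (+) \<delta> ` F" for x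
  proof -
    have "x - \<gamma> \<in> F" "x - \<delta> \<in> F" using that by (simp_all only: mem_translate_iff)
    then show False using assms gd unfolding fundamental_domain_def by blast
  qed
  then show "(+) \<gamma> ` F \<inter> (+) \<delta> ` F = {}" by blast
qed

text \<open>Cut \<open>F\<close> along the translates \<open>\<gamma> + G\<close>. Moving the pieces back by \<open>-\<gamma>\<close> gives the partition of \<open>G\<close> by the
translates of \<open>F\<close>.\<close>

lemma fundamental_domain_emeasure_eq:
  assumes F: "fundamental_domain \<Gamma> F" and G: "fundamental_domain \<Gamma> G"
  shows "emeasure lebesgue F = emeasure lebesgue G"
proof -
  have Fs: "F \<in> sets lebesgue" and Gs: "G \<in> sets lebesgue"
    using F G by (auto simp: fundamental_domain_def)
  have Fu: "\<exists>!\<gamma>. \<gamma> \<in> \<Gamma> \<and> x - \<gamma> \<in> F" and Gu: "\<exists>!\<gamma>. \<gamma> \<in> \<Gamma> \<and> x - \<gamma> \<in> G" for x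
    using F G by (auto simp: fundamental_domain_def)
  have tr: "(+) \<gamma> ` A \<in> sets lebesgue" if "A \<in> sets lebesgue" for \<gamma> and A :: "'b set"
    by (rule lebesgue_sets_translation[OF that])
  have "emeasure lebesgue F = emeasure lebesgue (\<Union>\<gamma>\<in>\<Gamma>. F \<inter> (+) \<gamma> ` G)"
  proof (rule arg_cong[where f = "emeasure lebesgue"], intro equalityI subsetI)
    fix x assume x: "x \<in> F"
    obtain \<gamma> where "\<gamma> \<in> \<Gamma>" "x - \<gamma> \<in> G" using Gu by blast
    then show "x \<in> (\<Union>\<gamma>\<in>\<Gamma>. F \<inter> (+) \<gamma> ` G)" using x by (auto intro!: image_eqI[of x _ "x - \<gamma>"])
  qed auto
  also have "\<dots> = (\<integral>\<^sup>+\<gamma>. emeasure lebesgue (F \<inter> (+) \<gamma> ` G) \<partial>count_space \<Gamma>)"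
  proof (rule emeasure_UN_countable)
    show "disjoint_family_on (\<lambda>\<gamma>. F \<inter> (+) \<gamma> ` G) \<Gamma>"
      using disjoint_translates[OF G] unfolding disjoint_family_on_def by blast
    show "F \<inter> (+) \<gamma> ` G \<in> sets lebesgue" for \<gamma> by (intro sets.Int tr Fs Gs)
  qed (rule countable_lattice)
  also have "\<dots> = (\<integral>\<^sup>+\<gamma>. emeasure lebesgue ((+) (- \<gamma>) ` F \<inter> G) \<partial>count_space \<Gamma>)"
  proof (rule nn_integral_cong)
    fix \<gamma>
    have "F \<inter> (+) \<gamma> ` G = (+) \<gamma> ` ((+) (- \<gamma>) ` F \<inter> G)" by force
    then show "emeasure lebesgue (F \<inter> (+) \<gamma> ` G) = emeasure lebesgue ((+) (- \<gamma>) ` F \<inter> G)"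
      by (simp only: emeasure_lebesgue_translation)
  qed
  also have "\<dots> = emeasure lebesgue (\<Union>\<gamma>\<in>\<Gamma>. (+) (- \<gamma>) ` F \<inter> G)"
  proof (rule emeasure_UN_countable[symmetric])
    show "disjoint_family_on (\<lambda>\<gamma>. (+) (- \<gamma>) ` F \<inter> G) \<Gamma>"
      unfolding disjoint_family_on_def
    proof (intro ballI impI)
      fix \<gamma> \<delta> assume "\<gamma> \<in> \<Gamma>" "\<delta> \<in> \<Gamma>" "\<gamma> \<noteq> \<delta>"
      then have "(+) (- \<gamma>) ` F \<inter> (+) (- \<delta>) ` F = {}"
        using disjoint_translates[OF F] uminus_in unfolding disjoint_family_on_def by (metis minus_minus)
      then show "((+) (- \<gamma>) ` F \<inter> G) \<inter> ((+) (- \<delta>) ` F \<inter> G) = {}" by blast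
    qed
    show "(+) (- \<gamma>) ` F \<inter> G \<in> sets lebesgue" for \<gamma> by (intro sets.Int tr Fs Gs)
  qed (rule countable_lattice)
  also have "(\<Union>\<gamma>\<in>\<Gamma>. (+) (- \<gamma>) ` F \<inter> G) = G"
  proof (intro equalityI subsetI)
    fix x assume x: "x \<in> G"
    obtain \<gamma> where "\<gamma> \<in> \<Gamma>" "x - \<gamma> \<in> F" using Fu by blast
    then have "- \<gamma> \<in> \<Gamma>" "x \<in> (+) (- (- \<gamma>)) ` F" by (auto simp: uminus_in intro!: image_eqI[of x _ "x - \<gamma>"])
    then show "x \<in> (\<Union>\<gamma>\<in>\<Gamma>. (+) (- \<gamma>) ` F \<inter> G)" using x by blast
  qed auto
  finally show ?thesis .
qed

lemma covol_cell: "covol \<Gamma> = measure lebesgue cell"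
proof -
  have "fundamental_domain \<Gamma> (SOME F. fundamental_domain \<Gamma> F)"
    using cell_fundamental by (rule someI)
  from fundamental_domain_emeasure_eq[OF this cell_fundamental]
  show ?thesis by (simp add: covol_def measure_def)
qed

lemma cell_lmeasurable: "cell \<in> lmeasurable"
  by (intro bounded_set_imp_lmeasurable bounded_cell) simp

definition hits :: "'b set \<Rightarrow> 'b \<Rightarrow> 'b set" where
  "hits E z = {\<gamma> \<in> \<Gamma>. \<gamma> + z \<in> E}"

lemma finite_hits:
  assumes "bounded E" shows "finite (hits E z)"
proof -
  have "hits E z \<subseteq> \<Gamma> \<inter> (\<lambda>x. x - z) ` E" by (auto simp: hits_def intro!: image_eqI)
  moreover have "finite (\<Gamma> \<inter> (\<lambda>x. x - z) ` E)"
    by (intro locally_finite bounded_translation_minus assms)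
  ultimately show ?thesis by (rule finite_subset)
qed

text \<open>The translates of the cell tile the space. As \<open>z\<close> runs through the cell and \<open>\<gamma>\<close> through the lattice,
\<open>\<gamma> + z\<close> meets each point of \<open>E\<close> exactly once.\<close>

lemma average_hits:
  assumes E: "bounded E" "E \<in> sets lebesgue"
  shows "has_bochner_integral (lebesgue_on cell) (\<lambda>z. real (card (hits E z))) (measure lebesgue E)"
proof -
  \<comment> \<open>boundedness of the cell leaves finitely many relevant \<open>\<gamma>\<close>, so that no infinite sum is interchanged\<close>
  define H where "H = {\<gamma> \<in> \<Gamma>. \<exists>z\<in>cell. \<gamma> + z \<in> E}"
  have "bounded ((\<lambda>(x, y). x - y) ` (E \<times> cell))"
    using bounded_minus_comp[OF bounded_fst bounded_snd] 
    using E(1) bounded_cell bounded_minus by (metis)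
  moreover have "H \<subseteq> \<Gamma> \<inter> (\<lambda>(x, y). x - y) ` (E \<times> cell)"
    by (force simp: H_def)
  ultimately have finH: "finite H" using locally_finite finite_subset by blast
  have Hs: "H \<subseteq> \<Gamma>" by (auto simp: H_def)
  have card: "real (card (hits E z)) = (\<Sum>\<gamma>\<in>H. indicator ((+) (- \<gamma>) ` E) z)" if z: "z \<in> cell" for z
  proof -
    have "hits E z = H \<inter> {\<gamma>. \<gamma> + z \<in> E}" using z by (auto simp: hits_def H_def)
    moreover have "(indicator ((+) (- \<gamma>) ` E) z :: real) = of_bool (\<gamma> + z \<in> E)" for \<gamma>
      by (force simp: indicator_def image_iff)
    ultimately show ?thesis using finH by (simp add: sum_of_bool_eq)
  qed
  have tr: "(+) (- \<gamma>) ` E \<in> sets lebesgue" for \<gamma>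
    by (rule lebesgue_sets_translation[OF E(2)])
  have trm: "(+) (- \<gamma>) ` E \<in> lmeasurable" for \<gamma>
    using E by (intro measurable_translation bounded_set_imp_lmeasurable)
  have ind: "has_bochner_integral (lebesgue_on cell) (indicator ((+) (- \<gamma>) ` E) :: 'b \<Rightarrow> real)
      (measure lebesgue ((+) (- \<gamma>) ` E \<inter> cell))" for \<gamma>
  proof -
    have fin: "(+) (- \<gamma>) ` E \<inter> cell \<in> lmeasurable"
      using trm cell_lmeasurable by (intro fmeasurable.Int)
    have "has_bochner_integral lebesgue (indicator ((+) (- \<gamma>) ` E \<inter> cell) :: 'b \<Rightarrow> real)
      (measure lebesgue ((+) (- \<gamma>) ` E \<inter> cell))"
      using fin by (intro has_bochner_integral_real_indicator) (auto simp: fmeasurable_def)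
    moreover have "(\<lambda>x. indicator cell x *\<^sub>R (indicator ((+) (- \<gamma>) ` E) x :: real)) = indicator ((+) (- \<gamma>) ` E \<inter> cell)"
      by (rule ext) (auto simp: indicator_def)
    ultimately show ?thesis
      by (subst has_bochner_integral_restrict_space) simp_all
  qed
  have "has_bochner_integral (lebesgue_on cell) (\<lambda>z. \<Sum>\<gamma>\<in>H. indicator ((+) (- \<gamma>) ` E) z :: real)
     (\<Sum>\<gamma>\<in>H. measure lebesgue ((+) (- \<gamma>) ` E \<inter> cell))"
    by (intro has_bochner_integral_sum ind)
  also have "(\<Sum>\<gamma>\<in>H. measure lebesgue ((+) (- \<gamma>) ` E \<inter> cell)) = (\<Sum>\<gamma>\<in>H. measure lebesgue (E \<inter> (+) \<gamma> ` cell))"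
  proof (rule sum.cong[OF refl])
    fix \<gamma>
    have "E \<inter> (+) \<gamma> ` cell = (+) \<gamma> ` ((+) (- \<gamma>) ` E \<inter> cell)" by force
    then show "measure lebesgue ((+) (- \<gamma>) ` E \<inter> cell) = measure lebesgue (E \<inter> (+) \<gamma> ` cell)"
      by (simp only: measure_def emeasure_lebesgue_translation)
  qed
  also have "\<dots> = measure lebesgue (\<Union>\<gamma>\<in>H. E \<inter> (+) \<gamma> ` cell)"
  proof (rule measure_finite_Union[symmetric, OF finH])
    show "(\<lambda>\<gamma>. E \<inter> (+) \<gamma> ` cell) ` H \<subseteq> sets lebesgue"
      using E by (auto intro!: sets.Int lebesgue_sets_translation)
    show "disjoint_family_on (\<lambda>\<gamma>. E \<inter> (+) \<gamma> ` cell) H"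
      using disjoint_translates[OF cell_fundamental] Hs unfolding disjoint_family_on_def by blast
    show "emeasure lebesgue (E \<inter> (+) \<gamma> ` cell) \<noteq> \<infinity>" for \<gamma>
    proof -
      have "E \<inter> (+) \<gamma> ` cell \<in> sets lebesgue"
        by (intro sets.Int E lebesgue_sets_translation) simp
      then have "E \<inter> (+) \<gamma> ` cell \<in> lmeasurable"
        using E(1) by (intro bounded_set_imp_lmeasurable bounded_Int) auto
      from fmeasurableD2[OF this] show ?thesis by simp
    qed
  qed
  also have "(\<Union>\<gamma>\<in>H. E \<inter> (+) \<gamma> ` cell) = E"
  proof (intro equalityI subsetI)
    fix x assume x: "x \<in> E"
    obtain \<gamma> where g: "\<gamma> \<in> \<Gamma>" "x - \<gamma> \<in> cell" using cell_fundamental unfolding fundamental_domain_def by blast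
    then have "\<gamma> \<in> H" using x by (auto simp: H_def intro!: bexI[of _ "x - \<gamma>"])
    then show "x \<in> (\<Union>\<gamma>\<in>H. E \<inter> (+) \<gamma> ` cell)" using x g by (auto intro!: image_eqI[of x _ "x - \<gamma>"])
  qed auto
  finally show ?thesis
    by (rule has_bochner_integral_cong[THEN iffD1, rotated -1]) (auto simp: space_restrict_space card)
qed

lemma average_inequality:
  fixes a b c :: real
  assumes E1: "bounded E1" "E1 \<in> sets lebesgue" and E2: "bounded E2" "E2 \<in> sets lebesgue"
    and le: "\<And>z. z \<in> cell \<Longrightarrow> a + b * card (hits E1 z) \<le> c * card (hits E2 z)"
  shows "a * covol \<Gamma> + b * measure lebesgue E1 \<le> c * measure lebesgue E2"
proof -
  interpret finite_measure "lebesgue_on cell"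
    using cell_lmeasurable finite_measure_lebesgue_on by blast
  have 1: "has_bochner_integral (lebesgue_on cell) (\<lambda>z. a) (a * covol \<Gamma>)"
    by (simp add: has_bochner_integral_iff covol_cell measure_restrict_space)
  note 2 = has_bochner_integral_add[OF 1 has_bochner_integral_mult_right[OF average_hits[OF E1], of b]]
  note 3 = has_bochner_integral_mult_right[OF average_hits[OF E2], of c]
  have "(LINT z|lebesgue_on cell. a + b * card (hits E1 z)) \<le> (LINT z|lebesgue_on cell. c * card (hits E2 z))"
    using 2 3 le by (intro integral_mono) (auto simp: has_bochner_integral_iff space_restrict_space)
  then show ?thesis using 2 3 by (simp only: has_bochner_integral_iff)
qed

text \<open>A null cell would make every average, and with it the volume of the unit cube, vanish.\<close>

lemma covol_pos: "0 < covol \<Gamma>"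
proof -
  let ?Q = "cbox (0::'b) One"
  have "covol \<Gamma> \<noteq> 0"
  proof
    assume "covol \<Gamma> = 0"
    then have null: "cell \<in> null_sets lebesgue"
      using cell_lmeasurable by (auto simp: covol_cell fmeasurable_def null_sets_def emeasure_eq_ennreal_measure)
    have "AE z in lebesgue_on cell. real (card (hits ?Q z)) = 0"
      by (subst AE_restrict_space_iff) (auto intro: AE_I'[OF null])
    then have "(LINT z|lebesgue_on cell. real (card (hits ?Q z))) = 0"
      by (rule integral_eq_zero_AE)
    then have "measure lebesgue ?Q = 0"
      using average_hits[of ?Q] by (simp add: has_bochner_integral_iff)
    then show False by simp
  qed
  then show ?thesis unfolding covol_cell by (simp add: order.strict_iff_order)
qed

end


section \<open>Windows\<close>


text \<open>The last assumption says that the density \<open>l / covol \<Gamma>\<close> of \<open>cut_project_set \<Gamma> I\<close> is the critical one.\<close>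

locale cut_project = Riemann_set S + lattice \<Gamma> Bs
  for S :: "'a::euclidean_space set" and \<Gamma> Bs :: "('a \<times> real) set" +
  fixes I :: "real set" and a l :: real
  assumes l_pos: "0 < l" and window: "I = {a..<a + l} \<or> I = {a<..a + l}"
    and inj_fst: "inj_on fst \<Gamma>" and dense_snd: "closure (snd ` \<Gamma>) = UNIV"
    and length_notin: "l \<notin> snd ` \<Gamma>"
    and critical: "measure lebesgue S * covol \<Gamma> = l"
begin

abbreviation model :: "real set \<Rightarrow> 'a set" where
  "model W \<equiv> cut_project_set \<Gamma> W"

lemma model_iff: "x \<in> model W \<longleftrightarrow> (\<exists>\<gamma>\<in>\<Gamma>. fst \<gamma> = x \<and> snd \<gamma> \<in> W)"
  by (force simp: cut_project_set_def)

lemma model_mono: "W \<subseteq> W' \<Longrightarrow> model W \<subseteq> model W'"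
  by (auto simp: cut_project_set_def)

lemma model_fst: "\<gamma> \<in> \<Gamma> \<Longrightarrow> fst \<gamma> \<in> model W \<longleftrightarrow> snd \<gamma> \<in> W"
  using inj_fst by (auto simp: model_iff inj_on_def)

lemma model_shift:
  assumes "\<gamma> \<in> \<Gamma>"
  shows "x - fst \<gamma> \<in> model W \<longleftrightarrow> x \<in> model ((+) (snd \<gamma>) ` W)"
proof
  assume "x - fst \<gamma> \<in> model W"
  then obtain \<delta> where d: "\<delta> \<in> \<Gamma>" "fst \<delta> = x - fst \<gamma>" "snd \<delta> \<in> W" by (auto simp: model_iff)
  show "x \<in> model ((+) (snd \<gamma>) ` W)"
    unfolding model_iff by (rule bexI[of _ "\<gamma> + \<delta>"]) (use d add_in assms in auto)
next
  assume "x \<in> model ((+) (snd \<gamma>) ` W)"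
  then obtain \<delta> where d: "\<delta> \<in> \<Gamma>" "fst \<delta> = x" "snd \<delta> \<in> (+) (snd \<gamma>) ` W" by (auto simp: model_iff)
  show "x - fst \<gamma> \<in> model W"
    unfolding model_iff by (rule bexI[of _ "\<delta> - \<gamma>"]) (use d diff_in assms in auto)
qed

lemma finite_lattice_strip:
  assumes "bounded E" "bounded W"
  shows "finite {\<gamma> \<in> \<Gamma>. fst \<gamma> \<in> E \<and> snd \<gamma> \<in> W}"
proof -
  have "{\<gamma> \<in> \<Gamma>. fst \<gamma> \<in> E \<and> snd \<gamma> \<in> W} = \<Gamma> \<inter> (E \<times> W)" by auto
  then show ?thesis using assms by (simp add: locally_finite bounded_Times)
qed

lemma finite_model:
  assumes "bounded E" "bounded W"
  shows "finite (model W \<inter> E)"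
proof -
  have "model W \<inter> E = fst ` {\<gamma> \<in> \<Gamma>. fst \<gamma> \<in> E \<and> snd \<gamma> \<in> W}"
    by (force simp: cut_project_set_def)
  then show ?thesis using finite_lattice_strip[OF assms] by simp
qed

lemma snd_dense: "u < v \<Longrightarrow> \<exists>\<gamma>\<in>\<Gamma>. u < snd \<gamma> \<and> snd \<gamma> < v"
proof -
  assume "u < v"
  then have "(u + v) / 2 \<in> {u<..<v}" by auto
  moreover have "(u + v) / 2 \<in> closure (snd ` \<Gamma>)" by (simp add: dense_snd)
  ultimately have "snd ` \<Gamma> \<inter> {u<..<v} \<noteq> {}"
    unfolding closure_iff_nhds_not_empty
    by (metis Int_commute open_greaterThanLessThan order_refl)
  then obtain \<gamma> where "\<gamma> \<in> \<Gamma>" "snd \<gamma> \<in> {u<..<v}" by blast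
  then show ?thesis by (intro bexI[of _ \<gamma>]) auto
qed

text \<open>Approaching the position \<open>s\<close> from below turns a window with either convention at its
  end points into \<open>{s..<s + l}\<close>.\<close>

lemma window_shift:
  assumes P: "finite P"
  shows "\<exists>\<gamma>\<in>\<Gamma>. \<bar>snd \<gamma> - (s - a)\<bar> < 1 \<and> (\<forall>v\<in>P. v \<in> {s..<s + l} \<longleftrightarrow> v - snd \<gamma> \<in> I)"
proof -
  have "\<forall>v\<in>P. \<exists>h>0. (v < s \<longrightarrow> h < s - v) \<and> (v < s + l \<longrightarrow> h < s + l - v)"
  proof
    fix v
    show "\<exists>h>0. (v < s \<longrightarrow> h < s - v) \<and> (v < s + l \<longrightarrow> h < s + l - v)"
    proof (cases "v < s")
      case True
      then show ?thesis using l_pos by (intro exI[of _ "(s - v) / 2"]) auto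
    next
      case False
      show ?thesis
      proof (cases "v < s + l")
        case True
        with False show ?thesis by (intro exI[of _ "(s + l - v) / 2"]) auto
      next
        case F: False
        with False show ?thesis by (intro exI[of _ 1]) auto
      qed
    qed
  qed
  then obtain h where h: "\<And>v. v \<in> P \<Longrightarrow> 0 < h v \<and> (v < s \<longrightarrow> h v < s - v) \<and> (v < s + l \<longrightarrow> h v < s + l - v)"
    by metis
  define h0 where "h0 = Min (insert 1 (h ` P))"
  have h0: "0 < h0" "h0 \<le> 1" "\<And>v. v \<in> P \<Longrightarrow> h0 \<le> h v"
    using P h by (auto simp: h0_def)
  obtain \<gamma> where g: "\<gamma> \<in> \<Gamma>" "s - a - h0 < snd \<gamma>" "snd \<gamma> < s - a"
    using snd_dense[of "s - a - h0" "s - a"] h0 by auto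
  show ?thesis
  proof (intro bexI[OF _ g(1)] conjI ballI)
    show "\<bar>snd \<gamma> - (s - a)\<bar> < 1" using g h0 by auto
    fix v assume v: "v \<in> P"
    have "v < s \<longrightarrow> h0 < s - v" "v < s + l \<longrightarrow> h0 < s + l - v"
      using h[OF v] h0(3)[OF v] by auto
    then show "v \<in> {s..<s + l} \<longleftrightarrow> v - snd \<gamma> \<in> I"
      using window g by (elim disjE) auto
  qed
qed

lemma I_subset: "I \<subseteq> {a..a + l}"
  using window by auto

text \<open>Consequently every bounded piece of a model set with window \<open>{s..<s + l}\<close> is a translate
  of a piece of \<open>model I\<close>.\<close>

lemma pattern_shift:
  obtains \<gamma> where "\<gamma> \<in> \<Gamma>" "\<bar>snd \<gamma> - (s - a)\<bar> < 1"
    "\<And>x. norm x < R \<Longrightarrow> x \<in> model {s..<s + l} \<longleftrightarrow> x - fst \<gamma> \<in> model I"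
proof -
  define Q where "Q = {\<gamma> \<in> \<Gamma>. fst \<gamma> \<in> ball 0 R \<and> snd \<gamma> \<in> {s - 1..s + l + 1}}"
  have "finite Q" unfolding Q_def by (rule finite_lattice_strip) auto
  then obtain \<gamma> where g: "\<gamma> \<in> \<Gamma>" "\<bar>snd \<gamma> - (s - a)\<bar> < 1"
    "\<And>v. v \<in> snd ` Q \<Longrightarrow> v \<in> {s..<s + l} \<longleftrightarrow> v - snd \<gamma> \<in> I"
    using window_shift[of "snd ` Q" s] by auto
  have "x \<in> model {s..<s + l} \<longleftrightarrow> x - fst \<gamma> \<in> model I" if x: "norm x < R" for x
  proof -
    have "snd \<delta> \<in> {s..<s + l} \<longleftrightarrow> snd \<delta> \<in> (+) (snd \<gamma>) ` I" if d: "\<delta> \<in> \<Gamma>" "fst \<delta> = x" for \<delta>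
    proof (cases "\<delta> \<in> Q")
      case True
      then show ?thesis using g(3)[of "snd \<delta>"] by (auto simp: mem_translate_iff simp del: add_uminus_conv_diff)
    next
      case False
      then have "snd \<delta> \<notin> {s - 1..s + l + 1}" using x d by (auto simp: Q_def)
      moreover have "snd \<delta> - snd \<gamma> \<notin> {a..a + l}" using calculation g(2) by auto
      ultimately show ?thesis using I_subset by (auto simp: mem_translate_iff)
    qed
    then show ?thesis unfolding model_shift[OF g(1)] unfolding model_iff by blast
  qed
  with g show ?thesis using that by blast
qed

lemma finite_pattern_shift:
  assumes X: "finite X" "X \<subseteq> model {s..<s + l}"
  shows "\<exists>y. (+) y ` X \<subseteq> model I"
proof -
  have "bounded X" using X(1) by (rule finite_imp_bounded)
  then obtain R where R: "X \<subseteq> ball 0 R" using bounded_subset_ballD by blast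
  obtain \<gamma> where "\<gamma> \<in> \<Gamma>" "\<bar>snd \<gamma> - (s - a)\<bar> < 1"
    and g: "\<And>x. norm x < R \<Longrightarrow> x \<in> model {s..<s + l} \<longleftrightarrow> x - fst \<gamma> \<in> model I"
    by (rule pattern_shift[of s R]) (rule that)
  have "(+) (- fst \<gamma>) ` X \<subseteq> model I"
  proof
    fix u assume "u \<in> (+) (- fst \<gamma>) ` X"
    then obtain x where x: "x \<in> X" "u = x - fst \<gamma>" by auto
    then have "norm x < R" "x \<in> model {s..<s + l}" using R X(2) by auto
    then show "u \<in> model I" using g x(2) by blast
  qed
  then show ?thesis by blast
qed

lemma Bessel_window:
  assumes B: "Bessel b (model I)"
  shows "Bessel b (model {s..<s + l})"
  unfolding Bessel_def
proof (intro conjI allI impI)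
  show "0 \<le> b" using B by (simp add: Bessel_def)
  fix X f assume X: "finite X" "X \<subseteq> model {s..<s + l}" and f: "cont f"
  obtain y where y: "(+) y ` X \<subseteq> model I" using finite_pattern_shift[OF X] by blast
  have "Bessel b ((+) (- y) ` (+) y ` X)"
    by (intro Bessel_translate Bessel_mono[OF B y]) simp
  moreover have "(+) (- y) ` (+) y ` X = X" by (simp add: image_image)
  ultimately show "sqsum X (coef f) \<le> b * (nrm f)\<^sup>2" using BesselD X(1) f by fastforce
qed

text \<open>A bounded window is covered by finitely many translates of the interior of \<open>I\<close>. The gain is
uniformity: a single Bessel sequence contains the model sets for all window positions in a bounded
range, so its tail controls all of theirs.\<close>

lemma Bessel_bounded_window:
  assumes B: "Bessel b (model I)" and W: "bounded W"
  shows "\<exists>b. Bessel b (model W)"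
proof -
  define O1 where "O1 = (\<lambda>\<gamma> :: 'a \<times> real. {snd \<gamma> + a<..<snd \<gamma> + a + l})"
  have "closure W \<subseteq> (\<Union>\<gamma>\<in>\<Gamma>. O1 \<gamma>)"
  proof
    fix v
    obtain \<gamma> where "\<gamma> \<in> \<Gamma>" "v - a - l < snd \<gamma>" "snd \<gamma> < v - a"
      using snd_dense[of "v - a - l" "v - a"] l_pos by auto
    then show "v \<in> (\<Union>\<gamma>\<in>\<Gamma>. O1 \<gamma>)" by (auto simp: O1_def intro!: bexI[of _ \<gamma>])
  qed
  moreover have "compact (closure W)" using W by simp
  ultimately obtain F where F: "F \<subseteq> \<Gamma>" "finite F" "closure W \<subseteq> (\<Union>\<gamma>\<in>F. O1 \<gamma>)"
    using compactE_image[of "closure W" \<Gamma> O1] unfolding O1_def by auto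
  have "\<exists>b. Bessel b (\<Union>\<gamma>\<in>F. (+) (fst \<gamma>) ` model I)"
    by (rule Bessel_UN[OF F(2)]) (use Bessel_translate[OF B] in blast)
  moreover have "model W \<subseteq> (\<Union>\<gamma>\<in>F. (+) (fst \<gamma>) ` model I)"
  proof
    fix x assume "x \<in> model W"
    then obtain \<delta> where d: "\<delta> \<in> \<Gamma>" "fst \<delta> = x" "snd \<delta> \<in> W" by (auto simp: model_iff)
    then obtain \<gamma> where g: "\<gamma> \<in> F" "snd \<delta> \<in> O1 \<gamma>" using F(3) closure_subset by blast
    have "snd \<delta> - snd \<gamma> \<in> I" using g(2) window by (auto simp: O1_def)
    then have "x - fst \<gamma> \<in> model I"
      unfolding model_iff using d g F(1) by (intro bexI[of _ "\<delta> - \<gamma>"]) (auto simp: diff_in)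
    then show "x \<in> (\<Union>\<gamma>\<in>F. (+) (fst \<gamma>) ` model I)"
      using g(1) by (intro UN_I) (simp_all only: mem_translate_iff)
  qed
  ultimately show ?thesis using Bessel_mono by blast
qed

end


section \<open>Counting points in balls\<close>


lemma measure_ball_strip:
  fixes R u v :: real
  assumes "u \<le> v"
  shows "measure lebesgue (ball (0::'a::euclidean_space) R \<times> {u..<v}) = measure lborel (ball (0::'a) R) * (v - u)"
proof -
  have "emeasure lborel (ball (0::'a) R \<times> {u..<v}) = emeasure lborel (ball (0::'a) R) * emeasure lborel {u..<v}"
    unfolding lborel_prod[symmetric] by (rule lborel.emeasure_pair_measure_Times) auto
  then have "measure lborel (ball (0::'a) R \<times> {u..<v}) = measure lborel (ball (0::'a) R) * (v - u)"
    using assms by (simp add: measure_def enn2real_mult)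
  moreover have "ball (0::'a) R \<times> {u..<v} \<in> sets borel" by (intro borel_Times) auto
  ultimately show ?thesis by (simp add: measure_completion)
qed

lemma bounded_strip: "bounded (ball (0::'a::euclidean_space) R \<times> {u..<v::real})"
  by (intro bounded_Times) auto

lemma strip_sets: "ball (0::'a::euclidean_space) R \<times> {u..<v::real} \<in> sets lebesgue"
proof -
  have "ball (0::'a) R \<times> {u..<v} \<in> sets borel" by (intro borel_Times) auto
  then show ?thesis by simp
qed

text \<open>The volumes of concentric balls with radii \<open>R\<close> and \<open>R + r\<close> have a quotient that tends to \<open>1\<close>.\<close>

lemma ball_volume_limit:
  assumes le: "\<And>R. 0 < R \<Longrightarrow> \<alpha> * measure lborel (ball (0::'a::euclidean_space) R) \<le> \<beta> * measure lborel (ball (0::'a) (R + r))"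
    and r: "0 \<le> r"
  shows "\<alpha> \<le> \<beta>"
proof -
  let ?n = "DIM('a)" and ?V = "unit_ball_vol (real DIM('a))"
  have V: "0 < ?V" by simp
  have ev: "eventually (\<lambda>R::real. \<alpha> \<le> \<beta> * ((R + r) / R) ^ ?n) at_top"
    using eventually_gt_at_top[of 0]
  proof eventually_elim
    case (elim R)
    have "\<alpha> * (?V * R ^ ?n) \<le> \<beta> * (?V * (R + r) ^ ?n)"
      using le[OF elim] elim r by (simp add: content_ball)
    then have "?V * (\<alpha> * R ^ ?n) \<le> ?V * (\<beta> * (R + r) ^ ?n)" by (simp add: mult_ac)
    then have "\<alpha> * R ^ ?n \<le> \<beta> * (R + r) ^ ?n"
      using V mult_le_cancel_left_pos by blast
    then show ?case using elim by (simp add: power_divide field_simps)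
  qed
  have "((\<lambda>R::real. (R + r) / R) \<longlongrightarrow> 1) at_top"
    by real_asymp
  then have "((\<lambda>R::real. \<beta> * ((R + r) / R) ^ ?n) \<longlongrightarrow> \<beta> * 1 ^ ?n) at_top"
    by (intro tendsto_intros)
  then show ?thesis
    using tendsto_lowerbound[OF _ ev] by simp
qed

context cut_project
begin

text \<open>The model set attached to the lattice translated by \<open>z\<close>, within the region \<open>E\<close>.\<close>

definition points :: "('a \<times> real) set \<Rightarrow> 'a \<times> real \<Rightarrow> 'a set" where
  "points E z = (\<lambda>\<gamma>. fst \<gamma> + fst z) ` hits E z"

text \<open>Only the lattice points above the ball whose second coordinate lies in \<open>{l..l + 1}\<close> could enter.
There are finitely many of them, and none has second coordinate exactly \<open>l\<close>.\<close>

lemma window_leaves_zero: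
  obtains \<delta> where "0 < \<delta>" "\<delta> \<le> 1"
    "\<And>t. 0 < t \<Longrightarrow> t \<le> \<delta> \<Longrightarrow> model {t..<t + l} \<inter> ball 0 R \<subseteq> model {0<..<l}"
proof -
  define Q where "Q = {\<gamma> \<in> \<Gamma>. fst \<gamma> \<in> ball 0 R \<and> snd \<gamma> \<in> {l..l + 1}}"
  have finQ: "finite Q" unfolding Q_def by (rule finite_lattice_strip) auto
  define \<delta> where "\<delta> = Min (insert 1 ((\<lambda>\<gamma>. snd \<gamma> - l) ` Q))"
  have "0 < snd \<gamma> - l" if "\<gamma> \<in> Q" for \<gamma>
    using that length_notin by (auto simp: Q_def order.strict_iff_order)
  then have \<delta>: "0 < \<delta>" "\<delta> \<le> 1" "\<And>\<gamma>. \<gamma> \<in> Q \<Longrightarrow> \<delta> \<le> snd \<gamma> - l"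
    unfolding \<delta>_def using finQ by auto
  show ?thesis
  proof (rule that[OF \<delta>(1,2)], rule subsetI)
    fix t x assume t: "0 < t" "t \<le> \<delta>" and x: "x \<in> model {t..<t + l} \<inter> ball 0 R"
    then have "x \<in> model {t..<t + l}" by blast
    then obtain \<gamma> where g: "\<gamma> \<in> \<Gamma>" "fst \<gamma> = x" "snd \<gamma> \<in> {t..<t + l}"
      unfolding model_iff by blast
    have "\<gamma> \<notin> Q" using \<delta>(3)[of \<gamma>] g t by auto
    then have "snd \<gamma> \<in> {0<..<l}" using g x t \<delta>(2) by (auto simp: Q_def)
    then show "x \<in> model {0<..<l}" using g by (auto simp: model_iff)
  qed
qed

lemma inj_on_points: "inj_on (\<lambda>\<gamma>. fst \<gamma> + fst z) (hits E z)"
  using inj_fst by (auto simp: inj_on_def hits_def)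

lemma card_points: "card (points E z) = card (hits E z)"
  unfolding points_def by (rule card_image[OF inj_on_points])

lemma finite_points: "bounded E \<Longrightarrow> finite (points E z)"
  unfolding points_def by (intro finite_imageI finite_hits)

lemma lattice_isolated:
  obtains \<rho> where "0 < \<rho>" "\<And>\<gamma>. \<gamma> \<in> \<Gamma> \<Longrightarrow> norm (fst \<gamma>) < \<rho> \<Longrightarrow> \<bar>snd \<gamma>\<bar> < \<rho> \<Longrightarrow> \<gamma> = 0"
proof -
  have fin: "finite (\<Gamma> \<inter> cball 0 2 - {0})" by (intro finite_Diff locally_finite) auto
  define m where "m = Min (insert 1 (norm ` (\<Gamma> \<inter> cball 0 2 - {0})))"
  have m: "0 < m" "m \<le> 1" "\<And>\<gamma>. \<gamma> \<in> \<Gamma> \<Longrightarrow> norm \<gamma> \<le> 2 \<Longrightarrow> \<gamma> \<noteq> 0 \<Longrightarrow> m \<le> norm \<gamma>"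
    using fin by (auto simp: m_def)
  show ?thesis
  proof (rule that[of "m / 2"])
    fix \<gamma> assume g: "\<gamma> \<in> \<Gamma>" "norm (fst \<gamma>) < m / 2" "\<bar>snd \<gamma>\<bar> < m / 2"
    have "norm \<gamma> \<le> norm (fst \<gamma>) + norm (snd \<gamma>)" using norm_Pair_le[of "fst \<gamma>" "snd \<gamma>"] by simp
    then have "norm \<gamma> < m" using g(2,3) by simp
    show "\<gamma> = 0"
    proof (rule ccontr)
      assume "\<gamma> \<noteq> 0"
      then have "m \<le> norm \<gamma>" using m(2) \<open>norm \<gamma> < m\<close> by (intro m(3) g(1)) auto
      then show False using \<open>norm \<gamma> < m\<close> by simp
    qed
  qed (use m in auto)
qed

end


section \<open>Riesz sequences\<close>

locale Riesz_model = cut_project S \<Gamma> Bs I a l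
  for S :: "'a::euclidean_space set" and \<Gamma> Bs :: "('a \<times> real) set" and I a l +
  fixes A b :: real
  assumes A_pos: "0 < A"
    and lower: "\<And>X c. finite X \<Longrightarrow> X \<subseteq> model I \<Longrightarrow> A * sqsum X c \<le> (nrm (trig_poly X c))\<^sup>2"
    and upper: "Bessel b (model I)"
begin

lemma lower_window:
  assumes "finite X" "X \<subseteq> model {s..<s + l}"
  shows "A * sqsum X c \<le> (nrm (trig_poly X c))\<^sup>2"
proof -
  obtain y where y: "(+) y ` X \<subseteq> model I" using finite_pattern_shift[OF assms] by blast
  have "A * sqsum ((+) y ` X) (\<lambda>x. c (x - y)) \<le> (nrm (trig_poly ((+) y ` X) (\<lambda>x. c (x - y))))\<^sup>2"
    using assms y by (intro lower) auto
  moreover have "trig_poly ((+) y ` X) (\<lambda>x. c (x - y)) = (\<lambda>t. expo y t * trig_poly X c t)"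
    by (rule ext) (simp add: trig_poly_translate)
  ultimately show ?thesis by (simp add: sqsum_translate nrm_modulate)
qed

text \<open>Let \<open>L0\<close> be the model set with window \<open>{0<..<l}\<close>. Together with \<open>0\<close> it is part of the Riesz sequence
with window \<open>{0..<l}\<close>, so \<open>expo 0\<close> has squared distance at least \<open>A\<close> from its span. Take \<open>w\<close> to be an almost
orthogonal residual of \<open>expo 0\<close>, and test with it a combination of exponentials whose window starts at a
small \<open>t > 0\<close>. The frequencies in \<open>L0\<close> contribute little by orthogonality. The other ones
lie far away, where the coefficients of \<open>w\<close> have small square sum. And \<open>ip w (expo 0)\<close> is large.\<close>

lemma Riesz_gap:
  obtains \<delta> \<eta> \<kappa> where "0 < \<delta>" "0 < \<eta>" "0 < \<kappa>"
    "\<And>t x X c. 0 < t \<Longrightarrow> t \<le> \<delta> \<Longrightarrow> norm x < \<eta> \<Longrightarrow> finite X \<Longrightarrow> X \<subseteq> model {t..<t + l} \<Longrightarrow>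
       \<kappa> \<le> (nrm (\<lambda>u. expo x u - trig_poly X c u))\<^sup>2"
proof -
  define e0 where "e0 = expo (0::'a)"
  define L0 where "L0 = model {0<..<l}"
  define s0 where "s0 = sqrt (measure lebesgue S)"
  have s0: "0 \<le> s0" by (simp add: s0_def)
  have b0: "0 \<le> b" using upper by (simp add: Bessel_def)
  have ce0: "cont e0" by (simp add: e0_def)
  have ne: "nrm (expo x) = s0" for x by (simp add: s0_def nrm_expo_eq)
  have zero: "0 \<in> model {0..<l}" "0 \<notin> L0"
    using model_fst[OF zero_in] l_pos by (auto simp: L0_def)
  have L0_sub: "L0 \<subseteq> model {0..<l}" unfolding L0_def by (rule model_mono) auto
  have away: "A \<le> (nrm (\<lambda>t. e0 t - trig_poly Y d t))\<^sup>2" if Y: "finite Y" "Y \<subseteq> L0" for Y d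
  proof -
    define d' where "d' = (\<lambda>x. if x = 0 then 1 else - d x)"
    have "0 \<notin> Y" using zero Y by auto
    have "trig_poly Y d' = trig_poly Y (\<lambda>x. - d x)" by (rule trig_poly_cong) (use \<open>0 \<notin> Y\<close> in \<open>auto simp: d'_def\<close>)
    then have eq: "trig_poly (insert 0 Y) d' = (\<lambda>t. e0 t - trig_poly Y d t)"
      using Y(1) \<open>0 \<notin> Y\<close> by (simp add: fun_eq_iff trig_poly_def e0_def d'_def sum_negf)
    have "A * 1 \<le> A * sqsum (insert 0 Y) d'"
      using A_pos Y(1) \<open>0 \<notin> Y\<close> sqsum_nonneg[of Y d'] by (intro mult_left_mono) (auto simp: sqsum_def d'_def)
    also have "\<dots> \<le> (nrm (trig_poly (insert 0 Y) d'))\<^sup>2"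
      by (rule lower_window[of _ 0]) (use Y zero L0_sub in auto)
    finally show ?thesis by (simp add: eq)
  qed
  \<comment> \<open>\<open>\<theta>\<close> is so small that the error terms below, all of them multiples of \<open>\<theta>\<close>, add up to at most \<open>A / 4\<close>\<close>
  define C where "C = (s0 + 1) * (sqrt b + 1) / sqrt A"
  have C: "0 \<le> C" using s0 b0 A_pos by (simp add: C_def)
  define \<theta> where "\<theta> = min 1 (A / (4 * (4 * s0 + 3 + C)))"
  have \<theta>: "0 < \<theta>" "\<theta> \<le> 1" using A_pos s0 C by (simp_all add: \<theta>_def add_nonneg_pos add_pos_nonneg)
  have \<theta>A: "\<theta> * (4 * s0 + 3 + C) \<le> A / 4"
  proof -
    have "\<theta> * (4 * s0 + 3 + C) \<le> A / (4 * (4 * s0 + 3 + C)) * (4 * s0 + 3 + C)"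
      using s0 C by (intro mult_right_mono) (auto simp: \<theta>_def)
    also have "\<dots> = A / 4" using s0 C by (simp add: field_simps)
    finally show ?thesis .
  qed
  obtain Y d where Y: "finite Y" "Y \<subseteq> L0" "(nrm (\<lambda>t. e0 t - trig_poly Y d t))\<^sup>2 \<le> (nrm e0)\<^sup>2 + \<theta>\<^sup>2"
    and orth0: "\<And>X c. finite X \<Longrightarrow> X \<subseteq> L0 \<Longrightarrow>
       cmod (ip (\<lambda>t. e0 t - trig_poly Y d t) (trig_poly X c)) \<le> \<theta> * nrm (trig_poly X c)"
    by (rule almost_orthogonal_residual[OF ce0 \<theta>(1)]) (rule that)
  define w where "w = (\<lambda>t. e0 t - trig_poly Y d t)"
  have orth: "cmod (ip w (trig_poly X c)) \<le> \<theta> * nrm (trig_poly X c)" if "finite X" "X \<subseteq> L0" for X c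
    unfolding w_def using that by (rule orth0)
  have cw: "cont w" unfolding w_def by (intro continuous_intros ce0)
  have nw: "nrm w \<le> s0 + 1"
  proof (rule power2_le_imp_le)
    have "(nrm w)\<^sup>2 \<le> s0\<^sup>2 + \<theta>\<^sup>2" using Y(3) ne[of 0] by (simp add: w_def e0_def)
    also have "\<theta>\<^sup>2 \<le> 1" using \<theta> by (simp add: power_le_one)
    also have "s0\<^sup>2 + 1 \<le> (s0 + 1)\<^sup>2" using s0 by (simp add: power2_sum)
    finally show "(nrm w)\<^sup>2 \<le> (s0 + 1)\<^sup>2" by simp
  qed (use s0 in simp)
  have big: "A - \<theta> * (2 * s0 + 1) \<le> cmod (ip w e0)"
  proof -
    have "complex_of_real ((nrm w)\<^sup>2) = ip w e0 - ip w (trig_poly Y d)"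
      unfolding ip_self[symmetric] using ip_diff_right[OF ce0 cont_trig_poly cw, of Y d] by (simp add: w_def)
    then have "(nrm w)\<^sup>2 = cmod (ip w e0 - ip w (trig_poly Y d))"
      by (metis norm_of_real abs_of_nonneg zero_le_power2)
    also have "\<dots> \<le> cmod (ip w e0) + cmod (ip w (trig_poly Y d))" by (rule norm_triangle_ineq4)
    also have "cmod (ip w (trig_poly Y d)) \<le> \<theta> * nrm (trig_poly Y d)" by (rule orth[OF Y(1,2)])
    also have "trig_poly Y d = (\<lambda>t. e0 t - w t)" by (simp add: w_def)
    also have "\<theta> * nrm (\<lambda>t. e0 t - w t) \<le> \<theta> * (2 * s0 + 1)"
      using nrm_triangle_diff[OF ce0 cw] nw ne[of 0] \<theta> by (intro mult_left_mono) (auto simp: e0_def)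
    finally have "(nrm w)\<^sup>2 \<le> cmod (ip w e0) + \<theta> * (2 * s0 + 1)" by simp
    moreover have "A \<le> (nrm w)\<^sup>2" unfolding w_def by (rule away[OF Y(1,2)])
    ultimately show ?thesis by linarith
  qed
  obtain b1 where b1: "Bessel b1 (model {0..l + 1})"
    using Bessel_bounded_window[OF upper, of "{0..l + 1}"] by auto
  obtain R where R: "0 < R"
    "\<And>X. finite X \<Longrightarrow> X \<subseteq> model {0..l + 1} \<Longrightarrow> X \<inter> ball 0 R = {} \<Longrightarrow> sqsum X (coef w) \<le> \<theta>\<^sup>2"
    using Bessel_tail[OF b1 cw, of "\<theta>\<^sup>2"] \<theta> by auto
  obtain \<delta> where \<delta>: "0 < \<delta>" "\<delta> \<le> 1"
    "\<And>t. 0 < t \<Longrightarrow> t \<le> \<delta> \<Longrightarrow> model {t..<t + l} \<inter> ball 0 R \<subseteq> model {0<..<l}"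
    by (rule window_leaves_zero[of R]) (rule that)
  obtain K where K: "0 < K" "\<And>x y. nrm (\<lambda>t. expo x t - expo y t) \<le> K * norm (x - y)"
    using nrm_expo_diff by blast
  define \<eta> where "\<eta> = \<theta> / K"
  have \<eta>: "0 < \<eta>" using K \<theta> by (simp add: \<eta>_def)
  show ?thesis
  proof (rule that[OF \<delta>(1) \<eta>, of "\<theta>\<^sup>2"])
    show "0 < \<theta>\<^sup>2" using \<theta> by simp
    fix t :: real and x :: 'a and X c
    assume t: "0 < t" "t \<le> \<delta>" and x: "norm x < \<eta>" and X: "finite X" "X \<subseteq> model {t..<t + l}"
    define u where "u = (\<lambda>s. expo x s - trig_poly X c s)"
    have cu: "cont u" unfolding u_def by (intro continuous_intros)
    show "\<theta>\<^sup>2 \<le> (nrm (\<lambda>s. expo x s - trig_poly X c s))\<^sup>2"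
    proof (rule ccontr)
      assume "\<not> \<theta>\<^sup>2 \<le> (nrm (\<lambda>s. expo x s - trig_poly X c s))\<^sup>2"
      then have "(nrm u)\<^sup>2 < \<theta>\<^sup>2" by (simp add: u_def)
      then have nu: "nrm u \<le> \<theta>" using \<theta> power_less_imp_less_base[of "nrm u" 2 \<theta>] by simp
      have "trig_poly X c = (\<lambda>s. expo x s - u s)" by (simp add: u_def)
      then have ntp: "nrm (trig_poly X c) \<le> s0 + 1"
        using nrm_triangle_diff[OF cont_expo cu, of x] ne[of x] nu \<theta> by simp
      have sq: "sqrt (sqsum X c) \<le> (s0 + 1) / sqrt A"
      proof -
        have "A * sqsum X c \<le> (s0 + 1)\<^sup>2"
          using lower_window[OF X, of c] power_mono[OF ntp nrm_nonneg, of 2] by linarith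
        then have "sqsum X c \<le> ((s0 + 1) / sqrt A)\<^sup>2"
          using A_pos by (simp add: power_divide field_simps)
        then show ?thesis using s0 A_pos by (intro real_le_lsqrt) (auto simp: sqsum_nonneg)
      qed
      \<comment> \<open>near the origin the window at \<open>t\<close> sees only \<open>L0\<close>, so \<open>X2\<close> is far away\<close>
      define X1 X2 where "X1 = X \<inter> L0" and "X2 = X - L0"
      have X12: "finite X1" "finite X2" using X by (auto simp: X1_def X2_def)
      have split: "trig_poly X c = (\<lambda>s. trig_poly X1 c s + trig_poly X2 c s)"
        unfolding trig_poly_def X1_def X2_def using X(1) by (intro ext sum.Int_Diff)
      have sq1: "sqsum X1 c \<le> sqsum X c" and sq2: "sqsum X2 c \<le> sqsum X c"
        using X(1) by (auto simp: X1_def X2_def intro!: sqsum_mono)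
      have X2sub: "X2 \<subseteq> model {0..l + 1}"
      proof -
        have "model {t..<t + l} \<subseteq> model {0..l + 1}" by (rule model_mono) (use t \<delta> in auto)
        then show ?thesis using X by (auto simp: X2_def)
      qed
      have X2far: "X2 \<inter> ball 0 R = {}" using \<delta>(3)[OF t] X(2) by (auto simp: X2_def L0_def)
      have b_1: "cmod (ip w (trig_poly X1 c)) \<le> \<theta> * (sqrt b * (s0 + 1) / sqrt A)"
      proof -
        have "X1 \<subseteq> model {0..<0 + l}" using L0_sub by (auto simp: X1_def)
        then have "Bessel b X1" by (rule Bessel_mono[OF Bessel_window[OF upper]]) simp
        then have "(nrm (trig_poly X1 c))\<^sup>2 \<le> b * sqsum X1 c" using Bessel_synthesis X12 by blast
        also have "\<dots> \<le> b * sqsum X c" using sq1 b0 by (intro mult_left_mono)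
        finally have "nrm (trig_poly X1 c) \<le> sqrt b * sqrt (sqsum X c)"
          unfolding real_sqrt_mult[symmetric] by (rule real_le_rsqrt)
        also have "\<dots> \<le> sqrt b * ((s0 + 1) / sqrt A)" using sq b0 by (intro mult_left_mono) auto
        finally have "\<theta> * nrm (trig_poly X1 c) \<le> \<theta> * (sqrt b * (s0 + 1) / sqrt A)"
          using \<theta> by (intro mult_left_mono) auto
        moreover have "cmod (ip w (trig_poly X1 c)) \<le> \<theta> * nrm (trig_poly X1 c)"
          by (rule orth) (use X12 in \<open>auto simp: X1_def\<close>)
        ultimately show ?thesis by linarith
      qed
      have b_2: "cmod (ip w (trig_poly X2 c)) \<le> \<theta> * ((s0 + 1) / sqrt A)"
      proof -
        have "ip w (trig_poly X2 c) = (\<Sum>l\<in>X2. cnj (c l) * coef w l)"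
          using X12 cw by (simp add: ip_trig_poly_right)
        then have "cmod (ip w (trig_poly X2 c)) \<le> sqrt (sqsum X2 (\<lambda>l. cnj (c l))) * sqrt (sqsum X2 (coef w))"
          using cmod_sum_le_sqsum[of "\<lambda>l. cnj (c l)" "coef w" X2] by simp
        also have "sqsum X2 (\<lambda>l. cnj (c l)) = sqsum X2 c" by (simp add: sqsum_def)
        also have "sqrt (sqsum X2 c) * sqrt (sqsum X2 (coef w)) \<le> ((s0 + 1) / sqrt A) * \<theta>"
        proof (rule mult_mono)
          show "sqrt (sqsum X2 c) \<le> (s0 + 1) / sqrt A" using sq sq2 real_sqrt_le_mono order_trans by blast
          show "sqrt (sqsum X2 (coef w)) \<le> \<theta>"
            using R(2)[OF X12(2) X2sub X2far] \<theta> by (intro real_le_lsqrt) auto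
        qed (use s0 A_pos in \<open>auto simp: sqsum_nonneg\<close>)
        finally show ?thesis by (simp add: mult.commute)
      qed
      have b_3: "cmod (ip w u) \<le> \<theta> * (s0 + 1)"
        using Cauchy_Schwarz[OF cw cu] mult_mono[OF nw nu] s0 nrm_nonneg[of u] \<theta>
        by (simp add: mult.commute)
      have b_4: "cmod (ip w (\<lambda>t. e0 t - expo x t)) \<le> \<theta> * (s0 + 1)"
      proof -
        have c: "cont (\<lambda>t. e0 t - expo x t)" by (intro continuous_intros ce0)
        have "nrm (\<lambda>t. e0 t - expo x t) \<le> K * norm (0 - x)" unfolding e0_def by (rule K(2))
        also have "\<dots> \<le> \<theta>" using x K by (simp add: \<eta>_def field_simps)
        finally have "nrm w * nrm (\<lambda>t. e0 t - expo x t) \<le> (s0 + 1) * \<theta>"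
          using nw s0 by (intro mult_mono) (auto simp: nrm_nonneg)
        then show ?thesis using Cauchy_Schwarz[OF cw c] by (simp add: mult.commute)
      qed
      have "ip w e0 = ip w (\<lambda>t. e0 t - expo x t) + (ip w u + (ip w (trig_poly X1 c) + ip w (trig_poly X2 c)))"
      proof -
        have "ip w (\<lambda>t. e0 t - expo x t) = ip w e0 - ip w (expo x)"
          by (rule ip_diff_right) (use ce0 cw in auto)
        moreover have "ip w u = ip w (expo x) - ip w (trig_poly X c)"
          unfolding u_def by (rule ip_diff_right) (use cw in auto)
        moreover have "ip w (trig_poly X c) = ip w (trig_poly X1 c) + ip w (trig_poly X2 c)"
          unfolding split by (rule ip_add_right) (use cw in auto)
        ultimately show ?thesis by simp
      qed
      then have "cmod (ip w e0) \<le> cmod (ip w (\<lambda>t. e0 t - expo x t)) + (cmod (ip w u) + (cmod (ip w (trig_poly X1 c)) + cmod (ip w (trig_poly X2 c))))"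
        by (simp only:) (intro order_trans[OF norm_triangle_ineq add_left_mono] norm_triangle_ineq)
      also have "\<dots> \<le> \<theta> * (s0 + 1) + (\<theta> * (s0 + 1) + (\<theta> * (sqrt b * (s0 + 1) / sqrt A) + \<theta> * ((s0 + 1) / sqrt A)))"
        by (intro add_mono b_1 b_2 b_3 b_4)
      also have "\<dots> = \<theta> * (2 * s0 + 2 + C)"
      proof -
        have "C = sqrt b * (s0 + 1) / sqrt A + (s0 + 1) / sqrt A"
          unfolding C_def add_divide_distrib[symmetric]
          by (rule arg_cong[where f = "\<lambda>x. x / sqrt A"]) (simp add: algebra_simps)
        moreover have "\<theta> * (s0 + 1) + (\<theta> * (s0 + 1) + (\<theta> * p + \<theta> * q)) = \<theta> * (2 * s0 + 2 + (p + q))" for p q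
          by (simp add: algebra_simps)
        ultimately show ?thesis by (simp only:)
      qed
      finally have "A \<le> \<theta> * (2 * s0 + 2 + C) + \<theta> * (2 * s0 + 1)" using big by linarith
      also have "\<dots> = \<theta> * (4 * s0 + 3 + C)" by (simp add: algebra_simps)
      finally show False using \<theta>A A_pos by linarith
    qed
  qed
qed

text \<open>The part of the squared kernel outside the ball of radius \<open>r\<close>; its integral bounds the mass that a
frequency contributes to the trace integral at distance at least \<open>r\<close>.\<close>

definition kernel_tail :: "real \<Rightarrow> 'a \<Rightarrow> real" where
  "kernel_tail r y = (if r \<le> norm y then (cmod (ip (expo y) (expo 0)))\<^sup>2 else 0)"

lemma kernel_square_integrable: "integrable lborel (\<lambda>y. (cmod (ip (expo y) (expo 0)))\<^sup>2)"
proof -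
  have eq: "ip (expo 0) (expo y) * ip (expo y) (expo 0) = complex_of_real ((cmod (ip (expo y) (expo 0)))\<^sup>2)" for y
    by (simp add: ip_commute[of "expo 0" "expo y"] complex_norm_square mult.commute del: of_real_power)
  from has_bochner_integral_bounded_linear[OF bounded_linear_Re Plancherel_kernel[of 0 0]]
  show ?thesis unfolding eq by (auto dest: integrable.intros)
qed

lemma kernel_tail_integrable: "integrable lborel (kernel_tail r)"
proof (rule Bochner_Integration.integrable_bound[OF kernel_square_integrable])
  show "kernel_tail r \<in> borel_measurable lborel" unfolding kernel_tail_def[abs_def] by measurable
qed (auto simp: kernel_tail_def)

lemma kernel_tail_limit: "(\<lambda>n. integral\<^sup>L lborel (kernel_tail (real n))) \<longlonglongrightarrow> 0"
proof -
  have "(\<lambda>n. integral\<^sup>L lborel (kernel_tail (real n))) \<longlonglongrightarrow> (\<integral>y. 0 \<partial>(lborel :: 'a measure))"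
  proof (rule integral_dominated_convergence[OF _ _ kernel_square_integrable])
    show "kernel_tail (real n) \<in> borel_measurable lborel" for n
      using kernel_tail_integrable by auto
    show "AE y in lborel. (\<lambda>n. kernel_tail (real n) y) \<longlonglongrightarrow> 0"
    proof (rule AE_I2)
      fix y :: 'a
      obtain n :: nat where "norm y < real n" using reals_Archimedean2 by blast
      then have "eventually (\<lambda>n. kernel_tail (real n) y = 0) sequentially"
        by (intro eventually_sequentiallyI[of n]) (auto simp: kernel_tail_def)
      then show "(\<lambda>n. kernel_tail (real n) y) \<longlonglongrightarrow> 0" by (rule tendsto_eventually)
    qed
    show "AE y in lborel. norm (kernel_tail (real n) y) \<le> (cmod (ip (expo y) (expo 0)))\<^sup>2" for n
      by (auto simp: kernel_tail_def)
  qed simp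
  then show ?thesis by simp
qed

text \<open>The trace identity for the points \<open>X\<close> of the translated model set in a ball of radius \<open>R\<close>. The sum is
almost the number of points. The integrand is at most \<open>|S|\<close> in the ball of radius \<open>R + r\<close>, at most
\<open>|S| - \<kappa>\<close> within distance \<open>\<eta>\<close> of the points with window coordinate in \<open>{-\<delta>..<0}\<close>, and farther away it
is bounded by the tails of the kernel. The isolation of the lattice makes the \<open>\<eta>\<close>-balls around these
points disjoint, so that their volumes add up.\<close>

lemma Riesz_local_inequality:
  assumes gap: "\<And>t x X c. 0 < t \<Longrightarrow> t \<le> \<delta> \<Longrightarrow> norm x < \<eta> \<Longrightarrow> finite X \<Longrightarrow> X \<subseteq> model {t..<t + l} \<Longrightarrow>
       \<kappa> \<le> (nrm (\<lambda>u. expo x u - trig_poly X c u))\<^sup>2"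
    and isolated: "\<And>\<gamma>. \<gamma> \<in> \<Gamma> \<Longrightarrow> norm (fst \<gamma>) < 2 * \<eta> \<Longrightarrow> \<bar>snd \<gamma>\<bar> < \<delta> \<Longrightarrow> \<gamma> = 0"
    and pos: "0 < \<delta>" "0 < \<eta>" "0 < \<kappa>" "\<eta> \<le> r" "0 < R" "0 < \<tau>"
  shows "- measure lebesgue S * measure lborel (ball (0::'a) (R + r))
      + \<kappa> * measure lborel (ball (0::'a) \<eta>) * card (hits (ball 0 R \<times> {-\<delta>..<0}) z)
    \<le> (\<tau> / A + integral\<^sup>L lborel (kernel_tail r) / A - 1) * card (hits (ball 0 R \<times> {0..<l}) z)"
proof -
  define E1 where "E1 = ball (0::'a) R \<times> {-\<delta>..<0}"
  define E2 where "E2 = ball (0::'a) R \<times> {0..<l}"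
  define X where "X = points E2 z"
  have finX: "finite X" unfolding X_def E2_def by (intro finite_points bounded_strip)
  have finH: "finite (hits E1 z)" unfolding E1_def by (intro finite_hits bounded_strip)
  have Xball: "norm x < R" if "x \<in> X" for x
    using that by (auto simp: X_def points_def hits_def E2_def mem_Times_iff)
  have X_win: "(+) (- (fst \<gamma> + fst z)) ` X \<subseteq> model {- (snd \<gamma> + snd z)..<- (snd \<gamma> + snd z) + l}" if g: "\<gamma> \<in> \<Gamma>" for \<gamma>
  proof
    fix u assume "u \<in> (+) (- (fst \<gamma> + fst z)) ` X"
    then obtain \<delta> where d: "\<delta> \<in> \<Gamma>" "\<delta> + z \<in> E2" "u = fst (\<delta> - \<gamma>)"
      by (auto simp: X_def points_def hits_def)
    then show "u \<in> model {- (snd \<gamma> + snd z)..<- (snd \<gamma> + snd z) + l}"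
      unfolding model_iff by (intro bexI[of _ "\<delta> - \<gamma>"]) (auto simp: diff_in g E2_def mem_Times_iff)
  qed
  have X_win0: "(+) (- fst z) ` X \<subseteq> model {- snd z..<- snd z + l}"
    using X_win[OF zero_in] by simp
  have X_lower: "A * sqsum X c \<le> (nrm (trig_poly X c))\<^sup>2" for c
  proof -
    let ?Y = "(+) (- fst z) ` X"
    have XY: "X = (+) (fst z) ` ?Y" by (simp add: image_image)
    have "A * sqsum ?Y (\<lambda>x. c (fst z + x)) \<le> (nrm (trig_poly ?Y (\<lambda>x. c (fst z + x))))\<^sup>2"
      using finX by (intro lower_window[OF _ X_win0]) simp
    moreover have "trig_poly X c = (\<lambda>t. expo (fst z) t * trig_poly ?Y (\<lambda>x. c (fst z + x)) t)"
      by (subst XY) (rule ext, rule trig_poly_translate)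
    moreover have "sqsum X c = sqsum ?Y (\<lambda>x. c (fst z + x))"
      by (subst XY) (rule sqsum_translate)
    ultimately show ?thesis by (simp only: nrm_modulate)
  qed
  define p where "p x = measure lebesgue S - ridge \<tau> X (expo x)" for x
  have trace: "has_bochner_integral lborel p ((\<Sum>x\<in>X. ridge \<tau> X (expo x)) / \<tau>)"
    unfolding p_def using pos(6) finX Plancherel_kernel by (rule ridge_trace)
  have ridge_X: "\<tau> * (1 - \<tau> / A) \<le> ridge \<tau> X (expo x)" if "x \<in> X" for x
    using pos(6) A_pos finX that X_lower by (rule ridge_ge_of_lower_bound)
  have lower_int: "(1 - \<tau> / A) * card X \<le> integral\<^sup>L lborel p"
  proof -
    have "card X * (\<tau> * (1 - \<tau> / A)) \<le> (\<Sum>x\<in>X. ridge \<tau> X (expo x))"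
      using sum_bounded_below[of X "\<tau> * (1 - \<tau> / A)" "\<lambda>x. ridge \<tau> X (expo x)"] ridge_X by simp
    then have "(1 - \<tau> / A) * card X \<le> (\<Sum>x\<in>X. ridge \<tau> X (expo x)) / \<tau>"
      using pos by (simp add: field_simps)
    then show ?thesis using trace by (simp add: has_bochner_integral_iff)
  qed
  \<comment> \<open>the three parts of the majorant: the large ball, the gaps and the tails\<close>
  define f1 where "f1 = (\<lambda>x. indicator (ball (0::'a) (R + r)) x :: real)"
  define f2 where "f2 = (\<lambda>x. \<Sum>\<gamma>\<in>hits E1 z. indicator (ball (fst \<gamma> + fst z) \<eta>) x :: real)"
  define f3 where "f3 = (\<lambda>x. \<Sum>y\<in>X. kernel_tail r (x - y))"
  have f3_nonneg: "0 \<le> f3 x" for x by (auto simp: f3_def kernel_tail_def intro!: sum_nonneg)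
  have pointwise: "p x \<le> measure lebesgue S * f1 x - \<kappa> * f2 x + f3 x / A" for x
  proof (cases "x \<in> ball 0 (R + r)")
    case inside: True
    show ?thesis
    proof (cases "\<exists>\<gamma>\<in>hits E1 z. x \<in> ball (fst \<gamma> + fst z) \<eta>")
      case True
      then obtain \<gamma> where g: "\<gamma> \<in> hits E1 z" "x \<in> ball (fst \<gamma> + fst z) \<eta>" by blast
      have uniq: "\<gamma>' = \<gamma>" if g': "\<gamma>' \<in> hits E1 z" "x \<in> ball (fst \<gamma>' + fst z) \<eta>" for \<gamma>'
      proof -
        have "dist (fst \<gamma>' + fst z) (fst \<gamma> + fst z) \<le> dist (fst \<gamma>' + fst z) x + dist (fst \<gamma> + fst z) x"
          by (rule dist_triangle2)
        also have "\<dots> < 2 * \<eta>" using g(2) g'(2) by simp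
        finally have "dist (fst \<gamma>' + fst z) (fst \<gamma> + fst z) < 2 * \<eta>" .
        then have "norm (fst (\<gamma>' - \<gamma>)) < 2 * \<eta>" by (simp add: dist_norm)
        moreover have "\<bar>snd (\<gamma>' - \<gamma>)\<bar> < \<delta>" using g g' by (auto simp: hits_def E1_def mem_Times_iff)
        ultimately have "\<gamma>' - \<gamma> = 0" using g g' by (intro isolated diff_in) (auto simp: hits_def)
        then show ?thesis by simp
      qed
      have "f2 x = (\<Sum>\<gamma>'\<in>hits E1 z. if \<gamma>' = \<gamma> then 1 else 0)"
        unfolding f2_def
      proof (rule sum.cong[OF refl])
        fix \<gamma>' assume "\<gamma>' \<in> hits E1 z"
        from uniq[OF this] g(2) show "indicator (ball (fst \<gamma>' + fst z) \<eta>) x = (if \<gamma>' = \<gamma> then 1 else 0 :: real)"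
          by (cases "\<gamma>' = \<gamma>") (simp, metis indicator_simps(2))
      qed
      then have f2: "f2 x = 1" using g finH by simp
      have "\<kappa> \<le> ridge \<tau> X (expo x)"
      proof (rule ridge_ge)
        fix c
        let ?y = "fst \<gamma> + fst z" and ?t = "- (snd \<gamma> + snd z)"
        let ?Y = "(+) (- ?y) ` X"
        have XY: "X = (+) ?y ` ?Y" by (simp add: image_image)
        have t: "0 < ?t" "?t \<le> \<delta>" using g by (auto simp: hits_def E1_def mem_Times_iff)
        have "\<kappa> \<le> (nrm (\<lambda>u. expo (x - ?y) u - trig_poly ?Y (\<lambda>l. c (?y + l)) u))\<^sup>2"
        proof (rule gap[OF t])
          show "norm (x - ?y) < \<eta>" using g by (simp add: dist_norm norm_minus_commute)
          show "?Y \<subseteq> model {?t..<?t + l}" by (rule X_win) (use g in \<open>auto simp: hits_def\<close>)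
        qed (use finX in simp)
        also have "\<dots> = (nrm (\<lambda>u. expo (?y + (x - ?y)) u - trig_poly ((+) ?y ` ?Y) c u))\<^sup>2"
          by (simp only: nrm_expo_trig_poly_shift)
        also have "\<dots> = (nrm (\<lambda>u. expo x u - trig_poly X c u))\<^sup>2"
          using XY by (simp only: diff_add_cancel add.commute[of ?y])
        also have "\<dots> \<le> energy \<tau> X (expo x) c" using pos by (simp add: energy_def sqsum_nonneg)
        finally show "\<kappa> \<le> energy \<tau> X (expo x) c" .
      qed
      then show ?thesis using inside f2 f3_nonneg[of x] A_pos by (simp add: p_def f1_def add_increasing2)
    next
      case False
      then have "f2 x = 0" unfolding f2_def by (intro sum.neutral) (auto simp: indicator_def)
      moreover have "0 \<le> ridge \<tau> X (expo x)" using pos by (intro ridge_nonneg) simp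
      ultimately show ?thesis using inside f3_nonneg[of x] A_pos by (simp add: p_def f1_def add_increasing2)
    qed
  next
    case outside: False
    have "f2 x = 0"
      unfolding f2_def
    proof (intro sum.neutral ballI)
      fix \<gamma> assume "\<gamma> \<in> hits E1 z"
      then have "norm (fst \<gamma> + fst z) < R" by (auto simp: hits_def E1_def mem_Times_iff)
      then have "x \<notin> ball (fst \<gamma> + fst z) \<eta>"
        using outside pos norm_triangle_sub[of x "fst \<gamma> + fst z"] by (auto simp: dist_norm norm_minus_commute)
      then show "indicator (ball (fst \<gamma> + fst z) \<eta>) x = (0::real)" by simp
    qed
    moreover have "f1 x = 0" using outside by (simp add: f1_def)
    moreover have "f3 x = sqsum X (coef (expo x))"
      unfolding f3_def sqsum_def
    proof (rule sum.cong[OF refl])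
      fix y assume "y \<in> X"
      then have "norm y < R" by (rule Xball)
      then have "r \<le> norm (x - y)"
        using outside norm_triangle_sub[of x y] by (auto simp: )
      moreover have "ip (expo x) (expo y) = ip (expo (x - y)) (expo 0)"
        using ip_modulate[of y "expo (x - y)" "expo 0"] by (simp flip: expo_add del: expo_0)
      ultimately show "kernel_tail r (x - y) = (cmod (ip (expo x) (expo y)))\<^sup>2" by (simp add: kernel_tail_def)
    qed
    moreover have "measure lebesgue S - sqsum X (coef (expo x)) / A \<le> ridge \<tau> X (expo x)"
      using ridge_ge_coef[OF _ A_pos finX cont_expo X_lower, of \<tau> x] pos(6) by (simp add: nrm_expo)
    ultimately show ?thesis by (simp add: p_def)
  qed
  have ball_int: "has_bochner_integral lborel (\<lambda>x. indicator (ball y q) x :: real) (measure lborel (ball y q))" for y :: 'a and q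
    using emeasure_bounded_finite[of "ball y q"] by (intro has_bochner_integral_real_indicator) auto
  have 1: "has_bochner_integral lborel f1 (measure lborel (ball (0::'a) (R + r)))"
    unfolding f1_def by (rule ball_int)
  have 2: "has_bochner_integral lborel f2 (card (hits E1 z) * measure lborel (ball (0::'a) \<eta>))"
  proof -
    have "has_bochner_integral lborel f2 (\<Sum>\<gamma>\<in>hits E1 z. measure lborel (ball (fst \<gamma> + fst z) \<eta>))"
      unfolding f2_def by (intro has_bochner_integral_sum ball_int)
    also have "(\<Sum>\<gamma>\<in>hits E1 z. measure lborel (ball (fst \<gamma> + fst z) \<eta>)) = (\<Sum>\<gamma>\<in>hits E1 z. measure lborel (ball (0::'a) \<eta>))"
      using pos by (intro sum.cong refl) (simp add: content_ball)
    finally show ?thesis by simp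
  qed
  have 3: "has_bochner_integral lborel f3 (card X * integral\<^sup>L lborel (kernel_tail r))"
  proof -
    have "has_bochner_integral lborel (\<lambda>x. kernel_tail r (x - y)) (integral\<^sup>L lborel (kernel_tail r))" for y
      using lborel_has_bochner_integral_affine[of 1 "kernel_tail r" "integral\<^sup>L lborel (kernel_tail r)" "- y"]
        kernel_tail_integrable by (simp add: has_bochner_integral_iff)
    then have "has_bochner_integral lborel f3 (\<Sum>y\<in>X. integral\<^sup>L lborel (kernel_tail r))"
      unfolding f3_def by (intro has_bochner_integral_sum)
    then show ?thesis by simp
  qed
  have "has_bochner_integral lborel (\<lambda>x. measure lebesgue S * f1 x - \<kappa> * f2 x + f3 x / A)
     (measure lebesgue S * measure lborel (ball (0::'a) (R + r)) - \<kappa> * (card (hits E1 z) * measure lborel (ball (0::'a) \<eta>))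
       + card X * integral\<^sup>L lborel (kernel_tail r) / A)"
    by (intro has_bochner_integral_add has_bochner_integral_diff has_bochner_integral_mult_right
        has_bochner_integral_divide_zero 1 2 3)
  moreover have "integral\<^sup>L lborel p \<le> (\<integral>x. measure lebesgue S * f1 x - \<kappa> * f2 x + f3 x / A \<partial>lborel)"
    using calculation trace pointwise by (intro integral_mono) (auto simp: has_bochner_integral_iff)
  ultimately have "integral\<^sup>L lborel p \<le> measure lebesgue S * measure lborel (ball (0::'a) (R + r)) - \<kappa> * (card (hits E1 z) * measure lborel (ball (0::'a) \<eta>))
       + card X * integral\<^sup>L lborel (kernel_tail r) / A"
    by (simp only: has_bochner_integral_iff)
  with lower_int have "(1 - \<tau> / A) * card X \<le> measure lebesgue S * measure lborel (ball (0::'a) (R + r)) - \<kappa> * (card (hits E1 z) * measure lborel (ball (0::'a) \<eta>))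
       + card X * integral\<^sup>L lborel (kernel_tail r) / A" by linarith
  moreover have "card X = card (hits E2 z)" by (simp add: X_def card_points)
  ultimately show ?thesis unfolding E1_def[symmetric] E2_def[symmetric] by (simp add: algebra_simps)
qed

text \<open>Averaging over the cell and letting \<open>R\<close> tend to infinity leaves
\<open>\<kappa> v \<delta> \<le> (\<tau> + T r) l / A\<close>, where \<open>v\<close> is the volume of an \<open>\<eta>\<close>-ball. The left side is a positive constant,
and the right side is arbitrarily small.\<close>

theorem no_critical_Riesz: False
proof -
  obtain \<delta>1 \<eta>1 \<kappa> where gap: "0 < \<delta>1" "0 < \<eta>1" "0 < \<kappa>"
    "\<And>t x X c. 0 < t \<Longrightarrow> t \<le> \<delta>1 \<Longrightarrow> norm x < \<eta>1 \<Longrightarrow> finite X \<Longrightarrow> X \<subseteq> model {t..<t + l} \<Longrightarrow>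
       \<kappa> \<le> (nrm (\<lambda>u. expo x u - trig_poly X c u))\<^sup>2"
    by (rule Riesz_gap) (rule that)
  obtain \<rho> where \<rho>: "0 < \<rho>" "\<And>\<gamma>. \<gamma> \<in> \<Gamma> \<Longrightarrow> norm (fst \<gamma>) < \<rho> \<Longrightarrow> \<bar>snd \<gamma>\<bar> < \<rho> \<Longrightarrow> \<gamma> = 0"
    by (rule lattice_isolated) (rule that)
  define \<delta> where "\<delta> = min \<delta>1 \<rho>"
  define \<eta> where "\<eta> = min \<eta>1 (\<rho> / 2)"
  have pos: "0 < \<delta>" "0 < \<eta>" using gap \<rho> by (auto simp: \<delta>_def \<eta>_def)
  define v where "v = measure lborel (ball (0::'a) \<eta>)"
  have v: "0 < v" using pos by (simp add: v_def)
  define T where "T r = integral\<^sup>L lborel (kernel_tail r)" for r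
  have main: "\<kappa> * v * \<delta> \<le> (\<tau> / A + T r / A) * l" if r: "\<eta> \<le> r" and \<tau>: "0 < \<tau>" for r \<tau>
  proof -
    have "(\<kappa> * v * \<delta> + (1 - (\<tau> / A + T r / A)) * l) * measure lborel (ball (0::'a) R) \<le> l * measure lborel (ball (0::'a) (R + r))"
      if R: "0 < R" for R
    proof -
      let ?b = "measure lborel (ball (0::'a) R)" and ?B = "measure lborel (ball (0::'a) (R + r))"
      have ineq: "(- measure lebesgue S * ?B) * covol \<Gamma> + \<kappa> * v * measure lebesgue (ball (0::'a) R \<times> {-\<delta>..<0})
        \<le> (\<tau> / A + T r / A - 1) * measure lebesgue (ball (0::'a) R \<times> {0..<l})"
      proof (rule average_inequality[OF bounded_strip strip_sets bounded_strip strip_sets])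
        fix z
        show "- measure lebesgue S * ?B + \<kappa> * v * card (hits (ball 0 R \<times> {-\<delta>..<0}) z)
          \<le> (\<tau> / A + T r / A - 1) * card (hits (ball 0 R \<times> {0..<l}) z)"
          unfolding v_def T_def
          by (rule Riesz_local_inequality)
            (use gap \<rho> pos r R \<tau> in \<open>auto simp: \<delta>_def \<eta>_def\<close>)
      qed
      have eq: "(- measure lebesgue S * ?B) * covol \<Gamma> = - (l * ?B)"
        unfolding critical[symmetric] by simp
      have m1: "measure lebesgue (ball (0::'a) R \<times> {-\<delta>..<0}) = ?b * \<delta>"
        using measure_ball_strip[of "- \<delta>" 0 R, where 'a = 'a] pos by simp
      have m2: "measure lebesgue (ball (0::'a) R \<times> {0..<l}) = ?b * l"
        using measure_ball_strip[of 0 l R, where 'a = 'a] l_pos by simp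
      from ineq[unfolded eq m1 m2] show ?thesis by (simp add: algebra_simps)
    qed
    from ball_volume_limit[OF this] r pos
    have "\<kappa> * v * \<delta> + (1 - (\<tau> / A + T r / A)) * l \<le> l" by simp
    then show ?thesis by (simp add: algebra_simps)
  qed
  \<comment> \<open>with \<open>\<mu>\<close> in place of both \<open>\<tau>\<close> and \<open>T r\<close> the right side is half of the left side\<close>
  define \<mu> where "\<mu> = \<kappa> * v * \<delta> * A / (4 * l)"
  have \<mu>: "0 < \<mu>" using gap v pos A_pos l_pos by (simp add: \<mu>_def)
  have "eventually (\<lambda>n. T (real n) < \<mu>) sequentially"
    using kernel_tail_limit \<mu> unfolding T_def by (rule order_tendstoD)
  moreover have "eventually (\<lambda>n. \<eta> \<le> real n) sequentially"
    using eventually_ge_at_top[of "nat \<lceil>\<eta>\<rceil>"] by eventually_elim linarith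
  ultimately have "eventually (\<lambda>n. T (real n) < \<mu> \<and> \<eta> \<le> real n) sequentially"
    by (rule eventually_conj)
  then obtain n where n: "T (real n) < \<mu>" "\<eta> \<le> real n"
    by (auto simp: eventually_sequentially)
  have "\<kappa> * v * \<delta> \<le> (\<mu> / A + T (real n) / A) * l" by (rule main[OF n(2) \<mu>])
  also have "\<dots> \<le> (\<mu> / A + \<mu> / A) * l"
    using n A_pos l_pos by (intro mult_right_mono add_mono divide_right_mono) auto
  also have "\<dots> = \<kappa> * v * \<delta> / 2" using A_pos l_pos by (simp add: \<mu>_def)
  finally have "\<kappa> * v * \<delta> \<le> 0" by linarith
  moreover have "0 < \<kappa> * v * \<delta>" using gap v pos by simp
  ultimately show False by linarith
qed

end


section \<open>Frames\<close>

text \<open>The lower frame inequality enters through finite parts of the frame sum. The assumption \<open>A \<le> b\<close>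
keeps the convergence rate of the frame algorithm real.\<close>

locale frame_model = cut_project S \<Gamma> Bs I a l
  for S :: "'a::euclidean_space set" and \<Gamma> Bs :: "('a \<times> real) set" and I a l +
  fixes A b :: real
  assumes A_pos: "0 < A" and Ab: "A \<le> b"
    and lower: "\<And>f \<epsilon>. cont f \<Longrightarrow> 0 < \<epsilon> \<Longrightarrow> \<exists>X. finite X \<and> X \<subseteq> model I \<and> A * (nrm f)\<^sup>2 \<le> sqsum X (coef f) + \<epsilon>"
    and upper: "Bessel b (model I)"
begin

abbreviation patch :: "real \<Rightarrow> real \<Rightarrow> 'a set" where
  "patch s R \<equiv> model {s..<s + l} \<inter> ball 0 R"

lemma finite_patch: "finite (patch s R)"
  by (rule finite_model) auto

lemma Bessel_patch: "Bessel b (patch s R)"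
  by (rule Bessel_mono[OF Bessel_window[OF upper]]) auto

text \<open>Outside a large ball the frame sums over all windows in question are bounded by the tail of one Bessel
sequence. Inside the ball the patch at \<open>s\<close> is a translate of a patch of \<open>model I\<close>, where the lower
frame inequality is known.\<close>

lemma lower_uniform:
  assumes f: "cont f" and \<epsilon>: "0 < \<epsilon>"
  obtains R where "0 < R" "\<And>s. s0 \<le> s \<Longrightarrow> s \<le> s1 \<Longrightarrow> A * (nrm f)\<^sup>2 \<le> sqsum (patch s R) (coef f) + \<epsilon>"
proof -
  obtain b1 where b1: "Bessel b1 (model {s0 - 1..s1 + l + 1})"
    using Bessel_bounded_window[OF upper, of "{s0 - 1..s1 + l + 1}"] by auto
  obtain R where R: "0 < R"
    "\<And>X. finite X \<Longrightarrow> X \<subseteq> model {s0 - 1..s1 + l + 1} \<Longrightarrow> X \<inter> ball 0 R = {} \<Longrightarrow> sqsum X (coef f) \<le> \<epsilon> / 2"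
    using Bessel_tail[OF b1 f, of "\<epsilon> / 2"] \<epsilon> by auto
  show ?thesis
  proof (rule that[OF R(1)])
    fix s assume s: "s0 \<le> s" "s \<le> s1"
    obtain \<gamma> where g: "\<gamma> \<in> \<Gamma>" "\<bar>snd \<gamma> - (s - a)\<bar> < 1"
      "\<And>x. norm x < R \<Longrightarrow> x \<in> model {s..<s + l} \<longleftrightarrow> x - fst \<gamma> \<in> model I"
      by (rule pattern_shift[of s R]) (rule that)
    define f' where "f' = (\<lambda>t. expo (- fst \<gamma>) t * f t)"
    have cf': "cont f'" unfolding f'_def by (intro continuous_intros f)
    obtain X where X: "finite X" "X \<subseteq> model I" "A * (nrm f')\<^sup>2 \<le> sqsum X (coef f') + \<epsilon> / 2"
      using lower[OF cf', of "\<epsilon> / 2"] \<epsilon> by auto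
    define Y where "Y = (+) (fst \<gamma>) ` X"
    have finY: "finite Y" using X by (simp add: Y_def)
    have "sqsum X (coef f') = sqsum Y (coef f)"
      unfolding Y_def sqsum_translate f'_def coef_modulate by (simp add: add.commute)
    moreover have "nrm f' = nrm f" by (simp add: f'_def nrm_modulate)
    ultimately have 1: "A * (nrm f)\<^sup>2 \<le> sqsum Y (coef f) + \<epsilon> / 2" using X by simp
    have Ysub: "y - fst \<gamma> \<in> model I" if "y \<in> Y" for y
      using that X by (auto simp: Y_def)
    have 2: "sqsum Y (coef f) = sqsum (Y \<inter> ball 0 R) (coef f) + sqsum (Y - ball 0 R) (coef f)"
      unfolding sqsum_def by (rule sum.Int_Diff[OF finY])
    have "Y \<inter> ball 0 R \<subseteq> patch s R" using Ysub g(3) by auto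
    then have 3: "sqsum (Y \<inter> ball 0 R) (coef f) \<le> sqsum (patch s R) (coef f)"
      by (intro sqsum_mono finite_patch)
    have "Y - ball 0 R \<subseteq> model {s0 - 1..s1 + l + 1}"
    proof
      fix y assume "y \<in> Y - ball 0 R"
      then have "y \<in> model ((+) (snd \<gamma>) ` I)" using Ysub model_shift[OF g(1), of y I] by auto
      moreover have "(+) (snd \<gamma>) ` I \<subseteq> {s0 - 1..s1 + l + 1}"
        using I_subset g(2) s by force
      ultimately show "y \<in> model {s0 - 1..s1 + l + 1}" using model_mono by blast
    qed
    then have "sqsum (Y - ball 0 R) (coef f) \<le> \<epsilon> / 2" using finY by (intro R(2)) auto
    with 1 2 3 show "A * (nrm f)\<^sup>2 \<le> sqsum (patch s R) (coef f) + \<epsilon>" by linarith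
  qed
qed

text \<open>The contraction factor of one step of the frame algorithm. Half of the frame bound is given up
because a step uses a finite patch only.\<close>

definition rate :: real where "rate = sqrt (1 - A / (2 * b))"

lemma b_pos: "0 < b" using A_pos Ab by simp

lemma rate_bounds: "0 \<le> rate" "rate < 1"
  using A_pos Ab b_pos by (auto simp: rate_def field_simps)

text \<open>With \<open>q\<close> the sum of the squared coefficients over the patch, the Bessel bound yields that the squared
norm of the remainder is at most \<open>\<parallel>f\<parallel>\<^sup>2 - q / b\<close>.\<close>

lemma frame_step:
  assumes f: "cont f" and q: "A / 2 * (nrm f)\<^sup>2 \<le> sqsum (patch s R) (coef f)"
  shows "nrm (\<lambda>t. f t - trig_poly (patch s R) (\<lambda>l. coef f l / b) t) \<le> rate * nrm f"
    and "sqrt (sqsum (patch s R) (\<lambda>l. coef f l / b)) \<le> nrm f / sqrt b"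
proof -
  let ?Y = "patch s R"
  define q where "q = sqsum ?Y (coef f)"
  have scale: "trig_poly ?Y (\<lambda>l. coef f l / b) = (\<lambda>t. (1 / b) * trig_poly ?Y (coef f) t)"
    by (simp add: trig_poly_def sum_distrib_left fun_eq_iff)
  have "ip f (trig_poly ?Y (coef f)) = (\<Sum>l\<in>?Y. cnj (coef f l) * coef f l)"
    using finite_patch f by (simp add: ip_trig_poly_right)
  also have "\<dots> = complex_of_real q"
    unfolding q_def sqsum_def of_real_sum by (rule sum.cong) (simp_all add: complex_norm_square mult.commute del: of_real_power)
  finally have ipq: "ip f (trig_poly ?Y (coef f)) = complex_of_real q" .
  have syn: "(nrm (trig_poly ?Y (coef f)))\<^sup>2 \<le> b * q"
    unfolding q_def by (rule Bessel_synthesis[OF Bessel_patch finite_patch subset_refl])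
  have "(nrm (\<lambda>t. f t - trig_poly ?Y (\<lambda>l. coef f l / b) t))\<^sup>2
      = (nrm f)\<^sup>2 - 2 * Re (ip f (\<lambda>t. complex_of_real (1 / b) * trig_poly ?Y (coef f) t)) + (nrm (\<lambda>t. complex_of_real (1 / b) * trig_poly ?Y (coef f) t))\<^sup>2"
  proof -
    have "cont (\<lambda>t. complex_of_real (1 / b) * trig_poly ?Y (coef f) t)" by (intro continuous_intros)
    from nrm_sq_diff[OF f this] show ?thesis by (simp only: scale of_real_divide of_real_1)
  qed
  also have "\<dots> = (nrm f)\<^sup>2 - 2 * (q / b) + (nrm (trig_poly ?Y (coef f)))\<^sup>2 / b\<^sup>2"
    using b_pos unfolding nrm_scale ip_scale_right ipq by (simp add: power_divide norm_divide)
  also have "(nrm (trig_poly ?Y (coef f)))\<^sup>2 / b\<^sup>2 \<le> b * q / b\<^sup>2"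
    by (rule divide_right_mono[OF syn]) simp
  also have "b * q / b\<^sup>2 = q / b" using b_pos by (simp add: power2_eq_square)
  finally have "(nrm (\<lambda>t. f t - trig_poly ?Y (\<lambda>l. coef f l / b) t))\<^sup>2 \<le> (nrm f)\<^sup>2 - q / b" by simp
  also have "\<dots> \<le> (nrm f)\<^sup>2 - (A / 2 * (nrm f)\<^sup>2) / b"
    using q b_pos unfolding q_def by (intro diff_left_mono divide_right_mono) auto
  also have "\<dots> = (rate * nrm f)\<^sup>2"
    using A_pos Ab b_pos by (simp add: rate_def power_mult_distrib field_simps)
  finally show "nrm (\<lambda>t. f t - trig_poly ?Y (\<lambda>l. coef f l / b) t) \<le> rate * nrm f"
    by (rule power2_le_imp_le) (simp add: rate_bounds nrm_nonneg)
  have "sqsum ?Y (\<lambda>l. coef f l / b) = q / b\<^sup>2"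
    using sqsum_scale[of ?Y "complex_of_real (1 / b)" "coef f"] b_pos by (simp add: q_def norm_divide power_divide)
  also have "\<dots> \<le> (b * (nrm f)\<^sup>2) / b\<^sup>2"
    unfolding q_def by (rule divide_right_mono[OF BesselD[OF Bessel_patch finite_patch subset_refl f]]) simp
  also have "\<dots> = (nrm f / sqrt b)\<^sup>2" using b_pos by (simp add: power_divide power2_eq_square)
  finally show "sqrt (sqsum ?Y (\<lambda>l. coef f l / b)) \<le> nrm f / sqrt b"
    using b_pos by (intro real_le_lsqrt) (auto simp: nrm_nonneg)
qed

text \<open>Iterating the step needs a radius that serves all remainders at once. The remainder after the first
step depends on the window position only through the patch that was used. As all these patches are
subsets of one finite set, finitely many remainders occur, and the induction
hypothesis applies to each of them.\<close>

lemma approx_steps: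
  assumes f: "cont f"
  shows "\<exists>R>0. \<forall>s. s0 \<le> s \<longrightarrow> s \<le> s1 \<longrightarrow>
    (\<exists>c. nrm (\<lambda>t. f t - trig_poly (patch s R) c t) \<le> rate ^ n * nrm f \<and>
         sqrt (sqsum (patch s R) c) \<le> (\<Sum>k<n. rate ^ k) * (nrm f / sqrt b))"
  using f
proof (induction n arbitrary: f)
  case 0
  show ?case
    by (intro exI[of _ 1] conjI allI impI exI[of _ "\<lambda>_. 0"]) (simp_all add: trig_poly_def sqsum_def)
next
  case (Suc n)
  note f = Suc.prems
  obtain R1 where R1: "0 < R1" "\<And>s. s0 \<le> s \<Longrightarrow> s \<le> s1 \<Longrightarrow> A / 2 * (nrm f)\<^sup>2 \<le> sqsum (patch s R1) (coef f)"
  proof (cases "nrm f = 0")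
    case True
    then show ?thesis using that[of 1] sqsum_nonneg by simp
  next
    case False
    then have p: "0 < A / 2 * (nrm f)\<^sup>2" using A_pos by simp
    obtain R where R: "0 < R" "\<And>s. s0 \<le> s \<Longrightarrow> s \<le> s1 \<Longrightarrow> A * (nrm f)\<^sup>2 \<le> sqsum (patch s R) (coef f) + A / 2 * (nrm f)\<^sup>2"
      by (rule lower_uniform[OF f p, of s0 s1]) (rule that)
    show ?thesis
    proof (rule that[OF R(1)])
      fix s assume "s0 \<le> s" "s \<le> s1"
      from R(2)[OF this] show "A / 2 * (nrm f)\<^sup>2 \<le> sqsum (patch s R) (coef f)" by simp
    qed
  qed
  define rest where "rest Y = (\<lambda>t. f t - trig_poly Y (\<lambda>l. coef f l / b) t)" for Y
  have crest: "cont (rest Y)" for Y unfolding rest_def by (intro continuous_intros f)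
  \<comment> \<open>the first step depends on \<open>s\<close> through finitely many possible patches only\<close>
  define \<P> where "\<P> = Pow (model {s0..s1 + l} \<inter> ball 0 R1)"
  have fin: "finite \<P>" unfolding \<P>_def by (intro finite_Pow_iff[THEN iffD2] finite_model) auto
  define good where "good Y R \<longleftrightarrow> 0 < R \<and> (\<forall>s. s0 \<le> s \<longrightarrow> s \<le> s1 \<longrightarrow>
    (\<exists>c. nrm (\<lambda>t. rest Y t - trig_poly (patch s R) c t) \<le> rate ^ n * nrm (rest Y) \<and>
         sqrt (sqsum (patch s R) c) \<le> (\<Sum>k<n. rate ^ k) * (nrm (rest Y) / sqrt b)))" for Y R
  have "\<exists>R. good Y R" for Y
    unfolding good_def by (rule Suc.IH[OF crest])
  then obtain r where r: "\<And>Y. good Y (r Y)" by metis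
  define R where "R = Max (insert R1 (r ` \<P>))"
  have R: "R1 \<le> R" "\<And>Y. Y \<in> \<P> \<Longrightarrow> r Y \<le> R" using fin by (auto simp: R_def)
  show ?case
  proof (intro exI[of _ R] conjI allI impI)
    show "0 < R" using R R1 by simp
    fix s assume s: "s0 \<le> s" "s \<le> s1"
    define Y where "Y = patch s R1"
    have "model {s..<s + l} \<subseteq> model {s0..s1 + l}" by (rule model_mono) (use s in auto)
    then have YP: "Y \<in> \<P>" by (auto simp: Y_def \<P>_def)
    obtain c where c: "nrm (\<lambda>t. rest Y t - trig_poly (patch s (r Y)) c t) \<le> rate ^ n * nrm (rest Y)"
      "sqrt (sqsum (patch s (r Y)) c) \<le> (\<Sum>k<n. rate ^ k) * (nrm (rest Y) / sqrt b)"
      using r[of Y] s unfolding good_def by blast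
    define Z where "Z = patch s (r Y)"
    let ?P = "patch s R"
    define u where "u = (\<lambda>l. if l \<in> Y then coef f l / b else 0)"
    define v where "v = (\<lambda>l. if l \<in> Z then c l else 0)"
    have sub: "Y \<subseteq> ?P" "Z \<subseteq> ?P" using R(1) R(2)[OF YP] by (auto simp: Y_def Z_def)
    have tpu: "trig_poly ?P u = trig_poly Y (\<lambda>l. coef f l / b)" "trig_poly ?P v = trig_poly Z c"
      unfolding u_def v_def using sub by (simp_all only: trig_poly_restrict finite_patch)
    have squ: "sqsum ?P u = sqsum Y (\<lambda>l. coef f l / b)" "sqsum ?P v = sqsum Z c"
      unfolding u_def v_def using sub by (simp_all only: sqsum_restrict finite_patch)
    have step: "nrm (rest Y) \<le> rate * nrm f" "sqrt (sqsum Y (\<lambda>l. coef f l / b)) \<le> nrm f / sqrt b"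
      unfolding rest_def Y_def by (rule frame_step[OF f R1(2)[OF s]])+
    have tpuv: "trig_poly ?P (\<lambda>l. u l + v l) t = trig_poly ?P u t + trig_poly ?P v t" for t
      by (simp add: trig_poly_def sum.distrib distrib_right)
    show "\<exists>c. nrm (\<lambda>t. f t - trig_poly ?P c t) \<le> rate ^ Suc n * nrm f \<and>
         sqrt (sqsum ?P c) \<le> (\<Sum>k<Suc n. rate ^ k) * (nrm f / sqrt b)"
    proof (intro exI[of _ "\<lambda>l. u l + v l"] conjI)
      have "(\<lambda>t. f t - trig_poly ?P (\<lambda>l. u l + v l) t) = (\<lambda>t. rest Y t - trig_poly Z c t)"
        by (simp add: tpuv tpu rest_def diff_diff_eq)
      then have "nrm (\<lambda>t. f t - trig_poly ?P (\<lambda>l. u l + v l) t) \<le> rate ^ n * nrm (rest Y)"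
        using c(1) by (simp add: Z_def)
      also have "\<dots> \<le> rate ^ n * (rate * nrm f)"
        using step rate_bounds by (intro mult_left_mono) auto
      finally show "nrm (\<lambda>t. f t - trig_poly ?P (\<lambda>l. u l + v l) t) \<le> rate ^ Suc n * nrm f"
        by (simp add: mult_ac)
      have "sqrt (sqsum ?P (\<lambda>l. u l + v l)) \<le> sqrt (sqsum ?P u) + sqrt (sqsum ?P v)"
        by (rule sqsum_triangle)
      also have "\<dots> \<le> nrm f / sqrt b + (\<Sum>k<n. rate ^ k) * (nrm (rest Y) / sqrt b)"
        unfolding squ using step c(2) by (intro add_mono) (auto simp: Z_def)
      also have "\<dots> \<le> nrm f / sqrt b + (\<Sum>k<n. rate ^ k) * (rate * nrm f / sqrt b)"
        using step rate_bounds b_pos by (intro add_left_mono mult_left_mono divide_right_mono sum_nonneg) auto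
      also have "\<dots> = (\<Sum>k<Suc n. rate ^ k) * (nrm f / sqrt b)"
        unfolding sum.lessThan_Suc_shift by (simp add: sum_distrib_left sum_distrib_right distrib_left distrib_right add_divide_distrib sum_divide_distrib mult_ac)
      finally show "sqrt (sqsum ?P (\<lambda>l. u l + v l)) \<le> (\<Sum>k<Suc n. rate ^ k) * (nrm f / sqrt b)" .
    qed
  qed
qed

text \<open>The geometric series of the coefficient norms in the frame algorithm.\<close>

definition C :: real where "C = 1 / ((1 - rate) * sqrt b)"

lemma C_pos: "0 < C" using rate_bounds b_pos by (simp add: C_def)

lemma uniform_approx:
  assumes f: "cont f" and \<epsilon>: "0 < \<epsilon>"
  obtains R where "0 < R" "\<And>s. s0 \<le> s \<Longrightarrow> s \<le> s1 \<Longrightarrow>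
    \<exists>c. nrm (\<lambda>t. f t - trig_poly (patch s R) c t) \<le> \<epsilon> \<and> sqrt (sqsum (patch s R) c) \<le> C * nrm f"
proof -
  have "(\<lambda>n. rate ^ n * nrm f) \<longlonglongrightarrow> 0 * nrm f"
    using rate_bounds by (intro tendsto_mult LIMSEQ_realpow_zero tendsto_const) 
  then have "eventually (\<lambda>n. rate ^ n * nrm f < \<epsilon>) sequentially"
    using \<epsilon> by (intro order_tendstoD(2)) auto
  then obtain n where n: "rate ^ n * nrm f < \<epsilon>" by (auto simp: eventually_sequentially)
  have "(\<Sum>k<n. rate ^ k) = (1 - rate ^ n) / (1 - rate)"
    using rate_bounds by (simp add: sum_gp_strict)
  also have "\<dots> \<le> 1 / (1 - rate)" using rate_bounds by (intro divide_right_mono) auto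
  finally have "(\<Sum>k<n. rate ^ k) * (nrm f / sqrt b) \<le> 1 / (1 - rate) * (nrm f / sqrt b)"
    using b_pos by (intro mult_right_mono) (auto simp: nrm_nonneg)
  then have g: "(\<Sum>k<n. rate ^ k) * (nrm f / sqrt b) \<le> C * nrm f" by (simp add: C_def)
  obtain R where R: "0 < R" "\<And>s. s0 \<le> s \<Longrightarrow> s \<le> s1 \<Longrightarrow>
    (\<exists>c. nrm (\<lambda>t. f t - trig_poly (patch s R) c t) \<le> rate ^ n * nrm f \<and>
         sqrt (sqsum (patch s R) c) \<le> (\<Sum>k<n. rate ^ k) * (nrm f / sqrt b))"
    using approx_steps[OF f, of s0 s1 n] by blast
  show ?thesis
  proof (rule that[OF R(1)])
    fix s assume "s0 \<le> s" "s \<le> s1"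
    from R(2)[OF this] n g
    show "\<exists>c. nrm (\<lambda>t. f t - trig_poly (patch s R) c t) \<le> \<epsilon> \<and> sqrt (sqsum (patch s R) c) \<le> C * nrm f"
      by (meson less_imp_le order_trans)
  qed
qed

lemma patch_extend:
  assumes "R1 \<le> R2"
  obtains c' where "trig_poly (patch s R2) c' = trig_poly (patch s R1) c" "sqsum (patch s R2) c' = sqsum (patch s R1) c"
proof -
  have "patch s R1 \<subseteq> patch s R2" using assms by auto
  then show ?thesis
    by (intro that[of "\<lambda>l. if l \<in> patch s R1 then c l else 0"] trig_poly_restrict sqsum_restrict finite_patch)
qed

text \<open>A radius that works for all frequencies in a ball at once, by compactness.\<close>

lemma uniform_approx_expo:
  assumes \<epsilon>: "0 < \<epsilon>"
  obtains R where "0 < R" "\<And>x s. norm x \<le> \<rho> \<Longrightarrow> \<bar>s\<bar> \<le> \<rho> \<Longrightarrow>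
    \<exists>c. nrm (\<lambda>t. expo x t - trig_poly (patch s R) c t) \<le> \<epsilon> \<and> sqrt (sqsum (patch s R) c) \<le> C * sqrt (measure lebesgue S)"
proof -
  obtain K where K: "0 < K" "\<And>x y. nrm (\<lambda>t. expo x t - expo y t) \<le> K * norm (x - y)"
    using nrm_expo_diff by blast
  define d where "d = \<epsilon> / (2 * K)"
  have d: "0 < d" using K \<epsilon> by (simp add: d_def)
  have cover: "cball (0::'a) \<rho> \<subseteq> (\<Union>x\<in>cball 0 \<rho>. ball x d)" using d by force
  obtain F where "F \<subseteq> cball (0::'a) \<rho>" and F: "finite F" "cball (0::'a) \<rho> \<subseteq> (\<Union>x\<in>F. ball x d)"
    by (rule compactE_image[OF compact_cball _ cover]) (simp, rule that)
  define good where "good x R \<longleftrightarrow> 0 < R \<and> (\<forall>s. - \<rho> \<le> s \<longrightarrow> s \<le> \<rho> \<longrightarrow>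
    (\<exists>c. nrm (\<lambda>t. expo x t - trig_poly (patch s R) c t) \<le> \<epsilon> / 2 \<and> sqrt (sqsum (patch s R) c) \<le> C * nrm (expo x)))" for x R
  have "\<exists>R. good x R" for x
  proof -
    obtain R where "0 < R" "\<And>s. - \<rho> \<le> s \<Longrightarrow> s \<le> \<rho> \<Longrightarrow>
      \<exists>c. nrm (\<lambda>t. expo x t - trig_poly (patch s R) c t) \<le> \<epsilon> / 2 \<and> sqrt (sqsum (patch s R) c) \<le> C * nrm (expo x)"
      by (rule uniform_approx[of "expo x" "\<epsilon> / 2" "- \<rho>" \<rho>]) (use \<epsilon> that in auto)
    then show ?thesis unfolding good_def by blast
  qed
  then obtain r where r: "\<And>x. good x (r x)" by metis
  define R where "R = Max (insert 1 (r ` F))"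
  have R: "1 \<le> R" "\<And>x. x \<in> F \<Longrightarrow> r x \<le> R" using F(1) by (auto simp: R_def)
  show ?thesis
  proof (rule that[of R])
    show "0 < R" using R by simp
    fix x :: 'a and s assume x: "norm x \<le> \<rho>" and s: "\<bar>s\<bar> \<le> \<rho>"
    then obtain y where y: "y \<in> F" "dist y x < d" using F(2) by force
    obtain c where c: "nrm (\<lambda>t. expo y t - trig_poly (patch s (r y)) c t) \<le> \<epsilon> / 2" "sqrt (sqsum (patch s (r y)) c) \<le> C * nrm (expo y)"
    proof -
      have "- \<rho> \<le> s" "s \<le> \<rho>" using s by auto
      with r[of y] show ?thesis unfolding good_def using that by blast
    qed
    obtain c' where c': "trig_poly (patch s R) c' = trig_poly (patch s (r y)) c" "sqsum (patch s R) c' = sqsum (patch s (r y)) c"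
      by (rule patch_extend[OF R(2)[OF y(1)]])
    show "\<exists>c. nrm (\<lambda>t. expo x t - trig_poly (patch s R) c t) \<le> \<epsilon> \<and> sqrt (sqsum (patch s R) c) \<le> C * sqrt (measure lebesgue S)"
    proof (intro exI[of _ c'] conjI)
      have "nrm (\<lambda>t. (expo x t - expo y t) + (expo y t - trig_poly (patch s (r y)) c t))
          \<le> nrm (\<lambda>t. expo x t - expo y t) + nrm (\<lambda>t. expo y t - trig_poly (patch s (r y)) c t)"
        by (intro nrm_triangle continuous_intros)
      also have "\<dots> \<le> K * norm (x - y) + \<epsilon> / 2" using K(2) c(1) by (intro add_mono)
      also have "\<dots> \<le> K * d + \<epsilon> / 2"
        using y K by (intro add_right_mono mult_left_mono) (auto simp: dist_norm norm_minus_commute)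
      also have "\<dots> = \<epsilon>" using K by (simp add: d_def)
      finally show "nrm (\<lambda>t. expo x t - trig_poly (patch s R) c' t) \<le> \<epsilon>" by (simp add: c')
      show "sqrt (sqsum (patch s R) c') \<le> C * sqrt (measure lebesgue S)" using c c' by (simp add: nrm_expo_eq)
    qed
  qed
qed

text \<open>Approximate \<open>expo 0\<close> by a combination \<open>c0\<close> from a window that just misses \<open>0\<close>. Its frequencies also belong
to all windows \<open>{-t..<-t + l}\<close> with small \<open>t \<ge> 0\<close>, which contain \<open>0\<close>. The small error is then removed,
to any precision, within these windows by \<open>c1\<close>, whose norm is at most \<open>1 / 2\<close>. The trivial
representation, with coefficient \<open>1\<close> at \<open>0\<close>, has norm \<open>1\<close>. Mixing in \<open>\<theta>\<close> times
the new one lowers the squared norm to first order in \<open>\<theta>\<close> and costs only the order \<open>\<theta>\<^sup>2\<close>. It is essential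
that \<open>\<delta>\<close> and \<open>\<kappa>\<close> do not depend on \<open>\<epsilon>\<close>.\<close>

lemma redundancy:
  obtains \<delta> \<kappa> where "0 < \<delta>" "\<delta> \<le> l" "0 < \<kappa>"
    "\<And>\<epsilon>. 0 < \<epsilon> \<Longrightarrow> \<exists>R>0. \<forall>t. 0 \<le> t \<longrightarrow> t \<le> \<delta> \<longrightarrow>
       (\<exists>c. nrm (\<lambda>u. expo 0 u - trig_poly (patch (- t) R) c u) \<le> \<epsilon> \<and> sqsum (patch (- t) R) c \<le> 1 - \<kappa>)"
proof -
  define e0 where "e0 = expo (0::'a)"
  have ce0: "cont e0" by (simp add: e0_def)
  define s0 where "s0 = sqrt (measure lebesgue S)"
  have ne: "nrm e0 = s0" by (simp add: e0_def s0_def nrm_expo_eq)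
  have s0: "0 \<le> s0" by (simp add: s0_def)
  \<comment> \<open>this precision makes the norm of the correction \<open>c1\<close> at most \<open>C * \<epsilon>0 = 1 / 2\<close>\<close>
  define \<epsilon>0 where "\<epsilon>0 = 1 / (2 * C)"
  have \<epsilon>0: "0 < \<epsilon>0" using C_pos by (simp add: \<epsilon>0_def)
  obtain R0 where R0: "0 < R0" "\<And>s. 0 \<le> s \<Longrightarrow> s \<le> 1 \<Longrightarrow>
    \<exists>c. nrm (\<lambda>t. e0 t - trig_poly (patch s R0) c t) \<le> \<epsilon>0 \<and> sqrt (sqsum (patch s R0) c) \<le> C * nrm e0"
    by (rule uniform_approx[OF ce0 \<epsilon>0, of 0 1]) (rule that)
  obtain t0 where t0: "0 < t0" "t0 \<le> 1"
    and t0_win: "\<And>t. 0 < t \<Longrightarrow> t \<le> t0 \<Longrightarrow> patch t R0 \<subseteq> model {0<..<l}"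
    by (rule window_leaves_zero[of R0]) (rule that)
  define X0 where "X0 = patch t0 R0"
  obtain c0 where c0: "nrm (\<lambda>t. e0 t - trig_poly X0 c0 t) \<le> \<epsilon>0" "sqrt (sqsum X0 c0) \<le> C * s0"
    using R0(2)[of t0] t0 ne by (auto simp: X0_def)
  have finX0: "finite X0" unfolding X0_def by (rule finite_patch)
  define H where "H = {\<gamma> \<in> \<Gamma>. fst \<gamma> \<in> ball 0 R0 \<and> snd \<gamma> \<in> {t0..<t0 + l}}"
  have finH: "finite H" unfolding H_def by (rule finite_lattice_strip) auto
  have X0H: "X0 = fst ` H" by (force simp: X0_def H_def cut_project_set_def)
  have Hwin: "0 < snd \<gamma> \<and> snd \<gamma> < l" if g: "\<gamma> \<in> H" for \<gamma>
  proof
    show "0 < snd \<gamma>" using g t0 by (auto simp: H_def)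
    have "fst \<gamma> \<in> model {0<..<l}" using t0_win[of t0] t0 X0H g by (auto simp: X0_def)
    then show "snd \<gamma> < l" using model_fst[of \<gamma>] g by (auto simp: H_def)
  qed
  define m where "m = Min (insert l ((\<lambda>\<gamma>. l - snd \<gamma>) ` H))"
  have m: "0 < m" "m \<le> l" "\<And>\<gamma>. \<gamma> \<in> H \<Longrightarrow> m \<le> l - snd \<gamma>"
    unfolding m_def using finH Hwin l_pos by auto
  define \<delta> where "\<delta> = m / 2"
  have \<delta>: "0 < \<delta>" "\<delta> \<le> l" using m by (auto simp: \<delta>_def)
  have X0win: "X0 \<subseteq> model {- t..<- t + l}" if t: "0 \<le> t" "t \<le> \<delta>" for t
  proof
    fix x assume "x \<in> X0"
    then obtain \<gamma> where g: "\<gamma> \<in> H" "x = fst \<gamma>" by (auto simp: X0H)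
    have "snd \<gamma> < l - t" using m(3)[OF g(1)] t m(1) by (simp add: \<delta>_def)
    then have "snd \<gamma> \<in> {- t..<- t + l}" using Hwin[OF g(1)] t by auto
    then show "x \<in> model {- t..<- t + l}" using g by (auto simp: model_iff H_def)
  qed
  have zero_notin: "0 \<notin> X0"
  proof
    assume "0 \<in> X0"
    then obtain \<gamma> where g: "\<gamma> \<in> H" "fst \<gamma> = 0" by (auto simp: X0H)
    then have "\<gamma> = 0" using inj_fst zero_in by (auto simp: inj_on_def H_def)
    then show False using Hwin[OF g(1)] by simp
  qed
  define E where "E = (\<lambda>t. e0 t - trig_poly X0 c0 t)"
  have cE: "cont E" unfolding E_def by (intro continuous_intros ce0)
  define G where "G = (C * s0 + 1 / 2)\<^sup>2"
  have G: "1 / 4 \<le> G"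
  proof -
    have "(1 / 2)\<^sup>2 \<le> G" unfolding G_def using C_pos s0 by (intro power_mono) auto
    then show ?thesis by (simp add: power2_eq_square)
  qed
  \<comment> \<open>this makes \<open>(1 - \<theta> / 2)\<^sup>2 + \<theta>\<^sup>2 * G\<close> equal to \<open>1 - \<theta> / 2\<close>\<close>
  define \<theta> where "\<theta> = 1 / (2 * (1 / 4 + G))"
  have \<theta>: "0 < \<theta>" "\<theta> \<le> 1" using G by (auto simp: \<theta>_def)
  show ?thesis
  proof (rule that[OF \<delta>, of "\<theta> / 2"])
    show "0 < \<theta> / 2" using \<theta> by simp
    fix \<epsilon> :: real assume \<epsilon>: "0 < \<epsilon>"
    obtain R1 where R1: "0 < R1" "\<And>s. - \<delta> \<le> s \<Longrightarrow> s \<le> 0 \<Longrightarrow>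
      \<exists>c. nrm (\<lambda>t. E t - trig_poly (patch s R1) c t) \<le> \<epsilon> \<and> sqrt (sqsum (patch s R1) c) \<le> C * nrm E"
      by (rule uniform_approx[OF cE \<epsilon>, of "- \<delta>" 0]) (rule that)
    define R where "R = max R0 R1"
    show "\<exists>R>0. \<forall>t. 0 \<le> t \<longrightarrow> t \<le> \<delta> \<longrightarrow>
       (\<exists>c. nrm (\<lambda>u. expo 0 u - trig_poly (patch (- t) R) c u) \<le> \<epsilon> \<and> sqsum (patch (- t) R) c \<le> 1 - \<theta> / 2)"
    proof (intro exI[of _ R] conjI allI impI)
      show "0 < R" using R0 by (simp add: R_def)
      fix t assume t: "0 \<le> t" "t \<le> \<delta>"
      define Z where "Z = patch (- t) R1"
      obtain c1 where c1: "nrm (\<lambda>u. E u - trig_poly Z c1 u) \<le> \<epsilon>" "sqrt (sqsum Z c1) \<le> C * nrm E"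
        using R1(2)[of "- t"] t by (auto simp: Z_def)
      have c1': "sqrt (sqsum Z c1) \<le> 1 / 2"
      proof -
        have "C * nrm E \<le> C * \<epsilon>0" using c0 C_pos by (intro mult_left_mono) (auto simp: E_def)
        then show ?thesis using c1(2) C_pos by (simp add: \<epsilon>0_def)
      qed
      define P where "P = patch (- t) R"
      have finP: "finite P" unfolding P_def by (rule finite_patch)
      have sub: "X0 \<subseteq> P" "Z \<subseteq> P"
        using X0win[OF t] by (auto simp: P_def Z_def R_def X0_def)
      have "0 \<in> model {- t..<- t + l}"
        using model_fst[OF zero_in, of "{- t..<- t + l}"] t \<delta>(1) m by (auto simp: \<delta>_def)
      then have zP: "0 \<in> P" using R0 by (auto simp: P_def R_def)
      define d0 where "d0 = (\<lambda>x. if x \<in> X0 then c0 x else 0)"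
      define d1 where "d1 = (\<lambda>x. if x \<in> Z then c1 x else 0)"
      define c where "c = (\<lambda>x. (if x = 0 then complex_of_real (1 - \<theta>) else 0) + complex_of_real \<theta> * (d0 x + d1 x))"
      have td: "trig_poly P d0 = trig_poly X0 c0" "trig_poly P d1 = trig_poly Z c1"
        unfolding d0_def d1_def by (intro trig_poly_restrict finP sub)+
      have sd: "sqsum P d0 = sqsum X0 c0" "sqsum P d1 = sqsum Z c1"
        unfolding d0_def d1_def by (intro sqsum_restrict finP sub)+
      have tpc: "trig_poly P c u = complex_of_real (1 - \<theta>) * e0 u + complex_of_real \<theta> * (trig_poly X0 c0 u + trig_poly Z c1 u)" for u
      proof -
        have "trig_poly P c u = (\<Sum>x\<in>P. (if x = 0 then complex_of_real (1 - \<theta>) * expo x u else 0)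
            + complex_of_real \<theta> * (d0 x * expo x u + d1 x * expo x u))"
          unfolding trig_poly_def by (rule sum.cong) (auto simp: c_def distrib_right distrib_left mult.assoc)
        also have "\<dots> = complex_of_real (1 - \<theta>) * e0 u + complex_of_real \<theta> * (trig_poly P d0 u + trig_poly P d1 u)"
          using finP zP by (simp add: sum.distrib sum_distrib_left[symmetric] trig_poly_def e0_def)
        finally show ?thesis by (simp add: td)
      qed
      show "\<exists>c. nrm (\<lambda>u. expo 0 u - trig_poly P c u) \<le> \<epsilon> \<and> sqsum P c \<le> 1 - \<theta> / 2"
      proof (intro exI[of _ c] conjI)
        have "(\<lambda>u. expo 0 u - trig_poly P c u) = (\<lambda>u. complex_of_real \<theta> * (E u - trig_poly Z c1 u))"
          unfolding tpc E_def e0_def[symmetric] by (simp add: fun_eq_iff algebra_simps)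
        then have "nrm (\<lambda>u. expo 0 u - trig_poly P c u) = \<theta> * nrm (\<lambda>u. E u - trig_poly Z c1 u)"
          using \<theta> by (simp only: nrm_scale norm_of_real)
        also have "\<dots> \<le> 1 * nrm (\<lambda>u. E u - trig_poly Z c1 u)" using \<theta> by (intro mult_right_mono nrm_nonneg)
        finally show "nrm (\<lambda>u. expo 0 u - trig_poly P c u) \<le> \<epsilon>" using c1(1) by simp
        have at0: "cmod (c 0) \<le> 1 - \<theta> / 2"
        proof -
          have "(cmod (d1 0))\<^sup>2 \<le> sqsum P d1"
            unfolding sqsum_def by (rule member_le_sum[OF zP]) (use finP in auto)
          then have "cmod (d1 0) \<le> sqrt (sqsum P d1)" by (rule real_le_rsqrt)
          then have "cmod (d1 0) \<le> 1 / 2" using c1' sd by simp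
          moreover have "c 0 = complex_of_real (1 - \<theta>) + complex_of_real \<theta> * d1 0"
            using zero_notin by (simp add: c_def d0_def)
          then have "cmod (c 0) \<le> cmod (complex_of_real (1 - \<theta>)) + cmod (complex_of_real \<theta> * d1 0)"
            by (simp only: norm_triangle_ineq)
          moreover have "cmod (complex_of_real (1 - \<theta>)) = 1 - \<theta>" using \<theta> by (simp only: norm_of_real)
          moreover have "cmod (complex_of_real \<theta> * d1 0) = \<theta> * cmod (d1 0)" using \<theta> by (simp add: norm_mult)
          moreover have "\<theta> * cmod (d1 0) \<le> \<theta> * (1 / 2)" using \<theta> calculation(1) by (intro mult_left_mono) auto
          ultimately show ?thesis by linarith
        qed
        have rest: "sqsum (P - {0}) c \<le> \<theta>\<^sup>2 * G"
        proof -
          have "sqsum (P - {0}) c = sqsum (P - {0}) (\<lambda>x. complex_of_real \<theta> * (d0 x + d1 x))"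
            unfolding sqsum_def by (rule sum.cong) (auto simp: c_def)
          also have "\<dots> \<le> sqsum P (\<lambda>x. complex_of_real \<theta> * (d0 x + d1 x))" using finP by (intro sqsum_mono) auto
          also have "\<dots> = \<theta>\<^sup>2 * sqsum P (\<lambda>x. d0 x + d1 x)" by (simp add: sqsum_scale)
          also have "\<dots> \<le> \<theta>\<^sup>2 * G"
          proof (rule mult_left_mono)
            have "sqrt (sqsum P (\<lambda>x. d0 x + d1 x)) \<le> C * s0 + 1 / 2"
              using sqsum_triangle[of P d0 d1] c0(2) c1' unfolding sd by linarith
            then have "(sqrt (sqsum P (\<lambda>x. d0 x + d1 x)))\<^sup>2 \<le> (C * s0 + 1 / 2)\<^sup>2"
              by (intro power_mono) (auto simp: sqsum_nonneg)
            then show "sqsum P (\<lambda>x. d0 x + d1 x) \<le> G" by (simp add: G_def sqsum_nonneg)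
          qed simp
          finally show ?thesis .
        qed
        have "sqsum P c = (cmod (c 0))\<^sup>2 + sqsum (P - {0}) c"
          unfolding sqsum_def using finP zP by (rule sum.remove)
        also have "\<dots> \<le> (1 - \<theta> / 2)\<^sup>2 + \<theta>\<^sup>2 * G"
          using at0 rest by (intro add_mono power_mono) auto
        also have "\<dots> = 1 - \<theta> + \<theta> * (\<theta> * (1 / 4 + G))"
          by (simp add: power2_eq_square algebra_simps)
        also have "\<theta> * (1 / 4 + G) = 1 / 2" using G by (simp add: \<theta>_def)
        finally show "sqsum P c \<le> 1 - \<theta> / 2" by simp
      qed
    qed
  qed
qed

text \<open>The trace identity for the points of the translated model set in a ball of radius \<open>R + r\<close>. The
integrand is nonnegative, and in the ball of radius \<open>R\<close> it is almost \<open>|S|\<close>, as a patch of radius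
\<open>r\<close> suffices to approximate. Each term of the sum is at most \<open>\<tau>\<close>, and points with window
coordinate in \<open>{0..<\<delta>}\<close> are redundant.\<close>

lemma frame_local_inequality:
  assumes approx: "\<And>x s. norm x \<le> \<rho> \<Longrightarrow> \<bar>s\<bar> \<le> \<rho> \<Longrightarrow>
      \<exists>c. nrm (\<lambda>t. expo x t - trig_poly (patch s R1) c t) \<le> \<epsilon> \<and> sqrt (sqsum (patch s R1) c) \<le> C * sqrt (measure lebesgue S)"
    and cell: "\<And>w. w \<in> cell \<Longrightarrow> norm w \<le> \<rho>"
    and red: "\<And>t. 0 \<le> t \<Longrightarrow> t \<le> \<delta> \<Longrightarrow>
      \<exists>c. nrm (\<lambda>u. expo 0 u - trig_poly (patch (- t) R2) c u) \<le> \<epsilon> \<and> sqsum (patch (- t) R2) c \<le> 1 - \<kappa>"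
    and pos: "0 \<le> \<epsilon>" "0 < \<tau>" "\<epsilon>\<^sup>2 \<le> \<tau> * \<kappa> / 2" "0 < \<delta>" "\<delta> \<le> l" "0 < R"
    and r: "R1 + \<rho> \<le> r" "R2 \<le> r" "0 \<le> r"
  shows "(measure lebesgue S - (\<epsilon>\<^sup>2 + \<tau> * (C\<^sup>2 * measure lebesgue S))) * measure lborel (ball (0::'a) R)
      + \<kappa> / 2 * card (hits (ball 0 R \<times> {0..<\<delta>}) z)
    \<le> 1 * real (card (hits (ball 0 (R + r) \<times> {0..<l}) z))"
proof -
  define E1 where "E1 = ball (0::'a) R \<times> {0..<\<delta>}"
  define E2 where "E2 = ball (0::'a) (R + r) \<times> {0..<l}"
  define X where "X = points E2 z"
  have finX: "finite X" unfolding X_def E2_def by (intro finite_points bounded_strip)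
  have XI: "fst \<gamma> + fst z \<in> X" if "\<gamma> \<in> \<Gamma>" "norm (fst \<gamma> + fst z) < R + r" "snd \<gamma> + snd z \<in> {0..<l}" for \<gamma>
    unfolding X_def points_def using that by (intro imageI) (auto simp: hits_def E2_def mem_Times_iff)
  define \<theta> where "\<theta> = \<epsilon>\<^sup>2 + \<tau> * (C\<^sup>2 * measure lebesgue S)"
  define p where "p x = measure lebesgue S - ridge \<tau> X (expo x)" for x
  have trace: "has_bochner_integral lborel p ((\<Sum>x\<in>X. ridge \<tau> X (expo x)) / \<tau>)"
    unfolding p_def using pos(2) finX Plancherel_kernel by (rule ridge_trace)
  have p_nonneg: "0 \<le> p x" for x
  proof -
    have "ridge \<tau> X (expo x) \<le> energy \<tau> X (expo x) (\<lambda>_. 0)" using pos by (intro ridge_le) simp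
    also have "\<dots> = measure lebesgue S" by (simp add: energy_def trig_poly_def sqsum_def nrm_expo)
    finally show ?thesis by (simp add: p_def)
  qed
  have p_large: "measure lebesgue S - \<theta> \<le> p x" if x: "norm x < R" for x
  proof -
    \<comment> \<open>shifting by \<open>\<gamma>\<close> brings \<open>x\<close> and the window position into the bounded range covered by \<open>approx\<close>\<close>
    obtain \<gamma> where g: "\<gamma> \<in> \<Gamma>" "(x - fst z, - snd z) - \<gamma> \<in> cell"
      using cell_fundamental unfolding fundamental_domain_def by blast
    define w where "w = (x - fst z, - snd z) - \<gamma>"
    have w: "norm w \<le> \<rho>" using cell g by (simp add: w_def)
    then have w12: "norm (fst w) \<le> \<rho>" "\<bar>snd w\<bar> \<le> \<rho>"
      using norm_fst_le[of "fst w" "snd w"] norm_snd_le[of "snd w" "fst w"] by auto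
    obtain c where c: "nrm (\<lambda>t. expo (fst w) t - trig_poly (patch (snd w) R1) c t) \<le> \<epsilon>"
      "sqrt (sqsum (patch (snd w) R1) c) \<le> C * sqrt (measure lebesgue S)"
      using approx[OF w12] by blast
    define y where "y = x - fst w"
    have y: "y = fst \<gamma> + fst z" "snd \<gamma> + snd z = - snd w" by (simp_all add: y_def w_def)
    have sub: "(+) y ` patch (snd w) R1 \<subseteq> X"
    proof
      fix v assume "v \<in> (+) y ` patch (snd w) R1"
      then obtain u where u: "v = y + u" "u \<in> model {snd w..<snd w + l}" "norm u < R1" by auto
      then obtain \<beta> where b: "\<beta> \<in> \<Gamma>" "fst \<beta> = u" "snd \<beta> \<in> {snd w..<snd w + l}"
        unfolding model_iff by blast
      have v: "v = fst (\<gamma> + \<beta>) + fst z" using u y b by simp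
      have "v = x - fst w + u" by (simp add: u y_def)
      then have "norm v \<le> norm x + norm (fst w) + norm u"
        using norm_triangle_ineq[of "x - fst w" u] norm_triangle_ineq4[of x "fst w"] by simp
      then have "norm v < R + r" using x w12 u r by linarith
      moreover have "snd (\<gamma> + \<beta>) + snd z \<in> {0..<l}" using y(2) b(3) by auto
      ultimately show "v \<in> X" unfolding v by (intro XI add_in g b)
    qed
    have "ridge \<tau> X (expo (y + fst w)) \<le> energy \<tau> (patch (snd w) R1) (expo (fst w)) c"
      using pos by (intro ridge_le_translate finX sub) simp
    also have "\<dots> \<le> \<theta>"
    proof -
      have "(nrm (\<lambda>t. expo (fst w) t - trig_poly (patch (snd w) R1) c t))\<^sup>2 \<le> \<epsilon>\<^sup>2"
        using c(1) by (intro power_mono nrm_nonneg)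
      moreover have "(sqrt (sqsum (patch (snd w) R1) c))\<^sup>2 \<le> (C * sqrt (measure lebesgue S))\<^sup>2"
        using c(2) by (intro power_mono) (auto simp: sqsum_nonneg)
      then have "sqsum (patch (snd w) R1) c \<le> C\<^sup>2 * measure lebesgue S"
        by (simp add: sqsum_nonneg power_mult_distrib)
      then have "\<tau> * sqsum (patch (snd w) R1) c \<le> \<tau> * (C\<^sup>2 * measure lebesgue S)"
        using pos by (intro mult_left_mono) auto
      ultimately show ?thesis unfolding energy_def \<theta>_def by linarith
    qed
    finally show ?thesis by (simp add: p_def y_def)
  qed
  have ridge_1: "ridge \<tau> X (expo x) \<le> \<tau>" if x: "x \<in> X" for x
  proof -
    let ?c = "\<lambda>l. if l = x then 1 else 0 :: complex"
    have "trig_poly X ?c = expo x"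
      using finX x by (simp add: trig_poly_def fun_eq_iff if_distrib[of "\<lambda>c. c * _"] cong: if_cong)
    moreover have "sqsum X ?c = 1"
      using finX x by (simp add: sqsum_def if_distrib[of cmod] if_distrib[of "\<lambda>c. c\<^sup>2"] cong: if_cong)
    ultimately have "energy \<tau> X (expo x) ?c = \<tau>" by (simp add: energy_def L2_norm_def)
    then show ?thesis using ridge_le[of \<tau> X "expo x" ?c] pos by simp
  qed
  have ridge_2: "ridge \<tau> X (expo x) \<le> \<tau> * (1 - \<kappa> / 2)" if x: "x \<in> points E1 z" for x
  proof -
    obtain \<gamma> where g: "\<gamma> \<in> \<Gamma>" "x = fst \<gamma> + fst z" "norm x < R" "0 \<le> snd \<gamma> + snd z" "snd \<gamma> + snd z < \<delta>"
      using x by (auto simp: points_def hits_def E1_def mem_Times_iff)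
    define t where "t = snd \<gamma> + snd z"
    obtain c where c: "nrm (\<lambda>u. expo 0 u - trig_poly (patch (- t) R2) c u) \<le> \<epsilon>" "sqsum (patch (- t) R2) c \<le> 1 - \<kappa>"
      using red[of t] g by (auto simp: t_def)
    have sub: "(+) x ` patch (- t) R2 \<subseteq> X"
    proof
      fix v assume "v \<in> (+) x ` patch (- t) R2"
      then obtain u where u: "v = x + u" "u \<in> model {- t..<- t + l}" "norm u < R2" by auto
      then obtain \<beta> where b: "\<beta> \<in> \<Gamma>" "fst \<beta> = u" "snd \<beta> \<in> {- t..<- t + l}"
        unfolding model_iff by blast
      have v: "v = fst (\<gamma> + \<beta>) + fst z" using u g b by simp
      have "norm v < R + r" using norm_triangle_ineq[of x u] u g r by simp
      moreover have "snd (\<gamma> + \<beta>) + snd z \<in> {0..<l}" using b(3) by (auto simp: t_def)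
      ultimately show "v \<in> X" unfolding v by (intro XI add_in g b)
    qed
    have "ridge \<tau> X (expo (x + 0)) \<le> energy \<tau> (patch (- t) R2) (expo 0) c"
      using pos by (intro ridge_le_translate finX sub) simp
    also have "\<dots> \<le> \<epsilon>\<^sup>2 + \<tau> * (1 - \<kappa>)"
      unfolding energy_def using c pos by (intro add_mono power_mono mult_left_mono nrm_nonneg) auto
    also have "\<dots> \<le> \<tau> * (1 - \<kappa> / 2)" using pos(3) by (simp add: right_diff_distrib)
    finally show ?thesis by simp
  qed
  have E1X: "points E1 z \<subseteq> X"
    unfolding X_def points_def using pos r by (intro image_mono) (auto simp: hits_def E1_def E2_def mem_Times_iff)
  have "(\<Sum>x\<in>X. ridge \<tau> X (expo x)) \<le> (\<Sum>x\<in>X. \<tau> - (if x \<in> points E1 z then \<tau> * (\<kappa> / 2) else 0))"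
  proof (rule sum_mono)
    fix x assume "x \<in> X"
    then show "ridge \<tau> X (expo x) \<le> \<tau> - (if x \<in> points E1 z then \<tau> * (\<kappa> / 2) else 0)"
      using ridge_1[of x] ridge_2[of x] by (auto simp: right_diff_distrib)
  qed
  also have "\<dots> = \<tau> * card X - \<tau> * (\<kappa> / 2) * card (points E1 z)"
    using finX E1X by (simp add: sum_subtractf sum.If_cases Int_absorb1 mult_ac)
  finally have "(\<Sum>x\<in>X. ridge \<tau> X (expo x)) / \<tau> \<le> (\<tau> * card X - \<tau> * (\<kappa> / 2) * card (points E1 z)) / \<tau>"
    using pos by (intro divide_right_mono) auto
  also have "\<dots> = card X - \<kappa> / 2 * card (points E1 z)"
    using pos by (simp add: field_simps)
  finally have up: "integral\<^sup>L lborel p \<le> card X - \<kappa> / 2 * card (points E1 z)"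
    using trace by (simp add: has_bochner_integral_iff)
  have ball: "has_bochner_integral lborel (\<lambda>x. indicator (ball (0::'a) R) x :: real) (measure lborel (ball (0::'a) R))"
    using emeasure_bounded_finite[of "ball (0::'a) R"] by (intro has_bochner_integral_real_indicator) auto
  have "(measure lebesgue S - \<theta>) * measure lborel (ball (0::'a) R) \<le> integral\<^sup>L lborel p"
  proof -
    note h = has_bochner_integral_mult_right[OF ball, of "measure lebesgue S - \<theta>"]
    have "(\<integral>x. (measure lebesgue S - \<theta>) * indicator (ball (0::'a) R) x \<partial>lborel) \<le> integral\<^sup>L lborel p"
      using h trace p_nonneg p_large
      by (intro integral_mono) (auto simp: has_bochner_integral_iff indicator_def)
    then show ?thesis using h by (simp only: has_bochner_integral_iff)
  qed
  with up show ?thesis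
    unfolding E1_def[symmetric] E2_def[symmetric] \<theta>_def[symmetric] by (simp add: X_def card_points)
qed

text \<open>Averaging over the cell and letting \<open>R\<close> tend to infinity leaves \<open>\<kappa> \<delta> / 2 \<le> \<tau> M\<close> with a
constant \<open>M\<close>; the chosen \<open>\<tau>\<close> violates this.\<close>

theorem no_critical_frame: False
proof -
  obtain \<delta> \<kappa> where red: "0 < \<delta>" "\<delta> \<le> l" "0 < \<kappa>"
    "\<And>\<epsilon>. 0 < \<epsilon> \<Longrightarrow> \<exists>R>0. \<forall>t. 0 \<le> t \<longrightarrow> t \<le> \<delta> \<longrightarrow>
       (\<exists>c. nrm (\<lambda>u. expo 0 u - trig_poly (patch (- t) R) c u) \<le> \<epsilon> \<and> sqsum (patch (- t) R) c \<le> 1 - \<kappa>)"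
    by (rule redundancy) (rule that)
  obtain \<rho> where \<rho>: "0 < \<rho>" "\<And>w. w \<in> cell \<Longrightarrow> norm w \<le> \<rho>"
    using bounded_cell by (auto simp: bounded_pos)
  define M where "M = (\<kappa> / 2 + C\<^sup>2 * measure lebesgue S) * covol \<Gamma>"
  have M: "0 < M"
    unfolding M_def using red(3) covol_pos by (intro mult_pos_pos add_pos_nonneg) auto
  define \<tau> where "\<tau> = \<kappa> * \<delta> / (4 * M)"
  have \<tau>: "0 < \<tau>" using red M by (simp add: \<tau>_def)
  define \<epsilon> where "\<epsilon> = sqrt (\<tau> * \<kappa> / 2)"
  have \<epsilon>: "0 < \<epsilon>" "\<epsilon>\<^sup>2 = \<tau> * \<kappa> / 2" using \<tau> red by (simp_all add: \<epsilon>_def)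
  define \<theta> where "\<theta> = \<epsilon>\<^sup>2 + \<tau> * (C\<^sup>2 * measure lebesgue S)"
  obtain R1 where R1: "0 < R1" "\<And>x s. norm x \<le> \<rho> \<Longrightarrow> \<bar>s\<bar> \<le> \<rho> \<Longrightarrow>
    \<exists>c. nrm (\<lambda>t. expo x t - trig_poly (patch s R1) c t) \<le> \<epsilon> \<and> sqrt (sqsum (patch s R1) c) \<le> C * sqrt (measure lebesgue S)"
    by (rule uniform_approx_expo[OF \<epsilon>(1), of \<rho>]) (rule that)
  obtain R2 where R2: "0 < R2" "\<And>t. 0 \<le> t \<Longrightarrow> t \<le> \<delta> \<Longrightarrow>
       (\<exists>c. nrm (\<lambda>u. expo 0 u - trig_poly (patch (- t) R2) c u) \<le> \<epsilon> \<and> sqsum (patch (- t) R2) c \<le> 1 - \<kappa>)"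
    using red(4)[OF \<epsilon>(1)] by auto
  define r where "r = max (R1 + \<rho>) R2"
  have r: "R1 + \<rho> \<le> r" "R2 \<le> r" "0 \<le> r" using R1 R2 \<rho> by (auto simp: r_def)
  have "(l - \<theta> * covol \<Gamma> + \<kappa> / 2 * \<delta>) * measure lborel (ball (0::'a) R) \<le> l * measure lborel (ball (0::'a) (R + r))"
    if R: "0 < R" for R
  proof -
    let ?b = "measure lborel (ball (0::'a) R)"
    have ineq: "((measure lebesgue S - \<theta>) * ?b) * covol \<Gamma> + \<kappa> / 2 * measure lebesgue (ball (0::'a) R \<times> {0..<\<delta>})
      \<le> 1 * measure lebesgue (ball (0::'a) (R + r) \<times> {0..<l})"
    proof (rule average_inequality[OF bounded_strip strip_sets bounded_strip strip_sets])
      fix z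
      show "(measure lebesgue S - \<theta>) * ?b + \<kappa> / 2 * card (hits (ball 0 R \<times> {0..<\<delta>}) z)
        \<le> 1 * real (card (hits (ball 0 (R + r) \<times> {0..<l}) z))"
        unfolding \<theta>_def
        by (rule frame_local_inequality[OF R1(2) \<rho>(2) R2(2)]) (use \<epsilon> \<tau> red r R in auto)
    qed
    have eq: "((measure lebesgue S - \<theta>) * ?b) * covol \<Gamma> = (l - \<theta> * covol \<Gamma>) * ?b"
      unfolding critical[symmetric] by (simp add: algebra_simps)
    have m1: "measure lebesgue (ball (0::'a) R \<times> {0..<\<delta>}) = ?b * \<delta>"
      using measure_ball_strip[of 0 \<delta> R, where 'a = 'a] red by simp
    have m2: "measure lebesgue (ball (0::'a) (R + r) \<times> {0..<l}) = measure lborel (ball (0::'a) (R + r)) * l"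
      using measure_ball_strip[of 0 l "R + r", where 'a = 'a] l_pos by simp
    from ineq[unfolded eq m1 m2] show ?thesis by (simp add: algebra_simps)
  qed
  from ball_volume_limit[OF this r(3)]
  have "\<kappa> / 2 * \<delta> \<le> \<theta> * covol \<Gamma>" by simp
  also have "\<theta> * covol \<Gamma> = \<tau> * M" by (simp add: \<theta>_def \<epsilon> M_def algebra_simps)
  also have "\<dots> = \<kappa> * \<delta> / 4" using M by (simp add: \<tau>_def)
  finally show False using red by simp
qed

end


section \<open>From families of exponentials to finite inequalities\<close>

lemma Riemann_measurable_imp_Riemann_set:
  assumes "Riemann_measurable S"
  shows "Riemann_set S"
proof
  show "bounded S" using assms by (simp add: Riemann_measurable_def)
  show null: "emeasure lebesgue (frontier S) = 0" using assms by (simp add: Riemann_measurable_def)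
  have "negligible (frontier S)"
    using null by (auto simp: negligible_iff_null_sets intro!: null_setsI)
  then have "negligible (S \<inter> frontier S)" by (rule negligible_subset) auto
  then have "S \<inter> frontier S \<in> sets lebesgue" by (rule negligible_imp_sets)
  moreover have "interior S \<in> sets lebesgue" by simp
  moreover have "S = interior S \<union> (S \<inter> frontier S)"
    using interior_subset closure_subset by (auto simp: frontier_def)
  ultimately show "S \<in> sets lebesgue" by (metis sets.Un)
qed

context bounded_measurable
begin

lemma frame_imp_lower:
  assumes low: "\<And>f. f \<in> L2 S \<Longrightarrow> (\<lambda>j. (cmod (L2_inner S f (expo j)))\<^sup>2) summable_on J"
    "\<And>f. f \<in> L2 S \<Longrightarrow> A * (L2_norm S f)\<^sup>2 \<le> (\<Sum>\<^sub>\<infinity>j\<in>J. (cmod (L2_inner S f (expo j)))\<^sup>2)"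
    and f: "cont f" and \<epsilon>: "0 < \<epsilon>"
  shows "\<exists>X. finite X \<and> X \<subseteq> J \<and> A * (nrm f)\<^sup>2 \<le> sqsum X (coef f) + \<epsilon>"
proof -
  let ?g = "\<lambda>j. (cmod (coef f j))\<^sup>2"
  note fL = cont_L2[OF f]
  have "(sum ?g \<longlongrightarrow> infsum ?g J) (finite_subsets_at_top J)"
    using has_sum_infsum[OF low(1)[OF fL]] by (simp add: has_sum_def)
  then have "\<forall>\<^sub>F X in finite_subsets_at_top J. infsum ?g J - \<epsilon> < sum ?g X"
    using \<epsilon> by (intro order_tendstoD(1)) auto
  then obtain X where X: "finite X" "X \<subseteq> J" "infsum ?g J - \<epsilon> < sum ?g X"
    unfolding eventually_finite_subsets_at_top by blast
  then show ?thesis using low(2)[OF fL] unfolding sqsum_def by (intro exI[of _ X]) auto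
qed

lemma frame_imp_Bessel:
  assumes up: "\<And>f. f \<in> L2 S \<Longrightarrow> (\<lambda>j. (cmod (L2_inner S f (expo j)))\<^sup>2) summable_on J"
    "\<And>f. f \<in> L2 S \<Longrightarrow> (\<Sum>\<^sub>\<infinity>j\<in>J. (cmod (L2_inner S f (expo j)))\<^sup>2) \<le> B * (L2_norm S f)\<^sup>2"
    and B: "0 \<le> B"
  shows "Bessel B J"
  unfolding Bessel_def
proof (intro conjI allI impI B)
  fix X f assume X: "finite X" "X \<subseteq> J" and f: "cont f"
  note fL = cont_L2[OF f]
  have "sqsum X (coef f) \<le> (\<Sum>\<^sub>\<infinity>j\<in>J. (cmod (coef f j))\<^sup>2)"
    unfolding sqsum_def by (rule finite_sum_le_infsum[OF up(1)[OF fL] X]) simp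
  then show "sqsum X (coef f) \<le> B * (nrm f)\<^sup>2" using up(2)[OF fL] by linarith
qed

text \<open>The function \<open>F\<close> is merely square integrable, so the comparison goes through equality almost
everywhere.\<close>

lemma nrm_eq_of_diff_zero:
  assumes f: "cont f" and F: "F \<in> L2 S" and 0: "L2_norm S (\<lambda>t. f t - F t) = 0"
  shows "L2_norm S F = nrm f"
proof -
  have [measurable]: "f \<in> borel_measurable (lebesgue_on S)" "F \<in> borel_measurable (lebesgue_on S)"
    and int: "integrable (lebesgue_on S) (\<lambda>t. (cmod (f t))\<^sup>2)" "integrable (lebesgue_on S) (\<lambda>t. (cmod (F t))\<^sup>2)"
    using cont_L2[OF f] F by (auto simp: L2_def)
  have "integrable (lebesgue_on S) (\<lambda>t. (cmod (f t - F t))\<^sup>2)"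
  proof (rule Bochner_Integration.integrable_bound)
    show "integrable (lebesgue_on S) (\<lambda>t. 2 * (cmod (f t))\<^sup>2 + 2 * (cmod (F t))\<^sup>2)"
      using int by simp
    have "(cmod (u - v))\<^sup>2 \<le> 2 * (cmod u)\<^sup>2 + 2 * (cmod v)\<^sup>2" for u v
    proof -
      have "(cmod (u - v))\<^sup>2 \<le> (cmod u + cmod v)\<^sup>2" by (intro power_mono norm_triangle_ineq4) simp
      also have "\<dots> \<le> 2 * (cmod u)\<^sup>2 + 2 * (cmod v)\<^sup>2"
        using sum_squares_bound[of "cmod u" "cmod v"] by (simp add: power2_sum)
      finally show ?thesis .
    qed
    then show "AE t in lebesgue_on S. norm ((cmod (f t - F t))\<^sup>2) \<le> norm (2 * (cmod (f t))\<^sup>2 + 2 * (cmod (F t))\<^sup>2)"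
      by (intro AE_I2) simp
  qed measurable
  moreover have "(LINT t|lebesgue_on S. (cmod (f t - F t))\<^sup>2) = 0"
    using 0 by (simp add: L2_norm_def)
  ultimately have "AE t in lebesgue_on S. (cmod (f t - F t))\<^sup>2 = 0"
    by (subst (asm) integral_nonneg_eq_0_iff_AE) auto
  then have "(LINT t|lebesgue_on S. (cmod (F t))\<^sup>2) = (LINT t|lebesgue_on S. (cmod (f t))\<^sup>2)"
    by (intro integral_cong_AE) auto
  then show ?thesis by (simp add: L2_norm_def)
qed

text \<open>For coefficients supported on \<open>X\<close>, the partial sums are eventually constant, so the \<open>L\<^sup>2\<close> sum is
\<open>trig_poly X c\<close> up to a null set.\<close>

lemma Riesz_imp_finite:
  assumes R: "\<And>c. c \<in> ell2 J \<Longrightarrow> \<exists>F. has_L2_sum S J (\<lambda>j t. c j * expo j t) F \<and>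
           A * (ell2_norm J c)\<^sup>2 \<le> (L2_norm S F)\<^sup>2 \<and> (L2_norm S F)\<^sup>2 \<le> B * (ell2_norm J c)\<^sup>2"
    and X: "finite X" "X \<subseteq> J"
  shows "A * sqsum X c \<le> (nrm (trig_poly X c))\<^sup>2 \<and> (nrm (trig_poly X c))\<^sup>2 \<le> B * sqsum X c"
proof -
  define d where "d = (\<lambda>j. if j \<in> X then c j else 0)"
  have "(\<lambda>j. (cmod (d j))\<^sup>2) summable_on J"
  proof (rule finite_nonzero_values_imp_summable_on)
    have "{j \<in> J. (cmod (d j))\<^sup>2 \<noteq> 0} \<subseteq> X" by (auto simp: d_def split: if_splits)
    then show "finite {j \<in> J. (cmod (d j))\<^sup>2 \<noteq> 0}" using X(1) finite_subset by blast
  qed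
  then have d: "d \<in> ell2 J" by (simp add: ell2_def)
  have "(\<Sum>\<^sub>\<infinity>j\<in>J. (cmod (d j))\<^sup>2) = (\<Sum>\<^sub>\<infinity>j\<in>X. (cmod (c j))\<^sup>2)"
    by (rule infsum_cong_neutral) (use X in \<open>auto simp: d_def\<close>)
  then have norm: "(ell2_norm J d)\<^sup>2 = sqsum X c"
    using X(1) by (simp add: ell2_norm_def sqsum_def sum_nonneg)
  obtain F where F: "has_L2_sum S J (\<lambda>j t. d j * expo j t) F"
    "A * (ell2_norm J d)\<^sup>2 \<le> (L2_norm S F)\<^sup>2" "(L2_norm S F)\<^sup>2 \<le> B * (ell2_norm J d)\<^sup>2"
    using R[OF d] by blast
  let ?h = "\<lambda>Y. L2_norm S (\<lambda>t. (\<Sum>j\<in>Y. d j * expo j t) - F t)"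
  have lim: "(?h \<longlongrightarrow> 0) (finite_subsets_at_top J)" and FL: "F \<in> L2 S"
    using F(1) by (auto simp: has_L2_sum_def)
  have "\<forall>\<^sub>F Y in finite_subsets_at_top J. ?h Y = nrm (\<lambda>t. trig_poly X c t - F t)"
    unfolding eventually_finite_subsets_at_top
  proof (intro exI[of _ X] conjI allI impI X)
    fix Y assume Y: "finite Y \<and> X \<subseteq> Y \<and> Y \<subseteq> J"
    then have "trig_poly Y d = trig_poly X c" unfolding d_def by (intro trig_poly_restrict) auto
    then show "?h Y = nrm (\<lambda>t. trig_poly X c t - F t)" by (simp add: trig_poly_def fun_eq_iff)
  qed
  then have "((\<lambda>_. nrm (\<lambda>t. trig_poly X c t - F t)) \<longlongrightarrow> 0) (finite_subsets_at_top J)"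
    using lim tendsto_cong by fastforce
  then have "nrm (\<lambda>t. trig_poly X c t - F t) = 0"
    by (simp add: tendsto_const_iff)
  then have "L2_norm S F = nrm (trig_poly X c)"
    by (intro nrm_eq_of_diff_zero FL) simp_all
  then show ?thesis using F norm by simp
qed

end

lemma cut_project_intro:
  fixes S :: "'a::euclidean_space set"
  assumes "is_lattice \<Gamma>" and inj: "inj_on fst \<Gamma>" and dense: "closure (snd ` \<Gamma>) = UNIV"
    and I: "half_open_interval I" and notin: "measure lebesgue I \<notin> snd ` \<Gamma>"
    and S: "Riemann_measurable S" and crit: "measure lebesgue I / covol \<Gamma> = measure lebesgue S"
  obtains B a l where "cut_project S \<Gamma> B I a l"
proof -
  obtain B where "independent B" "span B = UNIV" "\<Gamma> = {\<Sum>b\<in>B. of_int (k b) *\<^sub>R b | k :: 'a \<times> real \<Rightarrow> int. True}"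
    using assms(1) unfolding is_lattice_def by blast
  then interpret lattice \<Gamma> B by unfold_locales
  interpret Riemann_set S by (rule Riemann_measurable_imp_Riemann_set[OF S])
  obtain a b where ab: "a < b" "I = {a..<b} \<or> I = {a<..b}"
    using I by (auto simp: half_open_interval_def)
  have len: "measure lebesgue I = b - a"
    using ab by (auto simp: measure_completion)
  have "cut_project S \<Gamma> B I a (b - a)"
  proof unfold_locales
    show "measure lebesgue S * covol \<Gamma> = b - a"
      using crit covol_pos by (simp add: len field_simps)
  qed (use ab inj dense notin len in auto)
  then show ?thesis by (rule that)
qed

theorem theorem1p4:
  fixes \<Gamma> :: "((real ^ 'd) \<times> real) set"
    and I :: "real set"
    and \<Lambda> S :: "(real ^ 'd) set"
  assumes "is_lattice \<Gamma>"
    and "inj_on fst \<Gamma>" and "inj_on snd \<Gamma>"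
    and "closure (fst ` \<Gamma>) = UNIV" and "closure (snd ` \<Gamma>) = UNIV"
    and "half_open_interval I"
    and "measure lebesgue I \<notin> snd ` \<Gamma>"
    and "\<Lambda> = cut_project_set \<Gamma> I"
    and "Riemann_measurable S"
    and "measure lebesgue I / covol \<Gamma> = measure lebesgue S"
  shows "\<not> is_frame S \<Lambda> expo \<and> \<not> is_Riesz_sequence S \<Lambda> expo"
proof -
  obtain B a l where "cut_project S \<Gamma> B I a l"
    using cut_project_intro[OF assms(1,2,5,6,7,9,10)] by blast
  then interpret cut_project S \<Gamma> B I a l .
  show ?thesis
  proof (intro conjI notI)
    assume "is_frame S \<Lambda> expo"
    then obtain A b where Ab: "0 < A" "A \<le> b"
      and s: "\<And>f. f \<in> L2 S \<Longrightarrow> (\<lambda>j. (cmod (L2_inner S f (expo j)))\<^sup>2) summable_on \<Lambda>"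
      and low: "\<And>f. f \<in> L2 S \<Longrightarrow> A * (L2_norm S f)\<^sup>2 \<le> (\<Sum>\<^sub>\<infinity>j\<in>\<Lambda>. (cmod (L2_inner S f (expo j)))\<^sup>2)"
      and up: "\<And>f. f \<in> L2 S \<Longrightarrow> (\<Sum>\<^sub>\<infinity>j\<in>\<Lambda>. (cmod (L2_inner S f (expo j)))\<^sup>2) \<le> b * (L2_norm S f)\<^sup>2"
      unfolding is_frame_def by blast
    have "frame_model S \<Gamma> B I a l A b"
    proof unfold_locales
      show "Bessel b (model I)"
        using frame_imp_Bessel[OF s up] Ab by (simp add: assms(8))
      show "\<exists>X. finite X \<and> X \<subseteq> model I \<and> A * (nrm f)\<^sup>2 \<le> sqsum X (coef f) + \<epsilon>" if "cont f" "0 < \<epsilon>" for f \<epsilon>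
        using frame_imp_lower[OF s low that] by (simp only: assms(8))
    qed (use Ab in auto)
    then show False by (rule frame_model.no_critical_frame)
  next
    assume "is_Riesz_sequence S \<Lambda> expo"
    then obtain A b where Ab: "0 < A" "A \<le> b"
      and R: "\<And>c. c \<in> ell2 \<Lambda> \<Longrightarrow> \<exists>F. has_L2_sum S \<Lambda> (\<lambda>j t. c j * expo j t) F \<and>
           A * (ell2_norm \<Lambda> c)\<^sup>2 \<le> (L2_norm S F)\<^sup>2 \<and> (L2_norm S F)\<^sup>2 \<le> b * (ell2_norm \<Lambda> c)\<^sup>2"
      unfolding is_Riesz_sequence_def by blast
    have fin: "A * sqsum X c \<le> (nrm (trig_poly X c))\<^sup>2 \<and> (nrm (trig_poly X c))\<^sup>2 \<le> b * sqsum X c"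
      if "finite X" "X \<subseteq> model I" for X c
      using Riesz_imp_finite[OF R, of X c] that by (simp only: assms(8))
    have "Riesz_model S \<Gamma> B I a l A b"
    proof unfold_locales
      show "Bessel b (model I)"
        by (rule BesselI_synthesis) (use fin Ab in auto)
    qed (use fin Ab in auto)
    then show False by (rule Riesz_model.no_critical_Riesz)
  qed
qed

end
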